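(* For every integer $r\ge1$ and every connected constraint graph $H$ with at least one edge, there exists an activity vector $\lambda$ on $H$ for which there is exactly one simple, invariant Gibbs measure for $\lambda$ on $\hom(\mathbb{T}^r,H)$.
   Context: A constraint graph $H$ is a finite graph with node set $\{1,\dots,q\}$, possibly with loops but no multiple edges. $\mathbb{T}^r$ is the infinite connected cycle-free graph with all degrees $r+1$. $\hom(G,H)$ is the set of graph homomorphisms from the board $G$ to $H$, with the product $\sigma$-algebra. An activity vector is $\lambda=(\lambda_1,\dots,\lambda_q)$ with all $\lambda_i>0$; for finite $G$ the $\lambda$-measure on $\hom(G,H)$ gives $\varphi$ probability proportional to $\prod_v\lambda_{\varphi(v)}$. A patch is a finite set $U$ of sites, $\partial U$ the set of sites outside $U$ adjacent to $U$, $U^+=U\cup\partial U$. A probability measure $\mu$ on $\hom(G,H)$ is a Gibbs measure for $\lambda$ if for every patch $U$ and $\mu$-a.e. $\psi$, the $\mu$-conditional probability that $\varphi|_U=\psi|_U$ given $\varphi|_{G\setminus U}=\psi|_{G\setminus U}$ equals the $\lambda$-measure (on $\hom(U^+,H)$) conditional probability that $\varphi|_U=\psi|_U$ given $\varphi|_{\partial U}=\psi|_{\partial U}$. A Gibbs measure on $\hom(T,H)$, $T$ a tree, is simple if for every site $u$ and node $i$, the restrictions of $\varphi$ to the components of $T\setminus\{u\}$ are mutually independent given $\varphi(u)=i$; a measure is invariant if it is preserved by every automorphism of the board acting by precomposition. *)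

theory Defs
  imports "HOL-Probability.Probability"
begin

definition constraint_graph :: "nat \<Rightarrow> (nat \<Rightarrow> nat \<Rightarrow> bool) \<Rightarrow> bool" where
  "constraint_graph q H \<longleftrightarrow>
     (\<forall>i j. H i j \<longrightarrow> H j i) \<and> (\<forall>i j. H i j \<longrightarrow> i \<in> {1..q} \<and> j \<in> {1..q})"

definition cg_connected :: "nat \<Rightarrow> (nat \<Rightarrow> nat \<Rightarrow> bool) \<Rightarrow> bool" where
  "cg_connected q H \<longleftrightarrow> (\<forall>i\<in>{1..q}. \<forall>j\<in>{1..q}. H\<^sup>*\<^sup>* i j)"

definition hom_set :: "'a set \<Rightarrow> ('a \<Rightarrow> 'a \<Rightarrow> bool) \<Rightarrow> nat \<Rightarrow> (nat \<Rightarrow> nat \<Rightarrow> bool) \<Rightarrow> ('a \<Rightarrow> nat) set" where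
  "hom_set W E q H = {\<phi> \<in> W \<rightarrow>\<^sub>E {1..q}. \<forall>x\<in>W. \<forall>y\<in>W. E x y \<longrightarrow> H (\<phi> x) (\<phi> y)}"

definition hom_space :: "'a set \<Rightarrow> ('a \<Rightarrow> 'a \<Rightarrow> bool) \<Rightarrow> nat \<Rightarrow> (nat \<Rightarrow> nat \<Rightarrow> bool) \<Rightarrow> ('a \<Rightarrow> nat) measure" where
  "hom_space V E q H = restrict_space (PiM V (\<lambda>_. count_space {1..q})) (hom_set V E q H)"

definition bdry :: "'a set \<Rightarrow> ('a \<Rightarrow> 'a \<Rightarrow> bool) \<Rightarrow> 'a set \<Rightarrow> 'a set" where
  "bdry V E U = {x \<in> V - U. \<exists>u\<in>U. E x u}"

definition lam_weight :: "(nat \<Rightarrow> real) \<Rightarrow> 'a set \<Rightarrow> ('a \<Rightarrow> nat) \<Rightarrow> real" where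
  "lam_weight lam W c = (\<Prod>v\<in>W. lam (c v))"

definition lam_prob :: "'a set \<Rightarrow> ('a \<Rightarrow> 'a \<Rightarrow> bool) \<Rightarrow> nat \<Rightarrow> (nat \<Rightarrow> nat \<Rightarrow> bool) \<Rightarrow> (nat \<Rightarrow> real)
    \<Rightarrow> ('a \<Rightarrow> nat) set \<Rightarrow> real" where
  "lam_prob W E q H lam S =
     (\<Sum>c\<in>hom_set W E q H \<inter> S. lam_weight lam W c) / (\<Sum>c\<in>hom_set W E q H. lam_weight lam W c)"

definition lam_cond :: "'a set \<Rightarrow> ('a \<Rightarrow> 'a \<Rightarrow> bool) \<Rightarrow> nat \<Rightarrow> (nat \<Rightarrow> nat \<Rightarrow> bool) \<Rightarrow> (nat \<Rightarrow> real)
    \<Rightarrow> ('a \<Rightarrow> nat) set \<Rightarrow> ('a \<Rightarrow> nat) set \<Rightarrow> real" where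
  "lam_cond W E q H lam A B = lam_prob W E q H lam (A \<inter> B) / lam_prob W E q H lam B"

definition outside_algebra :: "'a set \<Rightarrow> ('a \<Rightarrow> 'a \<Rightarrow> bool) \<Rightarrow> nat \<Rightarrow> (nat \<Rightarrow> nat \<Rightarrow> bool) \<Rightarrow> 'a set
    \<Rightarrow> ('a \<Rightarrow> nat) measure" where
  "outside_algebra V E q H U =
     vimage_algebra (space (hom_space V E q H)) (\<lambda>\<phi>. restrict \<phi> (V - U)) (PiM (V - U) (\<lambda>_. count_space {1..q}))"

definition is_gibbs :: "'a set \<Rightarrow> ('a \<Rightarrow> 'a \<Rightarrow> bool) \<Rightarrow> nat \<Rightarrow> (nat \<Rightarrow> nat \<Rightarrow> bool) \<Rightarrow> (nat \<Rightarrow> real)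
    \<Rightarrow> ('a \<Rightarrow> nat) measure \<Rightarrow> bool" where
  "is_gibbs V E q H lam \<mu> \<longleftrightarrow>
     prob_space \<mu> \<and> sets \<mu> = sets (hom_space V E q H) \<and>
     (\<forall>U. finite U \<and> U \<subseteq> V \<longrightarrow>
        (AE \<psi> in \<mu>.
           real_cond_exp \<mu> (outside_algebra V E q H U)
             (indicator {\<phi> \<in> space \<mu>. \<forall>v\<in>U. \<phi> v = \<psi> v}) \<psi>
           = lam_cond (U \<union> bdry V E U) E q H lam
               {c. \<forall>v\<in>U. c v = \<psi> v} {c. \<forall>v\<in>bdry V E U. c v = \<psi> v}))"

definition components_without :: "'a set \<Rightarrow> ('a \<Rightarrow> 'a \<Rightarrow> bool) \<Rightarrow> 'a \<Rightarrow> 'a set set" where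
  "components_without V E u =
     {C. \<exists>w\<in>V - {u}. C = {x \<in> V - {u}.
        (\<lambda>a b. a \<in> V - {u} \<and> b \<in> V - {u} \<and> E a b)\<^sup>*\<^sup>* w x}}"

definition is_simple :: "'a set \<Rightarrow> ('a \<Rightarrow> 'a \<Rightarrow> bool) \<Rightarrow> nat \<Rightarrow> (nat \<Rightarrow> nat \<Rightarrow> bool)
    \<Rightarrow> ('a \<Rightarrow> nat) measure \<Rightarrow> bool" where
  "is_simple V E q H \<mu> \<longleftrightarrow>
     (\<forall>u\<in>V. \<forall>i\<in>{1..q}. measure \<mu> {\<phi> \<in> space \<mu>. \<phi> u = i} \<noteq> 0 \<longrightarrow>
        prob_space.indep_vars (uniform_measure \<mu> {\<phi> \<in> space \<mu>. \<phi> u = i})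
          (\<lambda>C. PiM C (\<lambda>_. count_space {1..q})) (\<lambda>C \<phi>. restrict \<phi> C)
          (components_without V E u))"

definition board_automorphism :: "'a set \<Rightarrow> ('a \<Rightarrow> 'a \<Rightarrow> bool) \<Rightarrow> ('a \<Rightarrow> 'a) \<Rightarrow> bool" where
  "board_automorphism V E g \<longleftrightarrow> bij_betw g V V \<and> (\<forall>x\<in>V. \<forall>y\<in>V. E x y \<longleftrightarrow> E (g x) (g y))"

definition is_invariant :: "'a set \<Rightarrow> ('a \<Rightarrow> 'a \<Rightarrow> bool) \<Rightarrow> nat \<Rightarrow> (nat \<Rightarrow> nat \<Rightarrow> bool)
    \<Rightarrow> ('a \<Rightarrow> nat) measure \<Rightarrow> bool" where
  "is_invariant V E q H \<mu> \<longleftrightarrow>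
     (\<forall>g. board_automorphism V E g \<longrightarrow>
        distr \<mu> (hom_space V E q H) (\<lambda>\<phi>. restrict (\<phi> \<circ> g) V) = \<mu>)"

text \<open>Vertices: reduced words over the letters {0..r} (no two consecutive equal letters);
  v and a#v are adjacent. This is the Cayley graph of the free product of r+1 copies
  of Z/2, i.e. the infinite tree with all degrees r+1.\<close>

definition tree_V :: "nat \<Rightarrow> nat list set" where
  "tree_V r = {xs. set xs \<subseteq> {..r} \<and> successively (\<noteq>) xs}"

definition tree_E :: "nat list \<Rightarrow> nat list \<Rightarrow> bool" where
  "tree_E xs ys \<longleftrightarrow> (\<exists>a. xs = a # ys) \<or> (\<exists>a. ys = a # xs)"

end

theory Submission
  imports Defs "HOL-Library.Sublist" "HOL-Combinatorics.Transposition"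
begin

text \<open>A simple invariant Gibbs measure is a branching random walk on \<open>H\<close>: independence and invariance
  express its marginals on finite subtrees through the symmetric edge distribution \<open>p\<close>, and comparing
  the star around a site with the Gibbs property forces \<open>p(i, j) = \<kappa> h\<^sub>i h\<^sub>j\<close> on the edges of \<open>H\<close>, where
  \<open>h\<close> is a positive solution of \<open>\<kappa> h\<^sub>i = \<lambda>\<^sub>i (\<Sum>j\<sim>i. h\<^sub>j)\<^sup>r\<close>. Conversely, such a solution defines a measure
  of this kind. So it suffices to find \<open>\<lambda>\<close> for which the solution is unique up to scaling. Fix a loop
  or, if there is none, an edge \<open>ab\<close>, and let the activities decay fast with the distance to it.
  Then any solution is concentrated on \<open>ab\<close>. All other weights are small and vary little with
  the solution, and the ratio of the weights of \<open>a\<close> and \<open>b\<close> solves a monotone equation depending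
  only on these small weights; hence the difference of two solutions normalised at \<open>a\<close> is bounded
  by a fraction of itself.\<close>

section \<open>Activities with a unique weight vector\<close>

text \<open>The weights are chosen before the activities: prescribing \<open>w\<close> by distance
  and setting \<open>lam = w / nsum w ^ r\<close> gives a solution for free, so only uniqueness
  costs work. Uniqueness uses no more of \<open>lam\<close> than the bounds
  \<open>\<epsilon> ^ d / Q \<le> lam \<le> \<epsilon> ^ d\<close>, and all other constants are
  independent of \<epsilon>, which can therefore be fixed last. The obstacle is the edge
  \<open>ab\<close> itself, where the activities are of order 1 and nothing contracts. With a loop
  it is a single node, removed by the normalisation. Without loops, the neighbours of
  \<open>a\<close> other than \<open>b\<close>, and of \<open>b\<close> other than \<open>a\<close>,
  lie off the edge, so these two weights meet only each other and small terms. A loop at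
  \<open>b\<close> would put the unknown weight of \<open>b\<close> on both sides of its own
  equation and spoil the monotonicity; hence a loop is taken whenever there is one. For an arbitrary
  measure the node probabilities might vanish a priori; their positivity comes out of the comparison
  on the star. Until then all identities between marginals are kept in cross-multiplied
  form.\<close>

lemma abs_power_diff_le:
  fixes x y B :: real
  assumes "\<bar>x\<bar> \<le> B" "\<bar>y\<bar> \<le> B" "1 \<le> B"
  shows "\<bar>x ^ n - y ^ n\<bar> \<le> n * B ^ n * \<bar>x - y\<bar>"
proof (induction n)
  case (Suc n)
  have yn: "\<bar>y ^ n\<bar> \<le> B ^ n"
    using assms by (simp add: power_abs power_mono)
  have "x ^ Suc n - y ^ Suc n = x * (x ^ n - y ^ n) + y ^ n * (x - y)"
    by (simp add: algebra_simps)
  then have "\<bar>x ^ Suc n - y ^ Suc n\<bar> \<le> \<bar>x\<bar> * \<bar>x ^ n - y ^ n\<bar> + \<bar>y ^ n\<bar> * \<bar>x - y\<bar>"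
    by (metis abs_mult abs_triangle_ineq)
  also have "\<dots> \<le> B * (n * B ^ n * \<bar>x - y\<bar>) + B ^ Suc n * \<bar>x - y\<bar>"
  proof (intro add_mono mult_mono Suc)
    show "\<bar>y ^ n\<bar> \<le> B ^ Suc n"
      using yn assms(3) by (metis (full_types) le_SucI order.refl order_trans power_increasing)
  qed (use assms in auto)
  also have "\<dots> = Suc n * B ^ Suc n * \<bar>x - y\<bar>"
    by (simp add: algebra_simps)
  finally show ?case .
qed simp

text \<open>For fixed \<open>s\<close>, the map \<open>x \<mapsto> x * (x + s) ^ r\<close> increases
  with slope at least \<open>m ^ r\<close>, because already the outer factor contributes
  \<open>(x + s) ^ r\<close>. Exchanging \<open>s\<close> for \<open>t\<close> costs the last
  summand. It is applied to the equation for the weight of \<open>b\<close>.\<close>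

lemma implicit_root_lipschitz:
  fixes x y s t m K :: real
  assumes "0 < x" "0 < y" "0 \<le> s" "0 \<le> t" "0 < m" "1 \<le> K" "x \<le> X" "y \<le> X"
    and "m \<le> x + s" "m \<le> y + t" "x + s \<le> K" "y + t \<le> K"
  shows "\<bar>x - y\<bar> * m ^ r \<le> \<bar>x * (x + s) ^ r - y * (y + t) ^ r\<bar> + X * (r * K ^ r * \<bar>s - t\<bar>)"
proof -
  \<comment> \<open>The claim is symmetric under exchanging \<open>(x, s)\<close> with
    \<open>(y, t)\<close>, so it is proved for \<open>y \<le> x\<close> with fresh variables and
    used in both orders.\<close>
  have main: "(x - y) * m ^ r \<le> \<bar>x * (x + s) ^ r - y * (y + t) ^ r\<bar> + X * (r * K ^ r * \<bar>s - t\<bar>)"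
    if "y \<le> x" "0 < x" "0 < y" "0 \<le> s" "0 \<le> t" "y \<le> X"
      "m \<le> x + s" "x + s \<le> K" "y + t \<le> K" for x y s t
  proof -
    have "(x - y) * m ^ r \<le> (x - y) * (x + s) ^ r"
      using that assms by (intro mult_left_mono power_mono) auto
    moreover have "y * (y + s) ^ r \<le> y * (x + s) ^ r"
      using that by (intro mult_left_mono power_mono) auto
    moreover have "\<bar>(y + s) ^ r - (y + t) ^ r\<bar> \<le> r * K ^ r * \<bar>(y + s) - (y + t)\<bar>"
      using that assms by (intro abs_power_diff_le) auto
    then have "y * ((y + t) ^ r - (y + s) ^ r) \<le> y * (r * K ^ r * \<bar>s - t\<bar>)"
      using that by (intro mult_left_mono) auto
    moreover have "y * (r * K ^ r * \<bar>s - t\<bar>) \<le> X * (r * K ^ r * \<bar>s - t\<bar>)"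
      using that assms by (intro mult_right_mono) auto
    ultimately show ?thesis
      by (simp add: algebra_simps)
  qed
  show ?thesis
  proof (cases "y \<le> x")
    case True
    with main[of y x s t] assms show ?thesis by simp
  next
    case False
    with main[of x y t s] assms show ?thesis by (simp add: abs_minus_commute)
  qed
qed

section \<open>Constraint graphs and the weight equation\<close>

locale cgraph =
  fixes q :: nat and H :: "nat \<Rightarrow> nat \<Rightarrow> bool"
  assumes graph: "constraint_graph q H"
    and connected: "cg_connected q H"
    and edge: "\<exists>i j. H i j"
begin

lemma H_sym: "H i j \<Longrightarrow> H j i"
  and H_in: "H i j \<Longrightarrow> i \<in> {1..q}" "H i j \<Longrightarrow> j \<in> {1..q}"
  using graph unfolding constraint_graph_def by blast+

lemma q_ge_1: "1 \<le> q"
  using edge H_in by fastforce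

text \<open>A walk from \<open>i\<close> to an end of a given edge has a first step, unless
  \<open>i\<close> is that end. This is where an isolated single node is excluded.\<close>

lemma ex_neighbour: "i \<in> {1..q} \<Longrightarrow> \<exists>j. H i j"
proof -
  assume i: "i \<in> {1..q}"
  obtain a b where ab: "H a b" using edge by blast
  then have "H\<^sup>*\<^sup>* i a"
    using connected i H_in[OF ab] by (auto simp: cg_connected_def)
  then show ?thesis
    using ab by (cases rule: converse_rtranclpE) auto
qed

definition nbs :: "nat \<Rightarrow> nat set" where
  "nbs i = {j \<in> {1..q}. H i j}"

lemma finite_nbs [simp]: "finite (nbs i)"
  by (simp add: nbs_def)

lemma nbs_subset: "nbs i \<subseteq> {1..q}"
  and mem_nbs [simp]: "j \<in> nbs i \<longleftrightarrow> H i j"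
  unfolding nbs_def using H_in(2) by blast+

definition nsum :: "(nat \<Rightarrow> real) \<Rightarrow> nat \<Rightarrow> real" where
  "nsum w i = (\<Sum>j\<in>nbs i. w j)"

lemma nsum_ge:
  assumes "\<forall>i\<in>{1..q}. 0 \<le> w i" "H i j"
  shows "w j \<le> nsum w i"
  unfolding nsum_def using assms H_in by (intro member_le_sum) auto

lemma nsum_pos:
  assumes "\<forall>i\<in>{1..q}. 0 < w i" "i \<in> {1..q}"
  shows "0 < nsum w i"
proof -
  obtain j where j: "H i j" using ex_neighbour assms by blast
  then have "w j \<le> nsum w i" using assms by (intro nsum_ge) auto
  then show ?thesis using j assms(1) H_in(2) by fastforce
qed

lemma sum_nbs_le:
  assumes "\<forall>i\<in>{1..q}. f i \<le> M" "0 \<le> M" "A \<subseteq> nbs i"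
  shows "(\<Sum>j\<in>A. f j) \<le> real q * M"
proof -
  have A: "A \<subseteq> {1..q}" using assms nbs_subset by blast
  have "(\<Sum>j\<in>A. f j) \<le> real (card A) * M"
    using assms A by (intro sum_bounded_above) auto
  also have "\<dots> \<le> real q * M"
    using A assms card_mono[of "{1..q}" A] by (intro mult_right_mono) auto
  finally show ?thesis .
qed

lemma nsum_le: "\<forall>i\<in>{1..q}. w i \<le> M \<Longrightarrow> 0 \<le> M \<Longrightarrow> nsum w i \<le> real q * M"
  unfolding nsum_def by (rule sum_nbs_le) auto

text \<open>The fixed-point equation relating the node weights of a branching random walk on \<open>H\<close>
  to the activities of the corresponding Gibbs measure, up to an overall factor.\<close>

definition is_weight :: "nat \<Rightarrow> (nat \<Rightarrow> real) \<Rightarrow> (nat \<Rightarrow> real) \<Rightarrow> bool" where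
  "is_weight r lam w \<longleftrightarrow>
     (\<forall>i\<in>{1..q}. 0 < w i) \<and> (\<exists>c>0. \<forall>i\<in>{1..q}. c * w i = lam i * nsum w i ^ r)"

lemma is_weight_scale:
  assumes "is_weight r lam w" "0 < t"
  shows "is_weight r lam (\<lambda>i. t * w i)"
proof -
  obtain c where c: "c > 0" "\<forall>i\<in>{1..q}. c * w i = lam i * nsum w i ^ r"
    using assms by (auto simp: is_weight_def)
  have n: "nsum (\<lambda>i. t * w i) i = t * nsum w i" for i
    by (simp add: nsum_def sum_distrib_left)
  have "c * t ^ r / t * (t * w i) = lam i * nsum (\<lambda>i. t * w i) i ^ r" if "i \<in> {1..q}" for i
    using c(2) that assms(2) unfolding n by (auto simp: field_simps)
  then show ?thesis
    using assms c(1) unfolding is_weight_def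
    by (intro conjI exI[of _ "c * t ^ r / t"]) auto
qed

text \<open>The second clause supplies the neighbour nearer to \<open>S\<close> that dominates a
  node; the third, used when the activities are chosen, bounds all neighbours of a node at
  once.\<close>

lemma ex_distance:
  assumes "S \<subseteq> {1..q}" "S \<noteq> {}"
  obtains d :: "nat \<Rightarrow> nat" where
    "\<And>i. i \<in> {1..q} \<Longrightarrow> d i = 0 \<longleftrightarrow> i \<in> S"
    "\<And>i n. i \<in> {1..q} \<Longrightarrow> d i = Suc n \<Longrightarrow> \<exists>m\<in>{1..q}. H i m \<and> d m = n"
    "\<And>i j. H i j \<Longrightarrow> d j \<le> Suc (d i)"
proof -
  define R where "R n i \<longleftrightarrow> (\<exists>s\<in>S. (H ^^ n) s i)" for n i
  define d where "d i = (LEAST n. R n i)" for i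
  have ex: "\<exists>n. R n i" if "i \<in> {1..q}" for i
  proof -
    obtain s where s: "s \<in> S" using assms by blast
    then have "H\<^sup>*\<^sup>* s i"
      using connected that assms by (auto simp: cg_connected_def)
    then show ?thesis using s unfolding R_def by (auto simp: rtranclp_power)
  qed
  have Rd: "R (d i) i" if "i \<in> {1..q}" for i
    unfolding d_def using ex[OF that] by (rule LeastI_ex)
  have step: "d j \<le> Suc (d i)" if "H i j" for i j
  proof -
    have "R (d i) i" using that H_in Rd by blast
    then have "R (Suc (d i)) j" using that unfolding R_def by (auto intro: relpowp_Suc_I)
    then show ?thesis unfolding d_def by (rule Least_le)
  qed
  show thesis
  proof
    fix i assume i: "i \<in> {1..q}"
    show "d i = 0 \<longleftrightarrow> i \<in> S"
    proof
      assume "d i = 0" then show "i \<in> S" using Rd[OF i] by (auto simp: R_def)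
    next
      assume "i \<in> S" then have "R 0 i" by (auto simp: R_def)
      then have "d i \<le> 0" unfolding d_def by (rule Least_le)
      then show "d i = 0" by simp
    qed
  next
    fix i n assume i: "i \<in> {1..q}" and n: "d i = Suc n"
    then have "R (Suc n) i" using Rd by metis
    then obtain m where m: "R n m" "H m i" unfolding R_def by auto
    have "d m \<le> n" unfolding d_def using m(1) by (rule Least_le)
    moreover have "n \<le> d m" using step[OF m(2)] n by simp
    ultimately show "\<exists>m\<in>{1..q}. H i m \<and> d m = n"
      using H_sym[OF m(2)] H_in(1)[OF m(2)] by (intro bexI[of _ m]) auto
  qed (rule step)
qed

end

text \<open>The activities decay with the distance \<open>d\<close> to the edge \<open>ab\<close>. For two solutions normalised at
  \<open>a\<close>, \<open>C1 * \<epsilon>\<close> and \<open>C2 * \<epsilon>\<close> bound their difference, relative to its maximum, at the nodes off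
  the edge and at \<open>b\<close>. A loop is treated as the case \<open>a = b\<close>.\<close>

locale hierarchy = cgraph +
  fixes r a b :: nat and d :: "nat \<Rightarrow> nat" and lam :: "nat \<Rightarrow> real" and \<epsilon> Q K C1 C2 :: real
  assumes r: "1 \<le> r" and ab: "H a b" and loop: "a = b \<or> (\<forall>i. \<not> H i i)"
    and d0: "\<And>i. i \<in> {1..q} \<Longrightarrow> d i = 0 \<longleftrightarrow> i \<in> {a, b}"
    and dS: "\<And>i n. i \<in> {1..q} \<Longrightarrow> d i = Suc n \<Longrightarrow> \<exists>m\<in>{1..q}. H i m \<and> d m = n"
    and lam_ge: "\<And>i. i \<in> {1..q} \<Longrightarrow> \<epsilon> ^ d i / Q \<le> lam i"
    and lam_le: "\<And>i. i \<in> {1..q} \<Longrightarrow> lam i \<le> \<epsilon> ^ d i"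
    and Q: "Q = real q ^ r" and K: "K = real q * Q\<^sup>2"
    and C1: "C1 = Q * (r * (K * Q\<^sup>2) ^ r * (q * Q\<^sup>2 + K * q * Q ^ 4))"
    and C2: "C2 = Q\<^sup>2 ^ r * ((Q + Q\<^sup>2) * (r * K ^ r * (q * C1)))"
    and eps: "0 < \<epsilon>" "\<epsilon> < 1" "\<epsilon> * Q\<^sup>2 < 1" "C1 * \<epsilon> < 1" "C2 * \<epsilon> < 1"
begin

lemma Q_ge_1: "1 \<le> Q" and K_ge_1: "1 \<le> K" and C1_nonneg: "0 \<le> C1"
proof -
  show *: "1 \<le> Q" using q_ge_1 unfolding Q by simp
  then have "1 * 1 \<le> K" using q_ge_1 unfolding K by (intro mult_mono) auto
  then show "1 \<le> K" by simp
  then show "0 \<le> C1" using * unfolding C1 by auto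
qed

lemma lam_pos: "i \<in> {1..q} \<Longrightarrow> 0 < lam i"
proof -
  assume i: "i \<in> {1..q}"
  have "0 < \<epsilon> ^ d i / Q" using eps(1) Q_ge_1 by (intro divide_pos_pos zero_less_power) auto
  then show ?thesis using lam_ge[OF i] by linarith
qed

lemma a_in: "a \<in> {1..q}" and b_in: "b \<in> {1..q}"
  using ab H_in by auto

text \<open>Let the maximum sit at \<open>k\<close> at distance \<open>n + 1\<close>, with a
  neighbour \<open>m\<close> at distance \<open>n\<close>. All neighbours of \<open>k\<close> weigh
  at most \<open>w k\<close>, so \<open>c * w k \<le> \<epsilon> ^ (n + 1) * Q * w k ^ r\<close>;
  and \<open>m\<close> sees \<open>k\<close>, so
  \<open>c * w m \<ge> \<epsilon> ^ n / Q * w k ^ r\<close>. Hence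
  \<open>w k \<le> \<epsilon> * Q\<^sup>2 * w m < w m\<close>, a contradiction.\<close>

lemma weight_max:
  assumes w: "is_weight r lam w"
  obtains s where "s \<in> {a, b}" "\<forall>i\<in>{1..q}. w i \<le> w s"
proof -
  obtain c where c: "c > 0" "\<forall>i\<in>{1..q}. c * w i = lam i * nsum w i ^ r"
    and pos: "\<forall>i\<in>{1..q}. 0 < w i"
    using w by (auto simp: is_weight_def)
  have ne: "{1..q} \<noteq> {}" using q_ge_1 by simp
  obtain k where k: "k \<in> {1..q}" "\<forall>i\<in>{1..q}. w i \<le> w k"
    using finite_has_maximal[of "w ` {1..q}"] ne by (auto) (metis linorder_linear)
  have wk: "0 < w k" using k pos by auto
  have "d k = 0"
  proof (rule ccontr)
    assume "d k \<noteq> 0"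
    then obtain n where n: "d k = Suc n" by (cases "d k") auto
    then obtain m where m: "m \<in> {1..q}" "H k m" "d m = n" using dS k by blast
    have "c * w k \<le> \<epsilon> ^ Suc n * (real q * w k) ^ r"
    proof -
      have "nsum w k ^ r \<le> (real q * w k) ^ r"
        using nsum_le[of w "w k" k] k wk nsum_pos[OF pos k(1)] by (intro power_mono) auto
      moreover have "lam k \<le> \<epsilon> ^ Suc n" using lam_le k n by metis
      ultimately show ?thesis
        using c(2) k(1) lam_pos eps nsum_pos[OF pos k(1)]
        by (auto intro!: mult_mono simp del: power_Suc)
    qed
    also have "\<dots> = \<epsilon> * Q\<^sup>2 * (\<epsilon> ^ n / Q * w k ^ r)"
      using Q_ge_1 by (simp add: Q power_mult_distrib power2_eq_square)
    also have "\<epsilon> ^ n / Q * w k ^ r \<le> lam m * nsum w m ^ r"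
    proof (intro mult_mono power_mono)
      show "\<epsilon> ^ n / Q \<le> lam m" using lam_ge m by blast
      show "w k \<le> nsum w m" using pos m H_sym by (intro nsum_ge) (auto simp: less_imp_le)
      show "0 \<le> lam m" using lam_pos m by (simp add: less_imp_le)
    qed (use wk in auto)
    also have "lam m * nsum w m ^ r = c * w m" using c(2) m(1) by metis
    also have "\<epsilon> * Q\<^sup>2 * (c * w m) < 1 * (c * w m)"
      using eps c(1) pos m(1) by (intro mult_strict_right_mono mult_pos_pos) auto
    also have "\<dots> \<le> c * w k" using k m(1) c(1) by (simp only: mult_1 mult_left_mono less_imp_le)
    finally show False using eps Q_ge_1 by (auto simp: mult_left_mono)
  qed
  then show thesis using that k d0 by blast
qed

text \<open>The comparison of \<open>weight_max\<close>, made between the two ends of the edge, has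
  no factor \<epsilon>: the maximal end exceeds the other by at most \<open>Q\<^sup>2\<close>. With
  \<open>w a = 1\<close> this bounds everything independently of \<epsilon>.\<close>

lemma weight_bounds:
  assumes w: "is_weight r lam w" and a1: "w a = 1"
  shows "\<forall>i\<in>{1..q}. w i \<le> Q\<^sup>2" and "1 / Q\<^sup>2 \<le> w b"
proof -
  obtain c where c: "c > 0" "\<forall>i\<in>{1..q}. c * w i = lam i * nsum w i ^ r"
    and pos: "\<forall>i\<in>{1..q}. 0 < w i"
    using w by (auto simp: is_weight_def)
  obtain s where s: "s \<in> {a, b}" "\<forall>i\<in>{1..q}. w i \<le> w s"
    using weight_max[OF w] .
  have *: "w s \<le> Q\<^sup>2 * w t" if t: "t \<in> {a, b}" "H t s" for t
  proof -
    have st: "s \<in> {1..q}" "t \<in> {1..q}" using that H_in by auto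
    have ws: "0 < w s" using pos st by auto
    have "d s = 0" "d t = 0" using d0 st s that by auto
    then have ls: "lam s \<le> 1" and lt: "1 / Q \<le> lam t"
      using lam_le[OF st(1)] lam_ge[OF st(2)] by auto
    have "c * w s \<le> 1 * (real q * w s) ^ r"
    proof -
      have "nsum w s ^ r \<le> (real q * w s) ^ r"
        using nsum_le[of w "w s" s] s ws nsum_pos[OF pos st(1)] by (intro power_mono) auto
      then show ?thesis
        using c(2) st(1) ls nsum_pos[OF pos st(1)] ws
          mult_mono[of "lam s" 1 "nsum w s ^ r" "(real q * w s) ^ r"] by simp
    qed
    also have "\<dots> = Q\<^sup>2 * (1 / Q * w s ^ r)"
      using Q_ge_1 by (simp add: Q power_mult_distrib power2_eq_square)
    also have "\<dots> \<le> Q\<^sup>2 * (lam t * nsum w t ^ r)"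
    proof (intro mult_left_mono mult_mono power_mono lt)
      show "w s \<le> nsum w t" using pos that by (intro nsum_ge) (auto simp: less_imp_le)
      show "0 \<le> lam t" using lam_pos st by (simp add: less_imp_le)
    qed (use ws in auto)
    also have "\<dots> = c * (Q\<^sup>2 * w t)" using c st by auto
    finally show ?thesis using c by simp
  qed
  have Q2: "1 \<le> Q\<^sup>2" using Q_ge_1 by simp
  have ba: "H b a" using ab H_sym by blast
  have "w s \<le> Q\<^sup>2 \<and> 1 / Q\<^sup>2 \<le> w b"
  proof (cases "s = a")
    case True
    then have "1 \<le> Q\<^sup>2 * w b" using *[of b] ba a1 by auto
    moreover have "0 < Q\<^sup>2" using Q2 by linarith
    ultimately show ?thesis using True a1 Q2 by (simp add: field_simps)
  next
    case False
    then have sb: "s = b" using s by auto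
    then have "w b \<le> Q\<^sup>2" using *[of a] ab a1 by auto
    moreover have "1 \<le> w b" using s sb a_in a1 by metis
    moreover have "1 / Q\<^sup>2 \<le> 1" using Q2 by (simp add: divide_le_eq_1)
    ultimately show ?thesis unfolding sb by linarith
  qed
  then show "\<forall>i\<in>{1..q}. w i \<le> Q\<^sup>2" and "1 / Q\<^sup>2 \<le> w b"
    using s by (auto intro: order_trans)
qed

text \<open>Dividing by the equation at \<open>a\<close>, where the weight is 1, eliminates the
  unknown factor \<open>c\<close>.\<close>

lemma weight_ratio:
  assumes w: "is_weight r lam w" and a1: "w a = 1" and i: "i \<in> {1..q}"
  shows "w i = lam i / lam a * (nsum w i / nsum w a) ^ r"
proof -
  obtain c where c: "c > 0" "\<forall>i\<in>{1..q}. c * w i = lam i * nsum w i ^ r"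
    and pos: "\<forall>i\<in>{1..q}. 0 < w i"
    using w by (auto simp: is_weight_def)
  have "c = lam a * nsum w a ^ r" using c a_in a1 by (metis mult.right_neutral)
  moreover have "0 < nsum w a" "0 < lam a" using nsum_pos[OF pos a_in] lam_pos[OF a_in] by auto
  ultimately show ?thesis using c i
    by (simp add: field_simps power_divide)
qed

text \<open>Each coordinate of the difference is bounded by its maximum \<open>D\<close> times
  \<open>C1 * \<epsilon>\<close> or \<open>C2 * \<epsilon>\<close>, both factors being below 1, or
  it is the coordinate \<open>a\<close>, where the difference is 0. Hence
  \<open>D = 0\<close>.\<close>

lemma normalised_weight_unique:
  assumes w: "is_weight r lam w" "w a = 1" and v: "is_weight r lam v" "v a = 1"
  shows "\<forall>i\<in>{1..q}. w i = v i"
proof -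
  define D where "D = Max ((\<lambda>i. \<bar>w i - v i\<bar>) ` {1..q})"
  have ne: "{1..q} \<noteq> {}" using q_ge_1 by simp
  have D: "\<bar>w i - v i\<bar> \<le> D" if "i \<in> {1..q}" for i
    unfolding D_def using that by (intro Max_ge) auto
  have D0: "0 \<le> D" using D[OF a_in] by simp
  have diff_sum: "\<bar>(\<Sum>j\<in>A. w j) - (\<Sum>j\<in>A. v j)\<bar> \<le> real q * M"
    if "\<And>j. j \<in> A \<Longrightarrow> \<bar>w j - v j\<bar> \<le> M" "A \<subseteq> {1..q}" "0 \<le> M" for A M
  proof -
    have "\<bar>(\<Sum>j\<in>A. w j) - (\<Sum>j\<in>A. v j)\<bar> \<le> (\<Sum>j\<in>A. \<bar>w j - v j\<bar>)"
      unfolding sum_subtractf[symmetric] by (rule sum_abs)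
    also have "\<dots> \<le> real (card A) * M"
      using that by (intro sum_bounded_above) auto
    also have "\<dots> \<le> real q * M"
      using that card_mono[of "{1..q}" A] by (intro mult_right_mono) auto
    finally show ?thesis .
  qed
  have Q2: "0 < Q\<^sup>2" using Q_ge_1 by simp
  have facts: "0 < u i" "nsum u i \<le> K" "0 < nsum u i" "1 / Q\<^sup>2 \<le> nsum u a"
      "1 / nsum u a \<le> Q\<^sup>2" "u i \<le> Q\<^sup>2"
    if u: "is_weight r lam u" "u a = 1" and i: "i \<in> {1..q}" for u i
  proof -
    have pos: "\<forall>i\<in>{1..q}. 0 < u i" using u by (auto simp: is_weight_def)
    show "0 < u i" "u i \<le> Q\<^sup>2" using pos i weight_bounds[OF u] by auto
    show "nsum u i \<le> K" unfolding K using weight_bounds[OF u] Q2 by (intro nsum_le) auto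
    show "0 < nsum u i" using nsum_pos pos i by auto
    have "u b \<le> nsum u a" using pos ab by (intro nsum_ge) (auto simp: less_imp_le)
    then show *: "1 / Q\<^sup>2 \<le> nsum u a" using weight_bounds(2)[OF u] by linarith
    have "0 < nsum u a" using nsum_pos[OF pos a_in] .
    then show "1 / nsum u a \<le> Q\<^sup>2" using * Q2 by (simp add: field_simps)
  qed
  have dn: "\<bar>nsum w i - nsum v i\<bar> \<le> real q * D" for i
    unfolding nsum_def using D D0 nbs_subset by (intro diff_sum) (blast | simp)+
  \<comment> \<open>The gain is \<open>lam k \<le> \<epsilon>\<close>. The other factors of
    \<open>C1\<close> are the bound \<open>Q\<close> for \<open>1 / lam a\<close>, the Lipschitz
    constant of the power \<open>r\<close> on \<open>[0, K * Q\<^sup>2]\<close>, and that of the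
    quotient \<open>y\<close>.\<close>
  have far: "\<bar>w k - v k\<bar> \<le> C1 * \<epsilon> * D" if k: "k \<in> {1..q}" "k \<noteq> a" "k \<noteq> b" for k
  proof -
    define y where "y u = nsum u k / nsum u a" for u
    have yb: "\<bar>y u\<bar> \<le> K * Q\<^sup>2" if u: "is_weight r lam u" "u a = 1" for u
    proof -
      have "y u = nsum u k * (1 / nsum u a)" by (simp add: y_def)
      also have "\<dots> \<le> K * Q\<^sup>2"
        using facts[OF u k(1)] facts[OF u a_in] by (intro mult_mono) auto
      finally show ?thesis using facts[OF u k(1)] facts[OF u a_in] by (simp add: y_def)
    qed
    \<comment> \<open>A difference of quotients, split so that each summand contains one difference
      of neighbour sums and otherwise only bounded factors.\<close>
    have "y w - y v = (nsum w k - nsum v k) * (1 / nsum w a)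
        + nsum v k * (nsum v a - nsum w a) * ((1 / nsum w a) * (1 / nsum v a))"
      using facts(3)[OF w a_in] facts(3)[OF v a_in] by (simp add: y_def field_simps)
    then have "\<bar>y w - y v\<bar> \<le> \<bar>nsum w k - nsum v k\<bar> * \<bar>1 / nsum w a\<bar>
        + \<bar>nsum v k\<bar> * \<bar>nsum v a - nsum w a\<bar> * (\<bar>1 / nsum w a\<bar> * \<bar>1 / nsum v a\<bar>)"
      by (metis abs_mult abs_triangle_ineq)
    also have "\<dots> \<le> real q * D * Q\<^sup>2 + K * (real q * D) * (Q\<^sup>2 * Q\<^sup>2)"
      using facts[OF w k(1)] facts[OF v k(1)] facts[OF w a_in] facts[OF v a_in] dn[of k] dn[of a] D0
        Q2 K_ge_1
      by (intro add_mono mult_mono) (auto simp: abs_minus_commute)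
    also have "\<dots> = (q * Q\<^sup>2 + K * q * Q ^ 4) * D"
      by (simp add: algebra_simps power2_eq_square power4_eq_xxxx)
    finally have dy: "\<bar>y w - y v\<bar> \<le> (q * Q\<^sup>2 + K * q * Q ^ 4) * D" .
    have KQ: "1 \<le> K * Q\<^sup>2"
      using mult_mono[of 1 K 1 "Q\<^sup>2"] K_ge_1 Q_ge_1 by auto
    have "\<bar>y w ^ r - y v ^ r\<bar> \<le> r * (K * Q\<^sup>2) ^ r * \<bar>y w - y v\<bar>"
      by (rule abs_power_diff_le) (use yb w v KQ in auto)
    also have "\<dots> \<le> r * (K * Q\<^sup>2) ^ r * ((q * Q\<^sup>2 + K * q * Q ^ 4) * D)"
      using KQ by (intro mult_left_mono dy) auto
    finally have dyr: "\<bar>y w ^ r - y v ^ r\<bar> \<le> r * (K * Q\<^sup>2) ^ r * ((q * Q\<^sup>2 + K * q * Q ^ 4) * D)" .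
    have "d k \<noteq> 0" using d0 k by auto
    then have "\<epsilon> ^ d k \<le> \<epsilon> ^ 1" using eps by (intro power_decreasing) auto
    then have "lam k \<le> \<epsilon>" using lam_le[OF k(1)] by simp
    moreover have "1 / lam a \<le> Q"
      using lam_ge[OF a_in] d0[OF a_in] lam_pos[OF a_in] Q_ge_1 by (simp add: field_simps)
    ultimately have l: "lam k * (1 / lam a) \<le> \<epsilon> * Q"
      using eps lam_pos[OF a_in] by (intro mult_mono) auto
    have "w k - v k = lam k * (1 / lam a) * (y w ^ r - y v ^ r)"
      using weight_ratio[OF w k(1)] weight_ratio[OF v k(1)] by (simp add: y_def algebra_simps)
    then have "\<bar>w k - v k\<bar> = lam k * (1 / lam a) * \<bar>y w ^ r - y v ^ r\<bar>"
      using lam_pos[OF k(1)] lam_pos[OF a_in] by (simp add: abs_mult)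
    also have "\<dots> \<le> (\<epsilon> * Q) * (r * (K * Q\<^sup>2) ^ r * ((q * Q\<^sup>2 + K * q * Q ^ 4) * D))"
      by (rule mult_mono[OF l dyr]) (use eps Q_ge_1 in auto)
    also have "\<dots> = C1 * \<epsilon> * D" by (simp add: C1)
    finally show ?thesis .
  qed
  \<comment> \<open>Here no small activity is available. Smallness is inherited from
    \<open>far\<close>: as there are no loops, the sums \<open>s\<close> and \<open>t\<close> run
    over nodes different from both \<open>a\<close> and \<open>b\<close>.\<close>
  have near: "\<bar>w b - v b\<bar> \<le> C2 * \<epsilon> * D" if "a \<noteq> b"
  proof -
    have nl: "\<not> H i i" for i using loop that by blast
    have ba: "H b a" using ab H_sym by blast
    define s where "s u = (\<Sum>j\<in>nbs a - {b}. u j)" for u :: "nat \<Rightarrow> real"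
    define t where "t u = (\<Sum>j\<in>nbs b - {a}. u j)" for u :: "nat \<Rightarrow> real"
    have ns: "nsum u a = u b + s u" "nsum u b = u a + t u" for u
      unfolding nsum_def s_def t_def using ab ba by (auto simp: sum.remove)
    define \<eta> where "\<eta> = real q * (C1 * \<epsilon> * D)"
    have CD: "0 \<le> C1 * \<epsilon> * D" using C1_nonneg eps D0 by simp
    have ds: "\<bar>s w - s v\<bar> \<le> \<eta>" unfolding s_def \<eta>_def
      using nl nbs_subset CD H_in by (intro diff_sum far) (auto)
    have dt: "\<bar>t w - t v\<bar> \<le> \<eta>" unfolding t_def \<eta>_def
      using nl nbs_subset CD H_in by (intro diff_sum far) (auto)
    define l where "l = lam b / lam a"
    have l: "0 < l" "l \<le> Q"
    proof -
      show "0 < l" using lam_pos a_in b_in by (simp add: l_def)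
      have "1 / lam a \<le> Q"
        using lam_ge[OF a_in] d0[OF a_in] lam_pos[OF a_in] Q_ge_1 by (simp add: field_simps)
      moreover have "lam b \<le> 1" using lam_le[OF b_in] d0[OF b_in] by simp
      ultimately have "lam b * (1 / lam a) \<le> 1 * Q"
        using lam_pos[OF a_in] lam_pos[OF b_in] by (intro mult_mono) auto
      then show "l \<le> Q" by (simp add: l_def)
    qed
    \<comment> \<open>Since \<open>nsum u b = 1 + t u\<close>, the right-hand side depends on small
      weights only, while the left-hand side is increasing in \<open>u b\<close>.\<close>
    have eq: "u b * (u b + s u) ^ r = l * (nsum u b) ^ r" if u: "is_weight r lam u" "u a = 1" for u
      using weight_ratio[OF u b_in] facts(3)[OF u a_in]
      unfolding l_def ns(1)[symmetric] by (simp add: power_divide field_simps)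
    have snn: "0 \<le> s u" if u: "is_weight r lam u" for u
      unfolding s_def
    proof (rule sum_nonneg)
      fix j assume "j \<in> nbs a - {b}"
      then have "j \<in> {1..q}" using nbs_subset by blast
      then show "0 \<le> u j" using u unfolding is_weight_def by (blast intro: less_imp_le)
    qed
    \<comment> \<open>The slope bound uses \<open>nsum u a \<ge> 1 / Q\<^sup>2\<close>; its inverse
      is the leading factor of \<open>C2\<close>. In \<open>Q + Q\<^sup>2\<close>, the first term
      comes from \<open>l \<le> Q\<close> on the right-hand side, the second from
      \<open>u b \<le> Q\<^sup>2\<close>.\<close>
    have "\<bar>w b - v b\<bar> * (1 / Q\<^sup>2) ^ r \<le> \<bar>w b * (w b + s w) ^ r - v b * (v b + s v) ^ r\<bar>
        + Q\<^sup>2 * (r * K ^ r * \<bar>s w - s v\<bar>)"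
      using facts[OF w a_in] facts[OF v a_in] facts[OF w b_in] facts[OF v b_in] ns snn w v K_ge_1 Q2
      by (intro implicit_root_lipschitz) auto
    also have "\<bar>w b * (w b + s w) ^ r - v b * (v b + s v) ^ r\<bar>
        = l * \<bar>nsum w b ^ r - nsum v b ^ r\<bar>"
      using l by (simp add: eq w v abs_mult right_diff_distrib[symmetric])
    also have "\<dots> \<le> Q * (r * K ^ r * \<eta>)"
    proof (intro mult_mono l)
      have "\<bar>nsum w b ^ r - nsum v b ^ r\<bar> \<le> r * K ^ r * \<bar>nsum w b - nsum v b\<bar>"
        using facts[OF w b_in] facts[OF v b_in] K_ge_1 by (intro abs_power_diff_le) auto
      also have "\<dots> \<le> r * K ^ r * \<eta>"
        using dt w v ns K_ge_1 by (intro mult_left_mono) auto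
      finally show "\<bar>nsum w b ^ r - nsum v b ^ r\<bar> \<le> r * K ^ r * \<eta>" .
    qed (use Q_ge_1 in auto)
    also have "Q\<^sup>2 * (r * K ^ r * \<bar>s w - s v\<bar>) \<le> Q\<^sup>2 * (r * K ^ r * \<eta>)"
      using ds K_ge_1 by (intro mult_left_mono) auto
    finally have "\<bar>w b - v b\<bar> * (1 / Q\<^sup>2) ^ r \<le> (Q + Q\<^sup>2) * (r * K ^ r * \<eta>)"
      by (simp add: algebra_simps)
    then have "\<bar>w b - v b\<bar> \<le> Q\<^sup>2 ^ r * ((Q + Q\<^sup>2) * (r * K ^ r * \<eta>))"
      using Q2 by (simp add: power_divide field_simps)
    also have "\<dots> = C2 * \<epsilon> * D" by (simp add: C2 \<eta>_def)
    finally show ?thesis .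
  qed
  have "D \<in> (\<lambda>i. \<bar>w i - v i\<bar>) ` {1..q}" unfolding D_def using ne by (intro Max_in) auto
  then obtain k where k: "k \<in> {1..q}" "D = \<bar>w k - v k\<bar>" by blast
  have "D = 0"
  proof (rule ccontr)
    assume "D \<noteq> 0"
    then have Dp: "0 < D" using D0 by simp
    have "D \<le> C1 * \<epsilon> * D \<or> D \<le> C2 * \<epsilon> * D \<or> k = a"
      using far[OF k(1)] near k(2) by metis
    moreover have "C1 * \<epsilon> * D < 1 * D" "C2 * \<epsilon> * D < 1 * D"
      using eps Dp by (intro mult_strict_right_mono; simp)+
    moreover have "k \<noteq> a" using k w v Dp by auto
    ultimately show False by linarith
  qed
  then show ?thesis using D by fastforce
qed

lemma weight_unique:
  assumes w: "is_weight r lam w" and v: "is_weight r lam v"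
  shows "\<exists>t>0. \<forall>i\<in>{1..q}. v i = t * w i"
proof -
  have p: "0 < w a" "0 < v a" using w v a_in by (auto simp: is_weight_def)
  have "\<forall>i\<in>{1..q}. 1 / w a * w i = 1 / v a * v i"
  proof (rule normalised_weight_unique)
    show "is_weight r lam (\<lambda>i. 1 / w a * w i)" using p by (intro is_weight_scale w) simp
    show "is_weight r lam (\<lambda>i. 1 / v a * v i)" using p by (intro is_weight_scale v) simp
  qed (use p in auto)
  then have "\<forall>i\<in>{1..q}. v i = v a / w a * w i" using p by (simp add: field_simps)
  then show ?thesis using p by (intro exI[of _ "v a / w a"]) auto
qed

end

section \<open>Choice of the activities\<close>

context cgraph
begin

text \<open>The fixed-point equation is read backwards: the weights are prescribed as a function of
  the distance, and \<open>lam\<close> is what makes them a solution. It remains to see that this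
  \<open>lam\<close> obeys the bounds of \<open>hierarchy\<close>.\<close>

theorem ex_unique_weight:
  assumes r: "1 \<le> r"
  obtains lam w :: "nat \<Rightarrow> real" where
    "\<forall>i\<in>{1..q}. 0 < lam i" "\<forall>i\<in>{1..q}. 0 < w i"
    "\<forall>i\<in>{1..q}. w i = lam i * nsum w i ^ r"
    "\<And>v. is_weight r lam v \<Longrightarrow> \<exists>t>0. \<forall>i\<in>{1..q}. v i = t * w i"
proof -
  obtain a b where ab: "H a b" and loop: "a = b \<or> (\<forall>i. \<not> H i i)"
    using edge by blast
  have abq: "{a, b} \<subseteq> {1..q}" using ab H_in by auto
  obtain d where d: "\<And>i. i \<in> {1..q} \<Longrightarrow> d i = (0::nat) \<longleftrightarrow> i \<in> {a, b}"
      "\<And>i n. i \<in> {1..q} \<Longrightarrow> d i = Suc n \<Longrightarrow> \<exists>m\<in>{1..q}. H i m \<and> d m = n"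
      "\<And>i j. H i j \<Longrightarrow> d j \<le> Suc (d i)"
    using ex_distance[OF abq] by auto
  define Q where "Q = real q ^ r"
  define K where "K = real q * Q\<^sup>2"
  define C1 where "C1 = Q * (r * (K * Q\<^sup>2) ^ r * (q * Q\<^sup>2 + K * q * Q ^ 4))"
  define C2 where "C2 = Q\<^sup>2 ^ r * ((Q + Q\<^sup>2) * (r * K ^ r * (q * C1)))"
  define \<epsilon> where "\<epsilon> = 1 / (2 + Q\<^sup>2 + C1 + C2)"
  have Q1: "1 \<le> Q" using q_ge_1 unfolding Q_def by simp
  have K0: "0 \<le> K" unfolding K_def by simp
  have C10: "0 \<le> C1" using Q1 K0 unfolding C1_def by simp
  have C20: "0 \<le> C2" using Q1 K0 C10 unfolding C2_def by simp
  have Q2: "0 \<le> Q\<^sup>2" by simp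
  have den: "0 < 2 + Q\<^sup>2 + C1 + C2" using C10 C20 by (simp add: add_pos_nonneg)
  have eps: "0 < \<epsilon>" "\<epsilon> < 1" "\<epsilon> * Q\<^sup>2 < 1" "C1 * \<epsilon> < 1" "C2 * \<epsilon> < 1"
    unfolding \<epsilon>_def using den C10 C20 Q1
    by (auto simp: field_simps add_pos_nonneg) (use C10 C20 Q2 in linarith)+
  \<comment> \<open>\<open>e n\<close> is the weight at distance \<open>n\<close>. A node at
    distance \<open>n + 1\<close> has neighbour sum between \<open>e n\<close> and
    \<open>q * e n\<close>, so with this recursion its activity lies between
    \<open>\<epsilon> ^ (n + 1) / Q\<close> and \<open>\<epsilon> ^ (n + 1)\<close>.\<close>
  define e where "e = rec_nat 1 (\<lambda>n x. \<epsilon> ^ Suc n * x ^ r)"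
  have e: "e 0 = 1" "e (Suc n) = \<epsilon> ^ Suc n * e n ^ r" for n by (simp_all add: e_def)
  have e01: "0 < e n \<and> e n \<le> 1" for n
  proof (induction n)
    case (Suc n)
    then have "\<epsilon> ^ Suc n * e n ^ r \<le> 1 * 1"
      using eps by (intro mult_mono power_le_one) auto
    then show ?case using Suc eps by (simp add: e)
  qed (simp add: e)
  have eSuc: "e (Suc n) \<le> e n" for n
  proof -
    have "e n ^ r \<le> e n ^ 1" using e01 r by (intro power_decreasing) (auto simp: less_imp_le)
    then have "\<epsilon> ^ Suc n * e n ^ r \<le> 1 * e n"
      using eps e01[of n] by (intro mult_mono power_le_one) auto
    then show ?thesis by (simp add: e)
  qed
  have e_dec: "e n \<le> e m" if "m \<le> n" for m n
    using decseqD[OF decseq_SucI[of e]] eSuc that by blast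
  define w where "w i = e (d i)" for i
  define lam where "lam i = w i / nsum w i ^ r" for i
  have wpos: "\<forall>i\<in>{1..q}. 0 < w i" using e01 by (simp add: w_def)
  then have wnn: "\<forall>i\<in>{1..q}. 0 \<le> w i" by (simp add: less_imp_le)
  have npos: "0 < nsum w i" if "i \<in> {1..q}" for i using nsum_pos[OF wpos that] .
  have lampos: "\<forall>i\<in>{1..q}. 0 < lam i" using npos wpos by (simp add: lam_def)
  \<comment> \<open>The witness is the weight of a neighbour closer to \<open>ab\<close>; on \<open>ab\<close> itself it is \<open>1\<close>.\<close>
  have key: "\<exists>x. 0 < x \<and> x \<le> nsum w i \<and> nsum w i \<le> real q * x \<and> w i = \<epsilon> ^ d i * x ^ r"
    if i: "i \<in> {1..q}" for i
  proof (cases "d i")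
    case 0
    then have iab: "i \<in> {a, b}" using d i by auto
    obtain j where j: "H i j" "j \<in> {a, b}" using iab ab H_sym by blast
    have "d j = 0" using d(1)[of j] j(2) H_in(2)[OF j(1)] by simp
    then have "w j = 1" by (simp add: w_def e)
    then have "1 \<le> nsum w i"
      using nsum_ge[OF wnn j(1)] by simp
    moreover have "nsum w i \<le> real q * 1" using e01 by (intro nsum_le) (auto simp: w_def)
    ultimately show ?thesis using 0 by (intro exI[of _ 1]) (auto simp: w_def e)
  next
    case (Suc n)
    then obtain m where m: "m \<in> {1..q}" "H i m" "d m = n" using d i by blast
    have "e n \<le> nsum w i"
      using nsum_ge[OF wnn m(2)] m(3) unfolding w_def by simp
    moreover have "nsum w i \<le> real q * e n"
    proof -
      have "nsum w i \<le> real (card (nbs i)) * e n"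
        unfolding nsum_def
      proof (rule sum_bounded_above)
        fix j assume "j \<in> nbs i"
        then have "d i \<le> Suc (d j)" using d(3) H_sym by simp
        then show "w j \<le> e n" unfolding w_def using Suc by (intro e_dec) simp
      qed
      also have "\<dots> \<le> real q * e n"
        using card_mono[of "{1..q}" "nbs i"] nbs_subset e01[of n] by (intro mult_right_mono) auto
      finally show ?thesis .
    qed
    ultimately show ?thesis using Suc e01[of n] by (intro exI[of _ "e n"]) (auto simp: w_def e)
  qed
  have lam_b: "\<epsilon> ^ d i / Q \<le> lam i \<and> lam i \<le> \<epsilon> ^ d i" if i: "i \<in> {1..q}" for i
  proof -
    obtain x where x: "0 < x" "x \<le> nsum w i" "nsum w i \<le> real q * x" "w i = \<epsilon> ^ d i * x ^ r"
      using key[OF i] by blast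
    have "x ^ r \<le> nsum w i ^ r" using x by (intro power_mono) auto
    then have 1: "\<epsilon> ^ d i * x ^ r \<le> \<epsilon> ^ d i * nsum w i ^ r" using eps by (intro mult_left_mono) auto
    have "nsum w i ^ r \<le> (real q * x) ^ r" using x npos[OF i] by (intro power_mono) auto
    then have 2: "\<epsilon> ^ d i * nsum w i ^ r \<le> \<epsilon> ^ d i * (Q * x ^ r)"
      using eps by (intro mult_left_mono) (auto simp: Q_def power_mult_distrib)
    show ?thesis unfolding lam_def x(4) using 1 2 npos[OF i] Q1
      by (auto simp: field_simps)
  qed
  interpret hierarchy q H r a b d lam \<epsilon> Q K C1 C2
    using r ab loop d lam_b eps by unfold_locales (auto simp: Q_def K_def C1_def C2_def)
  have fix_eq: "\<forall>i\<in>{1..q}. w i = lam i * nsum w i ^ r"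
    unfolding lam_def using npos by (metis nonzero_eq_divide_eq power_not_zero less_irrefl)
  then have "is_weight r lam w"
    unfolding is_weight_def using wpos by (intro conjI exI[of _ 1]) auto
  then show thesis using that[of lam w] lampos wpos fix_eq weight_unique by blast
qed

end

section \<open>The regular tree\<close>

lemma Nil_in_tree [simp]: "[] \<in> tree_V r"
  by (simp add: tree_V_def)

lemma Cons_in_tree: "a # v \<in> tree_V r \<longleftrightarrow> a \<le> r \<and> v \<in> tree_V r \<and> (v \<noteq> [] \<longrightarrow> hd v \<noteq> a)"
  by (auto simp: tree_V_def successively_Cons)

lemma snoc_in_tree: "v @ [b] \<in> tree_V r \<longleftrightarrow> b \<le> r \<and> v \<in> tree_V r \<and> (v \<noteq> [] \<longrightarrow> last v \<noteq> b)"
  by (auto simp: tree_V_def successively_append_iff)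

lemma tree_E_sym: "tree_E x y \<longleftrightarrow> tree_E y x"
  by (auto simp: tree_E_def)

lemma tree_E_Nil: "tree_E [] x \<longleftrightarrow> (\<exists>a. x = [a])"
  by (auto simp: tree_E_def)

lemma not_tree_E_refl [simp]: "\<not> tree_E x x"
  by (auto simp: tree_E_def)

lemma tree_E_Cons [simp]: "tree_E (a # v) v" "tree_E v (a # v)"
  by (auto simp: tree_E_def)

lemma suffix_in_tree: "suffix y x \<Longrightarrow> x \<in> tree_V r \<Longrightarrow> y \<in> tree_V r"
  by (auto simp: suffix_def tree_V_def successively_append_iff)

lemma tree_nbrs:
  assumes "v \<in> tree_V r"
  shows "finite {x \<in> tree_V r. tree_E v x}" "card {x \<in> tree_V r. tree_E v x} = Suc r"
proof -
  have "finite {x \<in> tree_V r. tree_E v x} \<and> card {x \<in> tree_V r. tree_E v x} = Suc r"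
  proof (cases v)
    case Nil
    then have "{x \<in> tree_V r. tree_E v x} = (\<lambda>a. [a]) ` {..r}"
      by (auto simp: tree_E_Nil Cons_in_tree)
    then show ?thesis by (simp add: card_image inj_on_def)
  next
    case (Cons b u)
    have "{x \<in> tree_V r. tree_E v x} = insert u ((\<lambda>a. a # v) ` ({..r} - {b}))"
      using assms unfolding Cons by (auto simp: tree_E_def Cons_in_tree)
    moreover have "u \<notin> (\<lambda>a. a # v) ` ({..r} - {b})" using Cons by auto
    moreover have "card ((\<lambda>a. a # v) ` ({..r} - {b})) = r"
      using assms unfolding Cons by (subst card_image) (auto simp: inj_on_def Cons_in_tree)
    ultimately show ?thesis by simp
  qed
  then show "finite {x \<in> tree_V r. tree_E v x}" "card {x \<in> tree_V r. tree_E v x} = Suc r" by auto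
qed

text \<open>Words grow at the head, so the parent of \<open>a # v\<close> is \<open>v\<close> and
  the ancestors of a word are its suffixes. Closure under parents together with the root amounts to
  connectedness, and every finite set of sites lies in such a set, its
  \<open>suffix_hull\<close>.\<close>

definition subtree :: "nat \<Rightarrow> nat list set \<Rightarrow> bool" where
  "subtree r W \<longleftrightarrow> finite W \<and> W \<subseteq> tree_V r \<and> [] \<in> W \<and> (\<forall>a v. a # v \<in> W \<longrightarrow> v \<in> W)"

lemma subtreeD:
  assumes "subtree r W"
  shows "finite W" "W \<subseteq> tree_V r" "[] \<in> W" "\<And>a v. a # v \<in> W \<Longrightarrow> v \<in> W"
  using assms unfolding subtree_def by blast+

lemma subtree_suffix: "subtree r W \<Longrightarrow> x \<in> W \<Longrightarrow> suffix y x \<Longrightarrow> y \<in> W"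
proof (induction x)
  case (Cons a x)
  then show ?case using subtreeD(4)[of r W a x] by (auto simp: suffix_Cons)
qed auto

lemma subtree_tl: "subtree r W \<Longrightarrow> x \<in> W \<Longrightarrow> tl x \<in> W"
  by (rule subtree_suffix[of r W x]) (simp_all add: suffix_tl)

text \<open>A longest word is a leaf, and deleting it leaves a subtree; so every subtree arises from
  the root by attaching leaves.\<close>

lemma subtree_induct [consumes 1, case_names Nil insert]:
  assumes "subtree r W" "P {[]}"
    and step: "\<And>W a v. subtree r W \<Longrightarrow> v \<in> W \<Longrightarrow> a # v \<in> tree_V r \<Longrightarrow> a # v \<notin> W \<Longrightarrow>
      subtree r (insert (a # v) W) \<Longrightarrow> P W \<Longrightarrow> P (insert (a # v) W)"
  shows "P W"
  using assms(1)
proof (induction "card W" arbitrary: W rule: less_induct)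
  case less
  note W = subtreeD[OF less.prems]
  show ?case
  proof (cases "W = {[]}")
    case True then show ?thesis using assms by simp
  next
    case False
    have "Max (length ` W) \<in> length ` W" using W by (intro Max_in) auto
    then obtain x where x: "x \<in> W" "length x = Max (length ` W)" by auto
    have x: "x \<in> W" "\<And>y. y \<in> W \<Longrightarrow> length y \<le> length x"
      using x W(1) by auto
    have "x \<noteq> []"
    proof
      assume "x = []"
      then have "\<forall>y\<in>W. y = []" using x(2) by force
      then show False using False W by blast
    qed
    then obtain a v where av: "x = a # v" by (cases x) auto
    have sub: "subtree r (W - {x})"
      unfolding subtree_def
    proof (intro conjI allI impI)
      fix b u assume "b # u \<in> W - {x}"
      then show "u \<in> W - {x}" using W(4) x(2)[of "b # u"] by auto
    qed (use W \<open>x \<noteq> []\<close> in auto)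
    have "P (W - {x})" using W x by (intro less.hyps sub) (rule card_Diff1_less, auto)
    moreover have ins: "insert (a # v) (W - {x}) = W" using x av by auto
    ultimately show ?thesis
      using step[of "W - {x}" v a] sub less.prems W x av by auto
  qed
qed

definition suffix_hull :: "nat list set \<Rightarrow> nat list set" where
  "suffix_hull J = insert [] (\<Union>x\<in>J. {y. suffix y x})"

lemma subtree_suffix_hull: "finite J \<Longrightarrow> J \<subseteq> tree_V r \<Longrightarrow> subtree r (suffix_hull J)"
proof -
  assume J: "finite J" "J \<subseteq> tree_V r"
  have "finite {y. suffix y x}" for x :: "nat list"
    by (metis List.finite_set set_suffixes_eq)
  then show ?thesis
    using J unfolding subtree_def suffix_hull_def
    by (auto dest: suffix_in_tree suffix_ConsD)
qed

lemma suffix_hull_superset: "J \<subseteq> suffix_hull J"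
  by (auto simp: suffix_hull_def)

lemma subtree_image_automorphism:
  assumes g: "board_automorphism (tree_V r) tree_E g" and W: "subtree r W"
    and p: "p \<in> W" "g p = []"
  shows "subtree r (g ` W)"
proof -
  define S where "S = {x \<in> W. \<forall>y. suffix y (g x) \<longrightarrow> y \<in> g ` W}"
  have WV: "x \<in> tree_V r" if "x \<in> W" for x using subtreeD(2)[OF W] that by blast
  have step: "y \<in> S" if "x \<in> S" "y \<in> W" "tree_E x y" for x y
  proof -
    have "tree_E (g x) (g y)"
      using g that WV unfolding board_automorphism_def S_def by blast
    then consider a where "g y = a # g x" | a where "g x = a # g y"
      by (auto simp: tree_E_def)
    then show ?thesis
    proof cases
      case 1
      moreover have "g y \<in> g ` W" using that by blast
      ultimately show ?thesis using that unfolding S_def by (auto simp: suffix_Cons)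
    next
      case 2
      then show ?thesis using that unfolding S_def by (auto simp: suffix_ConsI)
    qed
  qed
  have "[] \<in> g ` W" using p by (metis imageI)
  then have pS: "p \<in> S" using p by (auto simp: S_def)
  \<comment> \<open>From \<open>p\<close> the property is carried down to the root, and from there
    up to every site of \<open>W\<close>.\<close>
  have "v \<in> S" if "p = us @ v" for us v
    using that
  proof (induction us arbitrary: v rule: rev_induct)
    case Nil
    then show ?case using pS by simp
  next
    case (snoc a us)
    then have "a # v \<in> S" by simp
    moreover have "v \<in> W" using subtree_suffix[OF W p(1)] snoc(2) by (auto simp: suffix_def)
    ultimately show ?case using step[of "a # v" v] by simp
  qed
  then have root: "[] \<in> S" by simp
  have "x \<in> S" if "x \<in> W" for x
    using that
  proof (induction x)
    case (Cons a x)
    then show ?case using step[of x "a # x"] subtreeD(4)[OF W, of a x] by simp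
  qed (use root in simp)
  then have all: "y \<in> g ` W" if "x \<in> W" "suffix y (g x)" for x y
    using that by (auto simp: S_def)
  have gV: "g ` W \<subseteq> tree_V r"
    using g WV unfolding board_automorphism_def bij_betw_def by blast
  show ?thesis
    unfolding subtree_def
  proof (intro conjI allI impI)
    fix a v assume "a # v \<in> g ` W"
    then obtain x where "x \<in> W" "g x = a # v" by auto
    then show "v \<in> g ` W" using all[of x v] by (simp add: suffix_ConsI)
  next
    show "[] \<in> g ` W" using p by (metis imageI)
  qed (use gV subtreeD(1)[OF W] in auto)
qed

section \<open>Automorphisms of the tree\<close>

lemma involution_automorphism:
  assumes "\<And>x. x \<in> V \<Longrightarrow> g x \<in> V" "\<And>x. x \<in> V \<Longrightarrow> g (g x) = x"
    and "\<And>x y. x \<in> V \<Longrightarrow> y \<in> V \<Longrightarrow> E x y \<Longrightarrow> E (g x) (g y)"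
  shows "board_automorphism V E g"
  unfolding board_automorphism_def
proof (intro conjI ballI)
  show "bij_betw g V V" using assms(1,2) by (intro bij_betwI[of g V V g]) auto
  fix x y assume "x \<in> V" "y \<in> V"
  then show "E x y \<longleftrightarrow> E (g x) (g y)"
    using assms(3)[of x y] assms(3)[of "g x" "g y"] assms(1,2) by auto
qed

text \<open>The tree is the Cayley graph of a free product of copies of \<open>\<int>/2\<close> with edges given by left
  multiplication, so right multiplication by a generator is an automorphism.\<close>

definition rmult :: "nat \<Rightarrow> nat list \<Rightarrow> nat list" where
  "rmult b x = (if x \<noteq> [] \<and> last x = b then butlast x else x @ [b])"

lemma rmult_automorphism:
  assumes b: "b \<le> r"
  shows "board_automorphism (tree_V r) tree_E (rmult b)"
proof (rule involution_automorphism)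
  fix x assume x: "x \<in> tree_V r"
  show "rmult b x \<in> tree_V r"
    by (cases x rule: rev_cases)
      (use x b in \<open>auto simp: rmult_def tree_V_def successively_append_iff successively_Cons\<close>)
  show "rmult b (rmult b x) = x"
    by (cases x rule: rev_cases) (use x b in \<open>auto simp: rmult_def snoc_in_tree butlast_append\<close>)
next
  have *: "tree_E (rmult b (a # v)) (rmult b v)" for a v
    by (cases v rule: rev_cases) (auto simp: rmult_def tree_E_def)
  fix x y assume "tree_E x y"
  then show "tree_E (rmult b x) (rmult b y)"
    using *[of _ x] *[of _ y] tree_E_sym[of "rmult b x"] by (auto simp: tree_E_def[of x y])
qed

text \<open>Relabelling letters fixes the root and permutes its neighbours; \<open>rmult\<close>
  moves the root. Together they act transitively on directed edges.\<close>

lemma swap_automorphism: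
  assumes "a \<le> r" "b \<le> r"
  shows "board_automorphism (tree_V r) tree_E (map (Transposition.transpose a b))"
proof (rule involution_automorphism)
  fix x assume x: "x \<in> tree_V r"
  have "successively (\<noteq>) (map (Transposition.transpose a b) x)"
    using x by (auto simp: tree_V_def successively_map elim!: successively_mono dest: injD[OF inj_on_transpose])
  moreover have "Transposition.transpose a b ` set x \<subseteq> {..r}"
    using x assms by (auto simp: tree_V_def Transposition.transpose_def)
  ultimately show "map (Transposition.transpose a b) x \<in> tree_V r" by (simp add: tree_V_def)
  show "map (Transposition.transpose a b) (map (Transposition.transpose a b) x) = x" by (simp add: comp_def)
qed (auto simp: tree_E_def)

text \<open>From the words ending in \<open>a # v\<close> the only exit is the step from
  \<open>a # v\<close> to its parent \<open>v\<close>, which has been removed.\<close>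

lemma component_suffix:
  assumes "a # v \<in> tree_V r"
    and "(\<lambda>x y. x \<in> tree_V r - {v} \<and> y \<in> tree_V r - {v} \<and> tree_E x y)\<^sup>*\<^sup>* (a # v) x"
  shows "suffix (a # v) x"
  using assms(2)
proof (induction rule: rtranclp_induct)
  case (step y z)
  then show ?case by (auto simp: tree_E_def suffix_Cons)
qed simp

text \<open>The members of \<open>components_without\<close>, indexed by a representative site, so
  that families of components can be written as images of sets of sites.\<close>

definition component :: "'a set \<Rightarrow> ('a \<Rightarrow> 'a \<Rightarrow> bool) \<Rightarrow> 'a \<Rightarrow> 'a \<Rightarrow> 'a set" where
  "component V E u w = {x \<in> V - {u}. (\<lambda>a b. a \<in> V - {u} \<and> b \<in> V - {u} \<and> E a b)\<^sup>*\<^sup>* w x}"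

lemma components_without_eq: "components_without V E u = component V E u ` (V - {u})"
  by (auto simp: components_without_def component_def)

lemma component_refl: "w \<in> V - {u} \<Longrightarrow> w \<in> component V E u w"
  by (simp add: component_def)

lemma component_subset: "C \<in> components_without V E u \<Longrightarrow> C \<subseteq> V - {u}"
  by (auto simp: components_without_def)

lemma component_eq:
  assumes sym: "\<And>x y. E x y \<Longrightarrow> E y x" and "x \<in> component V E u w"
  shows "component V E u x = component V E u w"
proof -
  let ?R = "\<lambda>a b. a \<in> V - {u} \<and> b \<in> V - {u} \<and> E a b"
  have "symp ?R" unfolding symp_def using sym by blast
  then have "symp ?R\<^sup>*\<^sup>*" by (rule symp_rtranclp)
  then have "?R\<^sup>*\<^sup>* w x" "?R\<^sup>*\<^sup>* x w" using assms(2) by (auto simp: component_def dest: sympD)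
  then show ?thesis unfolding component_def by (auto intro: rtranclp_trans)
qed

lemma components_disjoint:
  assumes "\<And>x y. E x y \<Longrightarrow> E y x" "C \<in> components_without V E u" "D \<in> components_without V E u"
    and "x \<in> C" "x \<in> D"
  shows "C = D"
proof -
  obtain v w where "C = component V E u v" "D = component V E u w"
    using assms(2,3) unfolding components_without_eq by blast
  then show ?thesis
    using component_eq[where E = E, OF assms(1)] assms(4,5) by metis
qed

lemma component_adjacent:
  assumes "\<And>x y. E x y \<Longrightarrow> E y x" "x \<in> V - {u}" "y \<in> V - {u}" "E x y"
  shows "component V E u x = component V E u y"
proof (rule component_eq)
  show "x \<in> component V E u y"
    unfolding component_def using assms(1)[OF assms(4)] assms(2,3) by (auto intro!: r_into_rtranclp)
qed (rule assms(1))

section \<open>Cylinder events and Gibbs measures\<close>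

definition cyl :: "('a \<Rightarrow> nat) measure \<Rightarrow> 'a set \<Rightarrow> ('a \<Rightarrow> nat) \<Rightarrow> ('a \<Rightarrow> nat) set" where
  "cyl M W c = {\<phi> \<in> space M. \<forall>v\<in>W. \<phi> v = c v}"

definition rect :: "('a \<Rightarrow> nat) measure \<Rightarrow> 'a set \<Rightarrow> ('a \<Rightarrow> nat set) \<Rightarrow> ('a \<Rightarrow> nat) set" where
  "rect M W X = {\<phi> \<in> space M. \<forall>v\<in>W. \<phi> v \<in> X v}"

definition comb :: "'a set \<Rightarrow> ('a \<Rightarrow> 'b) \<Rightarrow> ('a \<Rightarrow> 'b) \<Rightarrow> 'a \<Rightarrow> 'b" where
  "comb U c d = (\<lambda>v. if v \<in> U then c v else d v)"

text \<open>The adjacency condition of \<open>hom_set\<close> without its range and extensionality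
  conditions, so that total functions such as those built by \<open>comb\<close> can be restricted
  and merged freely.\<close>

definition compat :: "('a \<Rightarrow> 'a \<Rightarrow> bool) \<Rightarrow> (nat \<Rightarrow> nat \<Rightarrow> bool) \<Rightarrow> 'a set \<Rightarrow> ('a \<Rightarrow> nat) \<Rightarrow> bool" where
  "compat E H W c \<longleftrightarrow> (\<forall>x\<in>W. \<forall>y\<in>W. E x y \<longrightarrow> H (c x) (c y))"

lemma compat_cong: "(\<And>v. v \<in> W \<Longrightarrow> c v = d v) \<Longrightarrow> compat E H W c \<longleftrightarrow> compat E H W d"
  by (simp add: compat_def)

lemma cyl_cong: "(\<And>v. v \<in> W \<Longrightarrow> c v = d v) \<Longrightarrow> cyl M W c = cyl M W d"
  by (auto simp: cyl_def)

lemma space_hom_space [simp]: "space (hom_space V E q H) = hom_set V E q H"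
  by (auto simp: hom_space_def space_restrict_space space_PiM hom_set_def)

lemma sum_cylinder_split:
  fixes f :: "('a \<Rightarrow> 'b) \<Rightarrow> real"
  assumes "U \<inter> W = {}"
  shows "(\<Sum>c\<in>PiE (U \<union> W) Y. f c) = (\<Sum>c\<in>PiE U Y. \<Sum>d\<in>PiE W Y. f (comb U c d))"
proof -
  have "(\<Sum>c\<in>PiE U Y. \<Sum>d\<in>PiE W Y. f (comb U c d)) = (\<Sum>(c, d)\<in>PiE U Y \<times> PiE W Y. f (comb U c d))"
    by (rule sum.cartesian_product)
  also have "\<dots> = (\<Sum>c\<in>PiE (U \<union> W) Y. f c)"
    by (rule sum.reindex_bij_witness[of _ "\<lambda>c. (restrict c U, restrict c W)" "\<lambda>(c, d). comb U c d"])
      (use assms in \<open>auto simp: comb_def PiE_def extensional_def fun_eq_iff restrict_def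
          intro!: arg_cong[where f = f] split: if_splits\<close>)
  finally show ?thesis ..
qed

text \<open>Only finiteness is assumed, because the determination by cylinders is applied to
  densities as well, whose total mass is not 1.\<close>

locale hom_measure = finite_measure \<mu> for \<mu> :: "('a \<Rightarrow> nat) measure" +
  fixes V :: "'a set" and E :: "'a \<Rightarrow> 'a \<Rightarrow> bool" and q :: nat and H :: "nat \<Rightarrow> nat \<Rightarrow> bool"
  assumes sets_eq: "sets \<mu> = sets (hom_space V E q H)"
begin

lemma space_eq: "space \<mu> = hom_set V E q H"
  using sets_eq_imp_space_eq[OF sets_eq] by simp

lemma coord_in: "\<phi> \<in> space \<mu> \<Longrightarrow> v \<in> V \<Longrightarrow> \<phi> v \<in> {1..q}"
  unfolding space_eq hom_set_def by (auto simp: PiE_def Pi_def)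

lemma measurable_coord: "v \<in> V \<Longrightarrow> (\<lambda>\<phi>. \<phi> v) \<in> measurable \<mu> (count_space {1..q})"
  unfolding measurable_cong_sets[OF sets_eq refl] hom_space_def
  by (intro measurable_restrict_space1 measurable_component_singleton)

lemma measurable_restrict_coord:
  "W \<subseteq> V \<Longrightarrow> (\<lambda>\<phi>. restrict \<phi> W) \<in> measurable \<mu> (PiM W (\<lambda>_. count_space {1..q}))"
  by (intro measurable_restrict measurable_coord) blast

lemma rect_sets: "finite W \<Longrightarrow> W \<subseteq> V \<Longrightarrow> rect \<mu> W X \<in> sets \<mu>"
proof -
  assume W: "finite W" "W \<subseteq> V"
  have "{\<phi> \<in> space \<mu>. \<phi> v \<in> X v} \<in> sets \<mu>" if "v \<in> W" for v
  proof -
    have "(\<lambda>\<phi>. \<phi> v) -` (X v \<inter> {1..q}) \<inter> space \<mu> \<in> sets \<mu>"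
      using measurable_coord[of v] that W by (intro measurable_sets) auto
    also have "(\<lambda>\<phi>. \<phi> v) -` (X v \<inter> {1..q}) \<inter> space \<mu> = {\<phi> \<in> space \<mu>. \<phi> v \<in> X v}"
      using coord_in that W by auto
    finally show ?thesis .
  qed
  then show ?thesis unfolding rect_def using W by (intro sets.sets_Collect_finite_All) auto
qed

lemma cyl_eq_rect: "cyl \<mu> W c = rect \<mu> W (\<lambda>v. {c v})"
  by (simp add: cyl_def rect_def)

lemma cyl_sets: "finite W \<Longrightarrow> W \<subseteq> V \<Longrightarrow> cyl \<mu> W c \<in> sets \<mu>"
  unfolding cyl_eq_rect by (rule rect_sets)

lemma measure_rect:
  assumes W: "finite W" "W \<subseteq> V"
  shows "measure \<mu> (rect \<mu> W X) = (\<Sum>c\<in>PiE W (\<lambda>v. X v \<inter> {1..q}). measure \<mu> (cyl \<mu> W c))"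
proof -
  let ?P = "PiE W (\<lambda>v. X v \<inter> {1..q})"
  have "rect \<mu> W X = (\<Union>c\<in>?P. cyl \<mu> W c)"
  proof (intro equalityI subsetI)
    fix \<phi> assume "\<phi> \<in> rect \<mu> W X"
    then have "restrict \<phi> W \<in> ?P" "\<phi> \<in> cyl \<mu> W (restrict \<phi> W)"
      using coord_in W by (auto simp: rect_def cyl_def)
    then show "\<phi> \<in> (\<Union>c\<in>?P. cyl \<mu> W c)" by blast
  qed (auto simp: rect_def cyl_def PiE_def Pi_def)
  moreover have "finite ?P" using W by (intro finite_PiE) auto
  moreover have "disjoint_family_on (cyl \<mu> W) ?P"
    unfolding disjoint_family_on_def
  proof (intro ballI impI equals0I)
    fix c d \<phi> assume "c \<in> ?P" "d \<in> ?P" "c \<noteq> d" "\<phi> \<in> cyl \<mu> W c \<inter> cyl \<mu> W d"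
    moreover from this have "c = d" by (intro PiE_ext[of c W _ d]) (auto simp: cyl_def)
    ultimately show False by simp
  qed
  ultimately show ?thesis
    using cyl_sets[OF W] by (simp add: finite_measure_finite_Union image_subset_iff)
qed

lemma measure_cyl_split:
  assumes "finite U" "finite W" "U \<inter> W = {}" "U \<subseteq> V" "W \<subseteq> V" and d: "d \<in> W \<rightarrow> {1..q}"
  shows "measure \<mu> (cyl \<mu> W d) = (\<Sum>c\<in>PiE U (\<lambda>_. {1..q}). measure \<mu> (cyl \<mu> (U \<union> W) (comb U c d)))"
proof -
  let ?Y = "\<lambda>v. (if v \<in> U then {1..q} else {d v}) \<inter> {1..q}"
  have "cyl \<mu> W d = rect \<mu> (U \<union> W) (\<lambda>v. if v \<in> U then {1..q} else {d v})"
    unfolding cyl_def rect_def using assms coord_in by (auto split: if_splits)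
  then have "measure \<mu> (cyl \<mu> W d) = (\<Sum>c\<in>PiE (U \<union> W) ?Y. measure \<mu> (cyl \<mu> (U \<union> W) c))"
    using assms measure_rect[of "U \<union> W"] by simp
  also have "\<dots> = (\<Sum>c\<in>PiE U ?Y. \<Sum>d'\<in>PiE W ?Y. measure \<mu> (cyl \<mu> (U \<union> W) (comb U c d')))"
    using assms by (intro sum_cylinder_split)
  also have "PiE W ?Y = PiE W (\<lambda>v. {restrict d W v})"
    using assms by (intro PiE_cong) auto
  also have "\<dots> = {restrict d W}" by (rule PiE_singleton) (rule restrict_extensional)
  also have "PiE U ?Y = PiE U (\<lambda>_. {1..q})"
    by (intro PiE_cong) auto
  finally show ?thesis
    by (simp, intro sum.cong refl arg_cong[where f = "measure \<mu>"] cyl_cong) (auto simp: comb_def)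
qed

lemma subalgebra_outside: "subalgebra \<mu> (outside_algebra V E q H U)"
proof -
  have "sets (outside_algebra V E q H U) \<subseteq> sets \<mu>"
    unfolding outside_algebra_def using measurable_restrict_coord[of "V - U"]
    by (intro sets_image_in_sets) (auto simp: space_eq)
  then show ?thesis
    by (simp add: subalgebra_def outside_algebra_def space_eq)
qed

lemma sets_outside:
  assumes "A \<in> sets (outside_algebra V E q H U)"
  obtains B where "B \<in> sets (PiM (V - U) (\<lambda>_. count_space {1..q}))"
    "A = (\<lambda>\<phi>. restrict \<phi> (V - U)) -` B \<inter> space \<mu>"
proof -
  have "(\<lambda>\<phi>. restrict \<phi> (V - U)) \<in> space \<mu> \<rightarrow> space (PiM (V - U) (\<lambda>_. count_space {1..q}))"
    using measurable_space[OF measurable_restrict_coord[of "V - U"]] by auto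
  then show thesis
    using assms that unfolding outside_algebra_def space_hom_space space_eq[symmetric]
    by (subst (asm) sets_vimage_algebra2) auto
qed

lemma rect_sets_outside:
  assumes "finite W" "W \<subseteq> V - U"
  shows "rect \<mu> W X \<in> sets (outside_algebra V E q H U)"
proof -
  let ?F = "outside_algebra V E q H U"
  let ?P = "PiM (V - U) (\<lambda>_. count_space {1..q})"
  have sp: "space ?F = space \<mu>" by (simp add: outside_algebra_def space_eq)
  have "(\<lambda>\<phi>. restrict \<phi> (V - U)) \<in> space \<mu> \<rightarrow> space ?P"
    using measurable_space[OF measurable_restrict_coord[of "V - U"]] by auto
  then have res: "(\<lambda>\<phi>. restrict \<phi> (V - U)) \<in> measurable ?F ?P"
    unfolding outside_algebra_def by (intro measurable_vimage_algebra1) (simp add: space_eq)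
  have "{\<phi> \<in> space ?F. \<phi> v \<in> X v} \<in> sets ?F" if "v \<in> W" for v
  proof -
    have v: "v \<in> V - U" using that assms by auto
    have "(\<lambda>\<phi>. restrict \<phi> (V - U) v) \<in> measurable ?F (count_space {1..q})"
      by (rule measurable_compose[OF res measurable_component_singleton[OF v]])
    then have "(\<lambda>\<phi>. restrict \<phi> (V - U) v) -` (X v \<inter> {1..q}) \<inter> space ?F \<in> sets ?F"
      by (rule measurable_sets) auto
    also have "(\<lambda>\<phi>. restrict \<phi> (V - U) v) -` (X v \<inter> {1..q}) \<inter> space ?F = {\<phi> \<in> space ?F. \<phi> v \<in> X v}"
      using v coord_in[of _ v] by (auto simp: sp)
    finally show ?thesis .
  qed
  then show ?thesis unfolding rect_def sp[symmetric]
    using assms by (intro sets.sets_Collect_finite_All) auto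
qed

end

text \<open>Rectangles over \<open>J\<close> are finite sums of cylinders over a larger
  \<open>W\<close>, so agreement on a cofinal family of index sets settles all finite-dimensional
  rectangles, and these determine a finite measure on the product. With \<open>U\<close> empty this
  identifies measures; for a patch \<open>U\<close> it identifies conditional expectations.\<close>

lemma measure_eq_outside:
  assumes \<mu>: "hom_measure \<mu> V E q H" and \<nu>: "hom_measure \<nu> V E q H"
    and cofinal: "\<And>J. finite J \<Longrightarrow> J \<subseteq> V - U \<Longrightarrow> \<exists>W. finite W \<and> J \<subseteq> W \<and> W \<subseteq> V - U \<and>
        (\<forall>c\<in>PiE W (\<lambda>_. {1..q}). measure \<mu> (cyl \<mu> W c) = measure \<nu> (cyl \<nu> W c))"
    and A: "A \<in> sets (outside_algebra V E q H U)"
  shows "measure \<mu> A = measure \<nu> A"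
proof -
  interpret \<mu>: hom_measure \<mu> V E q H by fact
  interpret \<nu>: hom_measure \<nu> V E q H by fact
  let ?P = "PiM (V - U) (\<lambda>_. count_space {1..q})"
  let ?res = "\<lambda>\<phi>. restrict \<phi> (V - U)"
  have sp: "space \<mu> = space \<nu>" by (simp add: \<mu>.space_eq \<nu>.space_eq)
  note m = \<mu>.measurable_restrict_coord[of "V - U", OF Diff_subset]
    \<nu>.measurable_restrict_coord[of "V - U", OF Diff_subset]
  have eq: "distr \<mu> ?P ?res = distr \<nu> ?P ?res"
  proof (rule measure_eqI_PiM_infinite)
    fix X J
    assume J: "finite J" "J \<subseteq> V - U" and X: "\<And>i. i \<in> J \<Longrightarrow> X i \<in> sets (count_space {1..q})"
    let ?e = "prod_emb (V - U) (\<lambda>_. count_space {1..q}) J (PiE J X)"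
    obtain W where W: "finite W" "J \<subseteq> W" "W \<subseteq> V - U"
      and eqW: "\<forall>c\<in>PiE W (\<lambda>_. {1..q}). measure \<mu> (cyl \<mu> W c) = measure \<nu> (cyl \<nu> W c)"
      using cofinal[OF J] by blast
    define Y where "Y v = (if v \<in> J then X v else {1..q})" for v
    have pre: "?res -` ?e \<inter> space M = rect M W Y" if "M = \<mu> \<or> M = \<nu>" for M
    proof -
      have in_q: "\<phi> v \<in> {1..q}" if "\<phi> \<in> space M" "v \<in> V" for \<phi> v
        using that \<open>M = \<mu> \<or> M = \<nu>\<close> \<mu>.coord_in[of \<phi> v] \<nu>.coord_in[of \<phi> v] by blast
      show ?thesis
        unfolding rect_def prod_emb_def Y_def using J W in_q by (auto simp: PiE_iff Int_def)
    qed
    have WV: "W \<subseteq> V" using W by auto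
    have sets: "?e \<in> sets ?P" using J X by (intro sets_PiM_I) auto
    have "measure \<mu> (rect \<mu> W Y) = measure \<nu> (rect \<nu> W Y)"
      unfolding \<mu>.measure_rect[OF W(1) WV] \<nu>.measure_rect[OF W(1) WV]
      by (intro sum.cong refl eqW[rule_format]) auto
    then show "emeasure (distr \<mu> ?P ?res) ?e = emeasure (distr \<nu> ?P ?res) ?e"
      unfolding emeasure_distr[OF m(1) sets] emeasure_distr[OF m(2) sets]
        pre[OF disjI1[OF refl]] pre[OF disjI2[OF refl]]
      by (simp add: \<mu>.emeasure_eq_measure \<nu>.emeasure_eq_measure)
  next
    show "finite_measure (distr \<mu> ?P ?res)" using m by (intro \<mu>.finite_measure_distr)
  qed auto
  obtain B where B: "B \<in> sets ?P" "A = ?res -` B \<inter> space \<mu>"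
    using \<mu>.sets_outside[OF A] .
  have "measure \<mu> A = measure (distr \<mu> ?P ?res) B"
    using B m by (simp add: measure_distr)
  also have "\<dots> = measure \<nu> A"
    unfolding eq using B m by (simp add: measure_distr sp)
  finally show ?thesis .
qed

lemma hom_measure_eqI:
  assumes \<mu>: "hom_measure \<mu> V E q H" and \<nu>: "hom_measure \<nu> V E q H"
    and cofinal: "\<And>J. finite J \<Longrightarrow> J \<subseteq> V \<Longrightarrow> \<exists>W. finite W \<and> J \<subseteq> W \<and> W \<subseteq> V \<and>
        (\<forall>c\<in>PiE W (\<lambda>_. {1..q}). measure \<mu> (cyl \<mu> W c) = measure \<nu> (cyl \<nu> W c))"
  shows "\<mu> = \<nu>"
proof (rule measure_eqI)
  interpret \<mu>: hom_measure \<mu> V E q H by fact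
  interpret \<nu>: hom_measure \<nu> V E q H by fact
  show sets: "sets \<mu> = sets \<nu>" by (simp add: \<mu>.sets_eq \<nu>.sets_eq)
  fix A assume "A \<in> sets \<mu>"
  then obtain B where B: "B \<in> sets (PiM V (\<lambda>_. count_space {1..q}))" "A = hom_set V E q H \<inter> B"
    unfolding \<mu>.sets_eq hom_space_def sets_restrict_space by auto
  have "restrict \<phi> V = \<phi>" if "\<phi> \<in> hom_set V E q H" for \<phi>
    using that by (auto simp: hom_set_def PiE_restrict)
  then have "A = (\<lambda>\<phi>. restrict \<phi> (V - {})) -` B \<inter> hom_set V E q H"
    using B(2) by auto
  then have "A \<in> sets (outside_algebra V E q H {})"
    unfolding outside_algebra_def space_hom_space using B(1) by (simp add: in_vimage_algebra)
  then have "measure \<mu> A = measure \<nu> A"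
    using cofinal by (intro measure_eq_outside[OF \<mu> \<nu>]) auto
  then show "emeasure \<mu> A = emeasure \<nu> A"
    by (simp add: \<mu>.emeasure_eq_measure \<nu>.emeasure_eq_measure)
qed

text \<open>The unnormalised conditional weight of a filling of \<open>U\<close>. Activities on the
  boundary cancel under conditioning, so the product runs over \<open>U\<close> only, whereas
  compatibility is tested on \<open>W\<close>, in use \<open>U\<close> with its boundary.\<close>

definition fillw :: "('a \<Rightarrow> 'a \<Rightarrow> bool) \<Rightarrow> (nat \<Rightarrow> nat \<Rightarrow> bool) \<Rightarrow> (nat \<Rightarrow> real) \<Rightarrow> 'a set \<Rightarrow> 'a set \<Rightarrow>
    ('a \<Rightarrow> nat) \<Rightarrow> real" where
  "fillw E H lam U W c = (if compat E H W c then \<Prod>v\<in>U. lam (c v) else 0)"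

lemma fillw_cong: "U \<subseteq> W \<Longrightarrow> (\<And>v. v \<in> W \<Longrightarrow> c v = d v) \<Longrightarrow> fillw E H lam U W c = fillw E H lam U W d"
  unfolding fillw_def using compat_cong[of W c d E H] by (auto intro!: prod.cong)

text \<open>Restriction to \<open>U\<close> matches the homomorphisms with prescribed boundary
  values with the compatible fillings. Their weights share the factor \<open>K\<close> of the
  boundary, which cancels, as does the partition function.\<close>

lemma lam_cond_eq:
  assumes fin: "finite U" "finite B" "U \<inter> B = {}"
    and c: "\<gamma> \<in> U \<rightarrow> {1..q}" "\<psi> \<in> B \<rightarrow> {1..q}" and lam: "\<forall>i\<in>{1..q}. 0 < lam i"
  shows "lam_cond (U \<union> B) E q H lam {c. \<forall>v\<in>U. c v = \<gamma> v} {c. \<forall>v\<in>B. c v = \<psi> v}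
    = fillw E H lam U (U \<union> B) (comb U \<gamma> \<psi>)
      / (\<Sum>c\<in>PiE U (\<lambda>_. {1..q}). fillw E H lam U (U \<union> B) (comb U c \<psi>))"
proof -
  let ?W = "U \<union> B" and ?P = "PiE U (\<lambda>_. {1..q})"
  let ?h = "hom_set ?W E q H" and ?w = "lam_weight lam ?W"
  let ?B = "{c. \<forall>v\<in>B. c v = \<psi> v}"
  define K where "K = (\<Prod>v\<in>B. lam (\<psi> v))"
  have K: "0 < K" unfolding K_def using c lam by (intro prod_pos) auto
  have finh: "finite ?h"
    using fin by (intro finite_subset[of ?h "PiE ?W (\<lambda>_. {1..q})"] finite_PiE) (auto simp: hom_set_def)
  have sum: "(\<Sum>c\<in>?h \<inter> {c. restrict c U \<in> S} \<inter> ?B. ?w c) = K * (\<Sum>c\<in>S. fillw E H lam U ?W (comb U c \<psi>))"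
    if S: "S \<subseteq> ?P" for S
  proof -
    have finS: "finite S" using S fin by (meson finite_PiE finite_atLeastAtMost finite_subset)
    let ?S = "{c \<in> S. compat E H ?W (comb U c \<psi>)}"
    have "(\<Sum>c\<in>S. fillw E H lam U ?W (comb U c \<psi>)) = (\<Sum>c\<in>?S. fillw E H lam U ?W (comb U c \<psi>))"
      using finS by (intro sum.mono_neutral_right) (auto simp: fillw_def)
    also have "K * \<dots> = (\<Sum>c\<in>?S. K * (\<Prod>v\<in>U. lam (c v)))"
      unfolding sum_distrib_left by (intro sum.cong) (auto simp: fillw_def comb_def intro!: prod.cong)
    also have "\<dots> = (\<Sum>c\<in>?h \<inter> {c. restrict c U \<in> S} \<inter> ?B. ?w c)"
    proof (rule sum.reindex_bij_witness[of _ "\<lambda>c. restrict c U" "\<lambda>c. restrict (comb U c \<psi>) ?W"])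
      fix a assume a: "a \<in> ?S"
      then have aP: "a \<in> ?P" using S by auto
      show ra: "restrict (restrict (comb U a \<psi>) ?W) U = a"
        using aP by (auto simp: comb_def fun_eq_iff PiE_def extensional_def)
      have "compat E H ?W (restrict (comb U a \<psi>) ?W)"
        using a compat_cong[of ?W "restrict (comb U a \<psi>) ?W" "comb U a \<psi>" E H] by auto
      moreover have "restrict (comb U a \<psi>) ?W \<in> PiE ?W (\<lambda>_. {1..q})"
        using aP c by (auto simp: comb_def PiE_def Pi_def)
      ultimately show "restrict (comb U a \<psi>) ?W \<in> ?h \<inter> {c. restrict c U \<in> S} \<inter> ?B"
        using a fin(3) ra unfolding hom_set_def compat_def by (auto simp: comb_def)
      have "?w (restrict (comb U a \<psi>) ?W) = (\<Prod>v\<in>U. lam (a v)) * (\<Prod>v\<in>B. lam (\<psi> v))"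
        unfolding lam_weight_def using fin
        by (subst prod.union_disjoint) (auto simp: comb_def intro!: arg_cong2[where f = times] prod.cong)
      then show "?w (restrict (comb U a \<psi>) ?W) = K * (\<Prod>v\<in>U. lam (a v))"
        by (simp add: K_def)
    next
      fix b assume b: "b \<in> ?h \<inter> {c. restrict c U \<in> S} \<inter> ?B"
      show rb: "restrict (comb U (restrict b U) \<psi>) ?W = b"
        using b unfolding hom_set_def by (auto simp: comb_def fun_eq_iff PiE_def extensional_def)
      have "compat E H ?W b" using b by (auto simp: hom_set_def compat_def)
      moreover have "b v = comb U (restrict b U) \<psi> v" if "v \<in> ?W" for v
        using that b by (auto simp: comb_def)
      ultimately have "compat E H ?W (comb U (restrict b U) \<psi>)"
        using compat_cong[of ?W b "comb U (restrict b U) \<psi>" E H] by blast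
      then show "restrict b U \<in> ?S" using b by auto
    qed
    finally show ?thesis ..
  qed
  have g: "restrict \<gamma> U \<in> ?P" using c by auto
  have "?h \<inter> ({c. \<forall>v\<in>U. c v = \<gamma> v} \<inter> ?B) = ?h \<inter> {c. restrict c U \<in> {restrict \<gamma> U}} \<inter> ?B"
    by (auto simp: restrict_def fun_eq_iff)
  then have num: "(\<Sum>c\<in>?h \<inter> ({c. \<forall>v\<in>U. c v = \<gamma> v} \<inter> ?B). ?w c) = K * fillw E H lam U ?W (comb U \<gamma> \<psi>)"
    using sum[of "{restrict \<gamma> U}"] g
      fillw_cong[of U ?W "comb U (restrict \<gamma> U) \<psi>" "comb U \<gamma> \<psi>" E H lam]
    by (auto simp: comb_def)
  have "?h \<inter> ?B = ?h \<inter> {c. restrict c U \<in> ?P} \<inter> ?B"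
    by (auto simp: hom_set_def)
  then have den: "(\<Sum>c\<in>?h \<inter> ?B. ?w c) = K * (\<Sum>c\<in>?P. fillw E H lam U ?W (comb U c \<psi>))"
    using sum[of ?P] by simp
  have wpos: "0 < ?w c" if "c \<in> ?h" for c
    unfolding lam_weight_def using that lam by (intro prod_pos) (auto simp: hom_set_def PiE_def Pi_def)
  \<comment> \<open>Without any homomorphism the left-hand side is 0 by the convention for division
    by zero; the right-hand side is 0 because its numerator is.\<close>
  have z: "(\<Sum>c\<in>?h \<inter> ?B. ?w c) = 0" "(\<Sum>c\<in>?h \<inter> ({c. \<forall>v\<in>U. c v = \<gamma> v} \<inter> ?B). ?w c) = 0"
    if "(\<Sum>c\<in>?h. ?w c) = 0"
  proof -
    have "?h = {}"
    proof (rule ccontr)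
      assume "?h \<noteq> {}"
      then have "0 < (\<Sum>c\<in>?h. ?w c)" using finh wpos by (intro sum_pos) auto
      then show False using that by simp
    qed
    then show "(\<Sum>c\<in>?h \<inter> ?B. ?w c) = 0" "(\<Sum>c\<in>?h \<inter> ({c. \<forall>v\<in>U. c v = \<gamma> v} \<inter> ?B). ?w c) = 0"
      by simp_all
  qed
  show ?thesis
    unfolding lam_cond_def lam_prob_def
  proof (cases "(\<Sum>c\<in>?h. ?w c) = 0")
    case True
    then show "(\<Sum>c\<in>?h \<inter> ({c. \<forall>v\<in>U. c v = \<gamma> v} \<inter> ?B). ?w c) / (\<Sum>c\<in>?h. ?w c)
      / ((\<Sum>c\<in>?h \<inter> ?B. ?w c) / (\<Sum>c\<in>?h. ?w c)) = fillw E H lam U ?W (comb U \<gamma> \<psi>)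
      / (\<Sum>c\<in>?P. fillw E H lam U ?W (comb U c \<psi>))"
      using z num K by simp
  next
    case False
    then show "(\<Sum>c\<in>?h \<inter> ({c. \<forall>v\<in>U. c v = \<gamma> v} \<inter> ?B). ?w c) / (\<Sum>c\<in>?h. ?w c)
      / ((\<Sum>c\<in>?h \<inter> ?B. ?w c) / (\<Sum>c\<in>?h. ?w c)) = fillw E H lam U ?W (comb U \<gamma> \<psi>)
      / (\<Sum>c\<in>?P. fillw E H lam U ?W (comb U c \<psi>))"
      unfolding num den using K by simp
  qed
qed

lemma fillw_nonneg:
  assumes "\<forall>i\<in>{1..q}. 0 < lam i" "c \<in> U \<rightarrow> {1..q}"
  shows "0 \<le> fillw E H lam U W (comb U c d)"
proof -
  have "0 \<le> (\<Prod>v\<in>U. lam (comb U c d v))"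
  proof (rule prod_nonneg)
    fix v assume "v \<in> U"
    then have "comb U c d v \<in> {1..q}" using assms(2) by (auto simp: comb_def)
    then show "0 \<le> lam (comb U c d v)" using assms(1) by (auto intro: less_imp_le)
  qed
  then show ?thesis by (simp add: fillw_def)
qed

section \<open>Conditioning on the outside of a patch\<close>

context hom_measure
begin

lemma finite_measure_subalgebra_outside: "finite_measure_subalgebra \<mu> (outside_algebra V E q H U)"
  using subalgebra_outside by unfold_locales

lemma cyl_Un: "cyl \<mu> (U \<union> W) (comb U c d) = cyl \<mu> U c \<inter> cyl \<mu> (W - U) d"
  by (auto simp: cyl_def comb_def)

text \<open>\<open>is_gibbs\<close> evaluates the conditional probability of a pattern only at configurations showing
  this very pattern. This yields an upper bound for the probability of a given pattern; equality
  follows because both sides have the same sum over all patterns.\<close>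

lemma gibbs_cylinder:
  assumes gibbs: "is_gibbs V E q H lam \<mu>" and lam: "\<forall>i\<in>{1..q}. 0 < lam i"
    and U: "finite U" "U \<subseteq> V" "finite (bdry V E U)"
    and \<gamma>: "\<gamma> \<in> PiE U (\<lambda>_. {1..q})" and \<psi>: "\<psi> \<in> bdry V E U \<rightarrow> {1..q}"
  defines "B \<equiv> bdry V E U"
  defines "F \<equiv> \<lambda>c. fillw E H lam U (U \<union> B) (comb U c \<psi>)"
  shows "measure \<mu> (cyl \<mu> (U \<union> B) (comb U \<gamma> \<psi>)) * (\<Sum>c\<in>PiE U (\<lambda>_. {1..q}). F c)
    = F \<gamma> * measure \<mu> (cyl \<mu> B \<psi>)"
proof -
  let ?P = "PiE U (\<lambda>_. {1..q})" and ?F = "outside_algebra V E q H U"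
  define S where "S = (\<Sum>c\<in>?P. F c)"
  define m where "m c = measure \<mu> (cyl \<mu> (U \<union> B) (comb U c \<psi>))" for c
  have finP: "finite ?P" using U by (intro finite_PiE) auto
  have UB: "U \<inter> B = {}" "B \<subseteq> V - U" "finite B" using U by (auto simp: B_def bdry_def)
  have Fnn: "0 \<le> F c" if "c \<in> ?P" for c
    unfolding F_def using that lam by (intro fillw_nonneg) (auto simp: PiE_def)
  interpret F: finite_measure_subalgebra \<mu> ?F by (rule finite_measure_subalgebra_outside)
  show ?thesis
  proof (cases "S = 0")
    case True
    then have "F \<gamma> = 0"
      using sum_nonneg_eq_0_iff[OF finP, of F] Fnn \<gamma> unfolding S_def by blast
    then show ?thesis using True by (simp add: S_def)
  next
    case False
    then have S: "0 < S" using sum_nonneg[of ?P F] Fnn unfolding S_def by fastforce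
    let ?A = "cyl \<mu> B \<psi>"
    have A: "?A \<in> sets ?F" unfolding cyl_eq_rect using UB by (intro rect_sets_outside)
    have le: "m c \<le> F c / S * measure \<mu> ?A" if c: "c \<in> ?P" for c
    proof -
      let ?C = "cyl \<mu> U c"
      have C: "?C \<in> sets \<mu>" using U by (intro cyl_sets)
      define R where "R = real_cond_exp \<mu> ?F (indicator ?C)"
      have R: "R \<in> borel_measurable ?F" by (simp add: R_def)
      have "{\<phi> \<in> space ?F. R \<phi> \<noteq> F c / S} \<in> sets ?F" using R by measurable
      then have "?A \<inter> {\<phi> \<in> space ?F. R \<phi> \<noteq> F c / S} \<in> sets ?F" using A by blast
      \<comment> \<open>The part of the boundary event where the conditional probability of the
        pattern \<open>c\<close> deviates from the prescribed value. The Gibbs condition makes only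
        \<open>D \<inter> ?C\<close> null; on the rest of \<open>D\<close> it speaks of other
        patterns.\<close>
      moreover define D where "D = {\<phi> \<in> ?A. R \<phi> \<noteq> F c / S}"
      moreover have "?A \<inter> {\<phi> \<in> space ?F. R \<phi> \<noteq> F c / S} = D"
        by (auto simp: D_def cyl_def outside_algebra_def space_eq)
      ultimately have D: "D \<in> sets ?F" by simp
      have Am: "?A \<in> sets \<mu>" and Dm: "D \<in> sets \<mu>"
        using subalgebra_outside[of U] A D by (auto simp: subalgebra_def)
      have "AE \<phi> in \<mu>. real_cond_exp \<mu> ?F (indicator {x \<in> space \<mu>. \<forall>v\<in>U. x v = \<phi> v}) \<phi>
          = lam_cond (U \<union> B) E q H lam {c. \<forall>v\<in>U. c v = \<phi> v} {c. \<forall>v\<in>B. c v = \<phi> v}"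
        using gibbs U unfolding is_gibbs_def B_def by blast
      then have "AE \<phi> in \<mu>. \<phi> \<notin> D \<inter> ?C"
      proof (rule AE_mp, intro AE_I2 impI notI)
        fix \<phi> assume *: "real_cond_exp \<mu> ?F (indicator {x \<in> space \<mu>. \<forall>v\<in>U. x v = \<phi> v}) \<phi>
          = lam_cond (U \<union> B) E q H lam {c. \<forall>v\<in>U. c v = \<phi> v} {c. \<forall>v\<in>B. c v = \<phi> v}"
          and \<phi>: "\<phi> \<in> D \<inter> ?C"
        have \<phi>U: "\<forall>v\<in>U. \<phi> v = c v" and \<phi>B: "\<forall>v\<in>B. \<phi> v = \<psi> v"
          using \<phi> by (auto simp: D_def cyl_def)
        have "{x \<in> space \<mu>. \<forall>v\<in>U. x v = \<phi> v} = ?C" using \<phi>U by (auto simp: cyl_def)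
        moreover have "{c. \<forall>v\<in>U. c v = \<phi> v} = {c'. \<forall>v\<in>U. c' v = c v}" using \<phi>U by auto
        moreover have "{c. \<forall>v\<in>B. c v = \<phi> v} = {c. \<forall>v\<in>B. c v = \<psi> v}" using \<phi>B by auto
        moreover have "lam_cond (U \<union> B) E q H lam {c'. \<forall>v\<in>U. c' v = c v} {c. \<forall>v\<in>B. c v = \<psi> v}
            = F c / S"
          unfolding F_def S_def
          by (rule lam_cond_eq) (use U UB lam \<psi> c in \<open>auto simp: B_def PiE_def\<close>)
        ultimately have "R \<phi> = F c / S" using * by (simp add: R_def)
        then show False using \<phi> by (simp add: D_def)
      qed
      then have null: "measure \<mu> (D \<inter> ?C) = 0"
        using C Dm by (intro measure_eq_0_null_sets) (simp add: AE_iff_null_sets)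
      \<comment> \<open>As \<open>D\<close> might have positive measure, the integral is taken over
        \<open>?A - D\<close>, where the conditional probability is known; enlarging to
        \<open>?A\<close> is the step that costs equality.\<close>
      have "measure \<mu> (?A \<inter> ?C) = measure \<mu> (((?A - D) \<inter> ?C) \<union> (D \<inter> ?C))"
        by (intro arg_cong[where f = "measure \<mu>"]) (auto simp: D_def)
      also have "\<dots> = measure \<mu> ((?A - D) \<inter> ?C)"
        using Am Dm C null by (subst finite_measure_Union) auto
      also have "\<dots> = (\<integral>x\<in>?A - D. indicator ?C x \<partial>\<mu>)"
        using Am Dm C sets.sets_into_space[OF Am]
        by (simp add: set_lebesgue_integral_def indicator_inter_arith[symmetric] Int_absorb2 inf_assoc)
      also have "\<dots> = (\<integral>x\<in>?A - D. R x \<partial>\<mu>)"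
        unfolding R_def using C A D by (intro F.real_cond_exp_intA) (auto simp: less_top[symmetric])
      also have "\<dots> = (\<integral>x\<in>?A - D. F c / S \<partial>\<mu>)"
        using Am Dm by (intro set_lebesgue_integral_cong) (auto simp: D_def)
      also have "\<dots> = F c / S * measure \<mu> (?A - D)"
        using Am Dm by (simp add: set_integral_const)
      also have "\<dots> \<le> F c / S * measure \<mu> ?A"
        using Am Dm Fnn[OF c] S by (intro mult_left_mono finite_measure_mono) auto
      finally show ?thesis
        unfolding m_def cyl_Un using UB by (simp add: Int_commute Diff_triv inf_commute)
    qed
    have "(\<Sum>c\<in>?P. m c) = measure \<mu> ?A"
      unfolding m_def using U UB \<psi> by (intro measure_cyl_split[symmetric]) (auto simp: B_def)
    also have "\<dots> = (\<Sum>c\<in>?P. F c / S * measure \<mu> ?A)"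
      using False by (simp add: S_def sum_distrib_right[symmetric] sum_divide_distrib[symmetric])
    finally have "m \<gamma> = F \<gamma> / S * measure \<mu> ?A"
      using le \<gamma> finP by (rule sum_mono_inv)
    then show ?thesis using False by (simp add: m_def S_def field_simps)
  qed
qed

lemma hom_measure_density:
  assumes g: "g \<in> borel_measurable \<mu>" and b: "\<And>x. 0 \<le> g x" "\<And>x. g x \<le> K"
  shows "hom_measure (density \<mu> (\<lambda>x. ennreal (g x))) V E q H"
    and "A \<in> sets \<mu> \<Longrightarrow> measure (density \<mu> (\<lambda>x. ennreal (g x))) A = (\<integral>x\<in>A. g x \<partial>\<mu>)"
proof -
  have int: "integrable \<mu> (\<lambda>x. indicator A x * g x)" if "A \<in> sets \<mu>" for A
    using that g b by (intro integrable_const_bound[of _ K])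
      (auto simp: indicator_def abs_mult intro!: AE_I2 order_trans[OF b])
  have em: "emeasure (density \<mu> (\<lambda>x. ennreal (g x))) A = ennreal (\<integral>x\<in>A. g x \<partial>\<mu>)" if "A \<in> sets \<mu>" for A
  proof -
    have "emeasure (density \<mu> (\<lambda>x. ennreal (g x))) A = (\<integral>\<^sup>+x. ennreal (indicator A x * g x) \<partial>\<mu>)"
      using g that by (subst emeasure_density)
        (auto intro!: nn_integral_cong simp: indicator_def)
    also have "\<dots> = ennreal (\<integral>x. indicator A x * g x \<partial>\<mu>)"
      using int[OF that] b by (intro nn_integral_eq_integral) auto
    finally show ?thesis by (simp add: set_lebesgue_integral_def)
  qed
  show "hom_measure (density \<mu> (\<lambda>x. ennreal (g x))) V E q H"
  proof (intro hom_measure.intro finite_measureI hom_measure_axioms.intro)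
    show "emeasure (density \<mu> (\<lambda>x. ennreal (g x))) (space (density \<mu> (\<lambda>x. ennreal (g x)))) \<noteq> \<infinity>"
      using em[OF sets.top] by simp
  qed (simp add: sets_eq)
  show "measure (density \<mu> (\<lambda>x. ennreal (g x))) A = (\<integral>x\<in>A. g x \<partial>\<mu>)" if "A \<in> sets \<mu>"
    unfolding measure_def em[OF that] using b
    by (intro enn2real_ennreal) (auto simp: set_lebesgue_integral_def intro!: Bochner_Integration.integral_nonneg)
qed

text \<open>A conditional expectation is determined by its integrals over outside events. These
  integrals are the values of two densities, one with the indicator of the pattern and one with the
  candidate value. By \<open>measure_eq_outside\<close> the densities need only be compared on
  cylinders over \<open>W - U\<close>, where the assumed factorisation gives equality.\<close>

lemma gibbsI:
  assumes prob: "prob_space \<mu>" and lam: "\<forall>i\<in>{1..q}. 0 < lam i"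
    and bdry: "\<And>U. finite U \<Longrightarrow> U \<subseteq> V \<Longrightarrow> finite (bdry V E U)"
    and factor: "\<And>U J. finite U \<Longrightarrow> U \<subseteq> V \<Longrightarrow> finite J \<Longrightarrow> J \<subseteq> V \<Longrightarrow>
      \<exists>W R. finite W \<and> J \<subseteq> W \<and> W \<subseteq> V \<and>
        (\<forall>c\<in>PiE U (\<lambda>_. {1..q}). \<forall>d\<in>PiE (W - U) (\<lambda>_. {1..q}).
          measure \<mu> (cyl \<mu> W (comb U c d)) = R d * fillw E H lam U (U \<union> bdry V E U) (comb U c d))"
  shows "is_gibbs V E q H lam \<mu>"
  unfolding is_gibbs_def
proof (intro conjI allI impI prob sets_eq)
  fix U assume U': "finite U \<and> U \<subseteq> V"
  then have U: "finite U" "U \<subseteq> V" by auto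
  define B where "B = bdry V E U"
  have B: "finite B" "U \<inter> B = {}" "B \<subseteq> V - U" using bdry[OF U] by (auto simp: B_def bdry_def)
  let ?F = "outside_algebra V E q H U" and ?P = "PiE U (\<lambda>_. {1..q})" and ?PB = "PiE B (\<lambda>_. {1..q})"
  interpret F: finite_measure_subalgebra \<mu> ?F by (rule finite_measure_subalgebra_outside)
  have finP: "finite ?P" "finite ?PB" using U B by (auto intro!: finite_PiE)
  define f where "f c d = fillw E H lam U (U \<union> B) (comb U c d)" for c d
  define l where "l c d = f c d / (\<Sum>c'\<in>?P. f c' d)" for c d
  have f_cong: "f c d = f c d'" if "\<And>v. v \<in> B \<Longrightarrow> d v = d' v" for c d d'
    unfolding f_def using that by (intro fillw_cong) (auto simp: comb_def)
  have l_cong: "l c d = l c d'" if "\<And>v. v \<in> B \<Longrightarrow> d v = d' v" for c d d'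
    unfolding l_def using f_cong[OF that] by simp
  have fnn: "0 \<le> f c d" if "c \<in> ?P" for c d
    unfolding f_def using that lam by (intro fillw_nonneg) (auto simp: PiE_def)
  have lb: "0 \<le> l c d" "l c d \<le> 1" if "c \<in> ?P" for c d
  proof -
    have "f c d \<le> (\<Sum>c'\<in>?P. f c' d)" using that finP fnn by (intro member_le_sum) auto
    then show "0 \<le> l c d" "l c d \<le> 1"
      unfolding l_def using fnn[OF that] sum_nonneg[of ?P "\<lambda>c. f c d"] fnn
      by (auto simp: divide_le_eq_1)
  qed
  have main: "AE \<phi> in \<mu>. real_cond_exp \<mu> ?F (indicator (cyl \<mu> U c)) \<phi> = l c \<phi>" if c: "c \<in> ?P" for c
  proof -
    \<comment> \<open>The candidate \<open>l c \<phi>\<close> depends on \<open>\<phi>\<close> only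
      through its boundary values. As a finite combination of indicators of outside cylinders it is
      visibly measurable for the outside algebra.\<close>
    define g where "g \<phi> = (\<Sum>d\<in>?PB. l c d * indicator (cyl \<mu> B d) \<phi>)" for \<phi>
    have cylF: "cyl \<mu> B d \<in> sets ?F" for d
      unfolding cyl_eq_rect using B by (intro rect_sets_outside)
    have g_eq: "g \<phi> = l c \<phi>" if "\<phi> \<in> space \<mu>" for \<phi>
    proof -
      have r: "restrict \<phi> B \<in> ?PB" using coord_in[OF that] B by auto
      have "g \<phi> = (\<Sum>d\<in>?PB. if d = restrict \<phi> B then l c d else 0)"
        unfolding g_def
      proof (intro sum.cong refl)
        fix d assume d: "d \<in> ?PB"
        have "\<phi> \<in> cyl \<mu> B d \<longleftrightarrow> d = restrict \<phi> B"
          using that d by (auto simp: cyl_def PiE_def extensional_def fun_eq_iff)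
        then show "l c d * indicator (cyl \<mu> B d) \<phi> = (if d = restrict \<phi> B then l c d else 0)"
          by (auto simp: indicator_def)
      qed
      also have "\<dots> = l c (restrict \<phi> B)" using r finP by (simp add: sum.delta)
      also have "\<dots> = l c \<phi>" by (intro l_cong) auto
      finally show ?thesis .
    qed
    have gF: "g \<in> borel_measurable ?F"
      unfolding g_def using cylF by (intro borel_measurable_sum borel_measurable_times) auto
    then have gm: "g \<in> borel_measurable \<mu>"
      by (rule measurable_from_subalg[OF subalgebra_outside])
    \<comment> \<open>Cutting off outside the space makes the bounds 0 and 1 hold everywhere, as
      \<open>hom_measure_density\<close> demands.\<close>
    define g' where "g' \<phi> = (if \<phi> \<in> space \<mu> then g \<phi> else 0)" for \<phi>
    have g'b: "0 \<le> g' \<phi>" "g' \<phi> \<le> 1" for \<phi> using lb[OF c] g_eq by (auto simp: g'_def)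
    have g'F: "g' \<in> borel_measurable ?F" and g'm: "g' \<in> borel_measurable \<mu>"
    proof -
      have "space ?F = space \<mu>" by (simp add: outside_algebra_def space_eq)
      then show "g' \<in> borel_measurable ?F" "g' \<in> borel_measurable \<mu>"
        using gF gm measurable_cong[of ?F g' g borel] measurable_cong[of \<mu> g' g borel]
        by (simp_all add: g'_def)
    qed
    let ?C = "cyl \<mu> U c"
    have C: "?C \<in> sets \<mu>" using U by (intro cyl_sets)
    let ?\<mu>1 = "density \<mu> (\<lambda>x. ennreal (indicator ?C x))" and ?\<mu>2 = "density \<mu> (\<lambda>x. ennreal (g' x))"
    have Cm: "indicator ?C \<in> borel_measurable \<mu>" using C by simp
    have i1: "(0::real) \<le> indicator ?C x" "indicator ?C x \<le> (1::real)" for x by (auto simp: indicator_def)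
    note h1 = hom_measure_density[OF Cm i1] and h2 = hom_measure_density[OF g'm g'b]
    have cyl_eq: "cyl ?\<mu>1 W d = cyl \<mu> W d" "cyl ?\<mu>2 W d = cyl \<mu> W d" for W d
      by (simp_all add: cyl_def)
    have eq: "measure ?\<mu>1 A = measure ?\<mu>2 A" if "A \<in> sets ?F" for A
    proof (rule measure_eq_outside[OF h1(1) h2(1) _ that])
      fix J assume J: "finite J" "J \<subseteq> V - U"
      have J': "finite (J \<union> U \<union> B)" "J \<union> U \<union> B \<subseteq> V" using J B U by auto
      obtain W R where *: "finite W \<and> J \<union> U \<union> B \<subseteq> W \<and> W \<subseteq> V \<and>
          (\<forall>c\<in>?P. \<forall>d\<in>PiE (W - U) (\<lambda>_. {1..q}). measure \<mu> (cyl \<mu> W (comb U c d)) = R d * f c d)"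
        using factor[OF U J', folded B_def] unfolding f_def by (elim exE)
      then have W: "finite W" "J \<union> U \<union> B \<subseteq> W" "W \<subseteq> V" by (simp_all only: simp_thms)
      have fac: "measure \<mu> (cyl \<mu> W (comb U c d)) = R d * f c d"
        if "c \<in> ?P" "d \<in> PiE (W - U) (\<lambda>_. {1..q})" for c d
        using *[THEN conjunct2, THEN conjunct2, THEN conjunct2, rule_format, OF that] .
      show "\<exists>W. finite W \<and> J \<subseteq> W \<and> W \<subseteq> V - U \<and> (\<forall>d\<in>PiE W (\<lambda>_. {1..q}).
          measure ?\<mu>1 (cyl ?\<mu>1 W d) = measure ?\<mu>2 (cyl ?\<mu>2 W d))"
      proof (intro exI[of _ "W - U"] conjI ballI)
        fix d assume d: "d \<in> PiE (W - U) (\<lambda>_. {1..q})"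
        let ?D = "cyl \<mu> (W - U) d"
        have D: "?D \<in> sets \<mu>" using W by (intro cyl_sets) auto
        have UW: "U \<union> (W - U) = W" using W by auto
        have "measure \<mu> ?D = (\<Sum>c\<in>?P. measure \<mu> (cyl \<mu> (U \<union> (W - U)) (comb U c d)))"
          using U W d by (intro measure_cyl_split) (auto simp: PiE_def)
        also have "\<dots> = R d * (\<Sum>c\<in>?P. f c d)"
          unfolding UW sum_distrib_left using fac d by (intro sum.cong) auto
        finally have mD: "measure \<mu> ?D = R d * (\<Sum>c\<in>?P. f c d)" .
        \<comment> \<open>If no filling has positive weight, the quotient \<open>l c d\<close> is 0
          by convention; this agrees with the cylinder, whose measure then vanishes.\<close>
        have zero: "f c d = 0" if "(\<Sum>c\<in>?P. f c d) = 0"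
          using sum_nonneg_eq_0_iff[OF finP(1), of "\<lambda>c. f c d"] fnn that c by auto
        have "cyl \<mu> W (comb U c d) = ?D \<inter> ?C"
          using W(2) by (auto simp: cyl_def comb_def)
        then have "measure ?\<mu>1 ?D = measure \<mu> (cyl \<mu> W (comb U c d))"
          using h1(2)[OF D] D C sets.sets_into_space[OF D]
          by (simp add: set_lebesgue_integral_def indicator_inter_arith[symmetric] Int_absorb2 inf_assoc)
        also have "\<dots> = l c d * measure \<mu> ?D"
          unfolding fac[OF c d] mD l_def using zero by (cases "(\<Sum>c\<in>?P. f c d) = 0") auto
        also have "\<dots> = (\<integral>x\<in>?D. l c d \<partial>\<mu>)"
          using D by (simp add: set_integral_const)
        also have "\<dots> = (\<integral>x\<in>?D. g' x \<partial>\<mu>)"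
        proof (intro set_lebesgue_integral_cong D allI impI)
          fix \<phi> assume "\<phi> \<in> ?D"
          then have "g' \<phi> = l c \<phi>" "\<And>v. v \<in> B \<Longrightarrow> \<phi> v = d v"
            using g_eq W B(2) by (auto simp: g'_def cyl_def)
          then show "l c d = g' \<phi>" using l_cong[of \<phi> d c] by simp
        qed
        finally show "measure ?\<mu>1 (cyl ?\<mu>1 (W - U) d) = measure ?\<mu>2 (cyl ?\<mu>2 (W - U) d)"
          unfolding cyl_eq h2(2)[OF D] .
      qed (use W J in auto)
    qed
    have "AE \<phi> in \<mu>. real_cond_exp \<mu> ?F (indicator ?C) \<phi> = g' \<phi>"
    proof (rule F.real_cond_exp_charact)
      fix A assume A: "A \<in> sets ?F"
      then have Am: "A \<in> sets \<mu>" using subalgebra_outside[of U] by (auto simp: subalgebra_def)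
      show "(\<integral>x\<in>A. indicator ?C x \<partial>\<mu>) = (\<integral>x\<in>A. g' x \<partial>\<mu>)"
        using eq[OF A] unfolding h1(2)[OF Am] h2(2)[OF Am] .
    next
      show "integrable \<mu> (indicator ?C :: _ \<Rightarrow> real)" using C by (simp add: less_top[symmetric])
      show "integrable \<mu> g'" using g'm g'b by (intro integrable_const_bound[of _ 1]) auto
    qed (rule g'F)
    then show ?thesis by (rule AE_mp) (auto intro!: AE_I2 simp: g'_def g_eq)
  qed
  \<comment> \<open>There are finitely many patterns, so one null set serves all of them, and the
    pattern may then be taken from the configuration itself.\<close>
  have "AE \<phi> in \<mu>. \<forall>c\<in>?P. real_cond_exp \<mu> ?F (indicator (cyl \<mu> U c)) \<phi> = l c \<phi>"
    using main finP by (intro AE_finite_allI) auto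
  then show "AE \<psi> in \<mu>. real_cond_exp \<mu> ?F (indicator {\<phi> \<in> space \<mu>. \<forall>v\<in>U. \<phi> v = \<psi> v}) \<psi>
      = lam_cond (U \<union> bdry V E U) E q H lam {c. \<forall>v\<in>U. c v = \<psi> v} {c. \<forall>v\<in>bdry V E U. c v = \<psi> v}"
  proof (rule AE_mp, intro AE_I2 impI)
    fix \<psi> assume \<psi>: "\<psi> \<in> space \<mu>"
      and *: "\<forall>c\<in>?P. real_cond_exp \<mu> ?F (indicator (cyl \<mu> U c)) \<psi> = l c \<psi>"
    have rP: "restrict \<psi> U \<in> ?P" using coord_in[OF \<psi>] U by auto
    have "{\<phi> \<in> space \<mu>. \<forall>v\<in>U. \<phi> v = \<psi> v} = cyl \<mu> U (restrict \<psi> U)" by (auto simp: cyl_def)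
    then have "real_cond_exp \<mu> ?F (indicator {\<phi> \<in> space \<mu>. \<forall>v\<in>U. \<phi> v = \<psi> v}) \<psi> = l (restrict \<psi> U) \<psi>"
      using * rP by simp
    also have "\<dots> = lam_cond (U \<union> B) E q H lam {c. \<forall>v\<in>U. c v = restrict \<psi> U v} {c. \<forall>v\<in>B. c v = \<psi> v}"
      unfolding l_def f_def using U B lam coord_in[OF \<psi>]
      by (intro lam_cond_eq[symmetric]) (auto simp: restrict_def)
    also have "{c. \<forall>v\<in>U. c v = restrict \<psi> U v} = {c. \<forall>v\<in>U. c v = \<psi> v}" by auto
    finally show "real_cond_exp \<mu> ?F (indicator {\<phi> \<in> space \<mu>. \<forall>v\<in>U. \<phi> v = \<psi> v}) \<psi>
      = lam_cond (U \<union> bdry V E U) E q H lam {c. \<forall>v\<in>U. c v = \<psi> v} {c. \<forall>v\<in>bdry V E U. c v = \<psi> v}"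
      unfolding B_def .
  qed
qed

end

section \<open>Uniqueness\<close>

lemma board_automorphism_comp:
  assumes "board_automorphism V E f" "board_automorphism V E g"
  shows "board_automorphism V E (f \<circ> g)"
proof -
  have "g x \<in> V" if "x \<in> V" for x
    using that assms(2) by (auto simp: board_automorphism_def bij_betw_def)
  then show ?thesis
    using assms by (simp add: board_automorphism_def bij_betw_trans[of g V V f V])
qed

text \<open>Swapping the letters 0 and \<open>a\<close> settles the arcs leaving the root. A longer
  arc comes from the arc with its last letter removed, by right multiplication with that
  letter.\<close>

lemma ex_automorphism_arc:
  assumes "a # v \<in> tree_V r"
  shows "\<exists>g. board_automorphism (tree_V r) tree_E g \<and> g [] = v \<and> g [0] = a # v"
  using assms
proof (induction v rule: rev_induct)
  case Nil
  then have "a \<le> r" by (simp add: Cons_in_tree)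
  then show ?case
    by (intro exI[of _ "map (Transposition.transpose 0 a)"]) (simp add: swap_automorphism)
next
  case (snoc b v)
  have *: "(a # v) @ [b] \<in> tree_V r" using snoc.prems by simp
  then have b: "b \<le> r" "a # v \<in> tree_V r" "last (a # v) \<noteq> b"
    unfolding snoc_in_tree by auto
  obtain g where g: "board_automorphism (tree_V r) tree_E g" "g [] = v" "g [0] = a # v"
    using snoc.IH b by blast
  have "rmult b v = v @ [b]" "rmult b (a # v) = a # v @ [b]"
    using b by (auto simp: rmult_def split: if_splits)
  then show ?case
    using g board_automorphism_comp[OF rmult_automorphism[OF b(1)] g(1)]
    by (metis append_Cons comp_apply)
qed

lemma tree_bdry_finite: "finite U \<Longrightarrow> U \<subseteq> tree_V r \<Longrightarrow> finite (bdry (tree_V r) tree_E U)"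
  by (rule finite_subset[of _ "\<Union>u\<in>U. {x \<in> tree_V r. tree_E u x}"])
    (auto simp: bdry_def tree_E_sym[of _ "_ :: nat list"] intro: tree_nbrs)

context hom_measure
begin

lemma automorphism_measurable:
  assumes "board_automorphism V E g"
  shows "(\<lambda>\<phi>. restrict (\<phi> \<circ> g) V) \<in> measurable \<mu> (hom_space V E q H)"
proof -
  have gV: "g x \<in> V" if "x \<in> V" for x
    using that assms by (auto simp: board_automorphism_def bij_betw_def)
  show ?thesis
    unfolding hom_space_def
  proof (rule measurable_restrict_space2)
    show "(\<lambda>\<phi>. restrict (\<phi> \<circ> g) V) \<in> space \<mu> \<rightarrow> hom_set V E q H"
    proof
      fix \<phi> assume "\<phi> \<in> space \<mu>"
      then have \<phi>: "\<phi> \<in> V \<rightarrow> {1..q}" "\<And>x y. x \<in> V \<Longrightarrow> y \<in> V \<Longrightarrow> E x y \<Longrightarrow> H (\<phi> x) (\<phi> y)"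
        unfolding space_eq hom_set_def by auto
      have "H (\<phi> (g x)) (\<phi> (g y))" if "x \<in> V" "y \<in> V" "E x y" for x y
      proof (rule \<phi>(2))
        show "E (g x) (g y)" using assms that unfolding board_automorphism_def by blast
      qed (use gV that in auto)
      then show "restrict (\<phi> \<circ> g) V \<in> hom_set V E q H"
        using \<phi>(1) gV unfolding hom_set_def by (simp add: Pi_iff)
    qed
    show "(\<lambda>\<phi>. restrict (\<phi> \<circ> g) V) \<in> measurable \<mu> (PiM V (\<lambda>_. count_space {1..q}))"
      unfolding comp_def using gV by (intro measurable_restrict measurable_coord)
  qed
qed

lemma measure_distr_automorphism:
  assumes g: "board_automorphism V E g" and W: "finite W" "W \<subseteq> V"
  shows "measure (distr \<mu> (hom_space V E q H) (\<lambda>\<phi>. restrict (\<phi> \<circ> g) V)) (cyl \<mu> W (c \<circ> g))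
    = measure \<mu> (cyl \<mu> (g ` W) c)"
proof -
  note m = automorphism_measurable[OF g]
  have "(\<lambda>\<phi>. restrict (\<phi> \<circ> g) V) -` cyl \<mu> W (c \<circ> g) \<inter> space \<mu> = cyl \<mu> (g ` W) c"
    using W measurable_space[OF m] by (auto simp: cyl_def space_eq)
  then show ?thesis
    using measure_distr[OF m, of "cyl \<mu> W (c \<circ> g)"] cyl_sets[OF W] by (simp add: sets_eq)
qed

end

section \<open>Marginals of a simple invariant Gibbs measure\<close>

locale simple_invariant_gibbs = cgraph +
  fixes r :: nat and lam :: "nat \<Rightarrow> real" and \<mu> :: "(nat list \<Rightarrow> nat) measure"
  assumes lam: "\<forall>i\<in>{1..q}. 0 < lam i"
    and gibbs: "is_gibbs (tree_V r) tree_E q H lam \<mu>"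
    and simple: "is_simple (tree_V r) tree_E q H \<mu>"
    and invariant: "is_invariant (tree_V r) tree_E q H \<mu>"
begin

sublocale prob_space \<mu>
  using gibbs by (simp add: is_gibbs_def)

sublocale hom_measure \<mu> "tree_V r" tree_E q H
  using gibbs by unfold_locales (simp add: is_gibbs_def)

definition pnode :: "nat \<Rightarrow> real" where
  "pnode i = measure \<mu> (cyl \<mu> {[]} (\<lambda>_. i))"

definition pedge :: "nat \<Rightarrow> nat \<Rightarrow> real" where
  "pedge i j = measure \<mu> (cyl \<mu> {[], [0]} (\<lambda>x. if x = [] then i else j))"

lemma invariant_cyl:
  assumes "board_automorphism (tree_V r) tree_E g" "finite W" "W \<subseteq> tree_V r"
  shows "measure \<mu> (cyl \<mu> (g ` W) c) = measure \<mu> (cyl \<mu> W (c \<circ> g))"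
  using measure_distr_automorphism[OF assms, of c] invariant assms(1) by (simp add: is_invariant_def)

lemma zero_in_tree: "[0] \<in> tree_V r"
  by (simp add: Cons_in_tree)

lemma measure_arc:
  assumes "a # v \<in> tree_V r"
  shows "measure \<mu> (cyl \<mu> {v, a # v} c) = pedge (c v) (c (a # v))"
proof -
  obtain g where g: "board_automorphism (tree_V r) tree_E g" "g [] = v" "g [0] = a # v"
    using ex_automorphism_arc[OF assms] by blast
  have "measure \<mu> (cyl \<mu> (g ` {[], [0]}) c) = measure \<mu> (cyl \<mu> {[], [0]} (c \<circ> g))"
    using g zero_in_tree by (intro invariant_cyl) auto
  also have "cyl \<mu> {[], [0]} (c \<circ> g) = cyl \<mu> {[], [0]} (\<lambda>x. if x = [] then c v else c (a # v))"
    using g by (intro cyl_cong) auto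
  finally show ?thesis using g by (simp add: pedge_def)
qed

text \<open>Right multiplication by the letter 0 exchanges the sites \<open>[]\<close> and
  \<open>[0]\<close>.\<close>

lemma pedge_sym: "pedge i j = pedge j i"
proof -
  have "measure \<mu> (cyl \<mu> (rmult 0 ` {[], [0]}) (\<lambda>x. if x = [] then i else j))
      = measure \<mu> (cyl \<mu> {[], [0]} ((\<lambda>x. if x = [] then i else j) \<circ> rmult 0))"
    using zero_in_tree by (intro invariant_cyl rmult_automorphism) auto
  also have "cyl \<mu> {[], [0]} ((\<lambda>x. if x = [] then i else j) \<circ> rmult 0)
      = cyl \<mu> {[], [0]} (\<lambda>x. if x = [] then j else i)"
    by (intro cyl_cong) (auto simp: rmult_def)
  also have "rmult 0 ` {[], [0]} = {[], [0]}" by (auto simp: rmult_def)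
  finally show ?thesis by (simp add: pedge_def)
qed

lemma measure_vertex:
  assumes "v \<in> tree_V r"
  shows "measure \<mu> (cyl \<mu> {v} c) = pnode (c v)"
proof -
  have "\<exists>g. board_automorphism (tree_V r) tree_E g \<and> g [] = v"
  proof (cases v)
    case Nil
    then show ?thesis
      by (intro exI[of _ id]) (simp add: board_automorphism_def)
  next
    case (Cons a u)
    then obtain g where g: "board_automorphism (tree_V r) tree_E g" "g [0] = v"
      using ex_automorphism_arc assms by blast
    show ?thesis
      by (rule exI[of _ "g \<circ> rmult 0"])
        (use g in \<open>auto intro!: board_automorphism_comp rmult_automorphism simp: rmult_def\<close>)
  qed
  then obtain g where g: "board_automorphism (tree_V r) tree_E g" "g [] = v" by blast
  have "measure \<mu> (cyl \<mu> (g ` {[]}) c) = measure \<mu> (cyl \<mu> {[]} (c \<circ> g))"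
    using g by (intro invariant_cyl) auto
  also have "cyl \<mu> {[]} (c \<circ> g) = cyl \<mu> {[]} (\<lambda>_. c v)"
    using g by (intro cyl_cong) auto
  finally show ?thesis using g by (simp add: pnode_def)
qed

text \<open>Given the colour at \<open>v\<close>, simplicity makes the new leaf \<open>a # v\<close>
  independent of the rest of \<open>W\<close>, which lies in other components of the tree without
  \<open>v\<close>. The product form covers a colour of probability 0.\<close>

lemma markov:
  assumes W: "subtree r W" "v \<in> W" and av: "a # v \<in> tree_V r" "a # v \<notin> W" and cv: "c v \<in> {1..q}"
  shows "measure \<mu> (cyl \<mu> (insert (a # v) W) c) * pnode (c v)
    = measure \<mu> (cyl \<mu> W c) * pedge (c v) (c (a # v))"
proof -
  let ?V = "tree_V r"
  note fW = subtreeD(1,2)[OF W(1)]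
  have vV: "v \<in> ?V" using W fW by auto
  let ?A = "cyl \<mu> {v} c"
  have A: "?A \<in> sets \<mu>" using vV by (intro cyl_sets) auto
  have mA: "measure \<mu> ?A = pnode (c v)" by (rule measure_vertex[OF vV])
  show ?thesis
  proof (cases "pnode (c v) = 0")
    case True
    have "measure \<mu> (cyl \<mu> W c) \<le> measure \<mu> ?A"
      using A W by (intro finite_measure_mono) (auto simp: cyl_def)
    then show ?thesis using True mA measure_nonneg[of \<mu> "cyl \<mu> W c"] by simp
  next
    case False
    define N where "N = uniform_measure \<mu> ?A"
    have nz: "emeasure \<mu> ?A \<noteq> 0" "emeasure \<mu> ?A \<noteq> \<infinity>"
      using False mA measure_nonneg[of \<mu> ?A] by (auto simp: emeasure_eq_measure)
    interpret N: prob_space N unfolding N_def using nz by (rule prob_space_uniform_measure)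
    have N: "measure N B = measure \<mu> (?A \<inter> B) / pnode (c v)" if "B \<in> sets \<mu>" for B
      unfolding N_def using nz that mA by simp
    have spN: "space N = space \<mu>" "sets N = sets \<mu>" by (simp_all add: N_def)
    let ?W' = "insert (a # v) W"
    define K where "K = component ?V tree_E v"
    have "{\<phi> \<in> space \<mu>. \<phi> v = c v} = ?A" by (auto simp: cyl_def)
    then have indep: "N.indep_vars (\<lambda>C. PiM C (\<lambda>_. count_space {1..q})) (\<lambda>C \<phi>. restrict \<phi> C)
        (K ` (?V - {v}))"
      using simple[unfolded is_simple_def components_without_eq, rule_format, OF vV cv] False mA
      unfolding N_def K_def by simp
    \<comment> \<open>Independence, applied to the events that prescribe \<open>c\<close> on the
      part of each component inside \<open>?W'\<close>. The empty family is separate because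
      \<open>indep_varsD\<close> requires a nonempty one.\<close>
    have prodN: "measure N (cyl \<mu> (\<Union>C\<in>J. C \<inter> ?W') c) = (\<Prod>C\<in>J. measure N (cyl \<mu> (C \<inter> ?W') c))"
      if J: "finite J" "J \<subseteq> K ` (?V - {v})" for J
    proof (cases "J = {}")
      case True
      then show ?thesis using N.prob_space by (simp add: cyl_def spN)
    next
      case False
      define B where "B C = prod_emb C (\<lambda>_. count_space {1..q}) (C \<inter> ?W') (PiE (C \<inter> ?W') (\<lambda>x. {c x} \<inter> {1..q}))"
        for C
      have CV: "C \<subseteq> ?V" if "C \<in> J" for C using that J unfolding K_def component_def by auto
      have B: "B C \<in> sets (PiM C (\<lambda>_. count_space {1..q}))" for C
        unfolding B_def using fW by (intro sets_PiM_I) auto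
      have pre: "(\<lambda>\<phi>. restrict \<phi> C) -` B C \<inter> space N = cyl \<mu> (C \<inter> ?W') c" if "C \<in> J" for C
      proof -
        have "restrict \<phi> C \<in> B C \<longleftrightarrow> (\<forall>x\<in>C \<inter> ?W'. \<phi> x = c x)" if \<phi>: "\<phi> \<in> space \<mu>" for \<phi>
        proof -
          have \<phi>q: "\<phi> x \<in> {1..q}" if "x \<in> C" for x
            using coord_in[OF \<phi>] that CV[OF \<open>C \<in> J\<close>] by blast
          then have "restrict \<phi> C \<in> B C \<longleftrightarrow> (\<forall>x\<in>C \<inter> ?W'. \<phi> x \<in> {c x} \<inter> {1..q})"
            unfolding B_def prod_emb_def by (simp add: PiE_iff)
          also have "\<dots> \<longleftrightarrow> (\<forall>x\<in>C \<inter> ?W'. \<phi> x = c x)" using \<phi>q by blast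
          finally show ?thesis .
        qed
        then show ?thesis unfolding cyl_def spN by blast
      qed
      have "measure N (\<Inter>C\<in>J. (\<lambda>\<phi>. restrict \<phi> C) -` B C \<inter> space N)
          = (\<Prod>C\<in>J. measure N ((\<lambda>\<phi>. restrict \<phi> C) -` B C \<inter> space N))"
        using J False B by (intro N.indep_varsD[OF indep]) auto
      moreover have "(\<Inter>C\<in>J. (\<lambda>\<phi>. restrict \<phi> C) -` B C \<inter> space N) = cyl \<mu> (\<Union>C\<in>J. C \<inter> ?W') c"
        using pre False by (auto simp: cyl_def)
      moreover have "(\<Prod>C\<in>J. measure N ((\<lambda>\<phi>. restrict \<phi> C) -` B C \<inter> space N))
          = (\<Prod>C\<in>J. measure N (cyl \<mu> (C \<inter> ?W') c))"
        using pre by (intro prod.cong) auto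
      ultimately show ?thesis by simp
    qed
    define J where "J = K ` (W - {v})"
    have KC: "x \<in> K x" if "x \<in> ?V - {v}" for x
      unfolding K_def using that by (rule component_refl)
    have av': "a # v \<in> ?V - {v}" using av by auto
    have KW: "K (a # v) \<inter> W = {}"
    proof (intro equals0I)
      fix x assume x: "x \<in> K (a # v) \<inter> W"
      then have "suffix (a # v) x"
        unfolding K_def component_def using component_suffix[OF av(1)] by blast
      then show False using subtree_suffix[OF W(1), of x "a # v"] x av by auto
    qed
    have notin: "K (a # v) \<notin> J"
    proof
      assume "K (a # v) \<in> J"
      then obtain x where x: "x \<in> W - {v}" "K (a # v) = K x" unfolding J_def by blast
      then have "x \<in> K (a # v)" using KC[of x] fW by auto
      then show False using x KW by auto
    qed
    have J: "finite J" "J \<subseteq> K ` (?V - {v})" using fW unfolding J_def by auto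
    have Ksub: "C \<subseteq> ?V - {v}" if "C \<in> K ` (?V - {v})" for C
      using that unfolding K_def component_def by auto
    have KK: "K (a # v) \<inter> ?W' = {a # v}" using KW KC[OF av'] by auto
    have JW: "(\<Union>C\<in>J. C \<inter> ?W') = W - {v}"
    proof (intro equalityI subsetI)
      fix x assume "x \<in> W - {v}"
      then show "x \<in> (\<Union>C\<in>J. C \<inter> ?W')" unfolding J_def using KC[of x] fW by auto
    next
      fix x assume "x \<in> (\<Union>C\<in>J. C \<inter> ?W')"
      then obtain C where C: "C \<in> J" "x \<in> C" "x \<in> ?W'" by blast
      have "x \<noteq> a # v"
      proof
        assume "x = a # v"
        moreover obtain y where "C = K y" using C unfolding J_def by blast
        ultimately have "K (a # v) = C"
          unfolding K_def using C component_eq[of tree_E "a # v" ?V v y] by (simp add: tree_E_sym)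
        then show False using C notin by simp
      qed
      moreover have "x \<noteq> v" using C(1,2) J(2) Ksub by blast
      ultimately show "x \<in> W - {v}" using C(3) by blast
    qed
    have "measure N (cyl \<mu> (\<Union>C\<in>insert (K (a # v)) J. C \<inter> ?W') c)
        = measure N (cyl \<mu> (K (a # v) \<inter> ?W') c) * (\<Prod>C\<in>J. measure N (cyl \<mu> (C \<inter> ?W') c))"
      using J notin av' by (subst prodN) auto
    also have "(\<Prod>C\<in>J. measure N (cyl \<mu> (C \<inter> ?W') c)) = measure N (cyl \<mu> (W - {v}) c)"
      using prodN[OF J] JW by simp
    also have "(\<Union>C\<in>insert (K (a # v)) J. C \<inter> ?W') = {a # v} \<union> (W - {v})"
      unfolding UN_insert JW KK ..
    finally have "measure N (cyl \<mu> ({a # v} \<union> (W - {v})) c)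
        = measure N (cyl \<mu> {a # v} c) * measure N (cyl \<mu> (W - {v}) c)"
      unfolding KK .
    moreover have "?A \<inter> cyl \<mu> ({a # v} \<union> (W - {v})) c = cyl \<mu> (insert (a # v) W) c"
      "?A \<inter> cyl \<mu> {a # v} c = cyl \<mu> {v, a # v} c" "?A \<inter> cyl \<mu> (W - {v}) c = cyl \<mu> W c"
      using W(2) by (auto simp: cyl_def)
    moreover have "cyl \<mu> ({a # v} \<union> (W - {v})) c \<in> sets \<mu>" "cyl \<mu> {a # v} c \<in> sets \<mu>"
      "cyl \<mu> (W - {v}) c \<in> sets \<mu>"
      using fW av by (auto intro!: cyl_sets)
    ultimately have "measure \<mu> (cyl \<mu> (insert (a # v) W) c) / pnode (c v)
        = measure \<mu> (cyl \<mu> {v, a # v} c) / pnode (c v) * (measure \<mu> (cyl \<mu> W c) / pnode (c v))"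
      by (simp add: N)
    then show ?thesis using False measure_arc[OF av(1), of c] by (simp add: field_simps)
  qed
qed

lemma zero_one_sets: "cyl \<mu> {[]} c \<in> sets \<mu>" "cyl \<mu> {[], [0]} c \<in> sets \<mu>"
  using zero_in_tree by (auto intro!: cyl_sets)

lemma pnode_nonneg: "0 \<le> pnode i" and pedge_nonneg: "0 \<le> pedge i j"
  by (simp_all add: pnode_def pedge_def)

lemma pnode_eq_sum: "pnode i = (\<Sum>j\<in>{1..q}. pedge i j)"
proof -
  let ?C = "\<lambda>j. cyl \<mu> {[], [0]} (\<lambda>x. if x = [] then i else j)"
  have "cyl \<mu> {[]} (\<lambda>_. i) = (\<Union>j\<in>{1..q}. ?C j)"
    using coord_in[OF _ zero_in_tree] by (fastforce simp: cyl_def)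
  moreover have "disjoint_family_on ?C {1..q}" by (auto simp: disjoint_family_on_def cyl_def)
  ultimately show ?thesis
    unfolding pnode_def pedge_def using zero_one_sets
    by (simp add: finite_measure_finite_Union image_subset_iff)
qed

lemma sum_pnode: "(\<Sum>i\<in>{1..q}. pnode i) = 1"
proof -
  let ?C = "\<lambda>i. cyl \<mu> {[]} (\<lambda>_. i)"
  have "space \<mu> = (\<Union>i\<in>{1..q}. ?C i)"
    using coord_in[OF _ Nil_in_tree] by (fastforce simp: cyl_def)
  moreover have "disjoint_family_on ?C {1..q}" by (auto simp: disjoint_family_on_def cyl_def)
  ultimately have "measure \<mu> (space \<mu>) = (\<Sum>i\<in>{1..q}. measure \<mu> (?C i))"
    using zero_one_sets by (simp add: finite_measure_finite_Union image_subset_iff)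
  then show ?thesis by (simp add: pnode_def prob_space)
qed

lemma pedge_imp_H: "pedge i j \<noteq> 0 \<Longrightarrow> H i j"
proof -
  assume "pedge i j \<noteq> 0"
  then have "cyl \<mu> {[], [0]} (\<lambda>x. if x = [] then i else j) \<noteq> {}"
    unfolding pedge_def by auto
  then obtain \<phi> where \<phi>: "\<phi> \<in> space \<mu>" "\<phi> [] = i" "\<phi> [0] = j" by (auto simp: cyl_def)
  have "tree_E [] [0]" by simp
  then show "H i j" using \<phi> zero_in_tree Nil_in_tree unfolding space_eq hom_set_def by blast
qed

lemma pedge_le_pnode: "pedge i j \<le> pnode i"
  unfolding pedge_def pnode_def using zero_one_sets
  by (intro finite_measure_mono) (auto simp: cyl_def)

definition star :: "nat \<Rightarrow> nat list set" where
  "star n = insert [] ((\<lambda>a. [a]) ` {..<n})"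

definition star_col :: "nat \<Rightarrow> nat \<Rightarrow> nat list \<Rightarrow> nat" where
  "star_col i j x = (if x = [] then i else j)"

lemma subtree_star: "n \<le> Suc r \<Longrightarrow> subtree r (star n)"
  by (auto simp: subtree_def star_def Cons_in_tree)

lemma star_Suc: "star (Suc n) = insert [n] (star n)"
  by (auto simp: star_def less_Suc_eq)

text \<open>The Markov property, used once per leaf. Stars with all leaves of one colour already
  determine the edge law.\<close>

lemma measure_star:
  assumes "n \<le> Suc r" "i \<in> {1..q}"
  shows "measure \<mu> (cyl \<mu> (star n) (star_col i j)) * pnode i ^ n = pnode i * pedge i j ^ n"
  using assms(1)
proof (induction n)
  case 0
  have "cyl \<mu> (star 0) (star_col i j) = cyl \<mu> {[]} (\<lambda>_. i)"
    by (simp add: star_def star_col_def cyl_def)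
  then show ?case by (simp add: pnode_def)
next
  case (Suc n)
  have "measure \<mu> (cyl \<mu> (insert (n # []) (star n)) (star_col i j)) * pnode (star_col i j [])
      = measure \<mu> (cyl \<mu> (star n) (star_col i j)) * pedge (star_col i j []) (star_col i j (n # []))"
    using Suc.prems assms(2)
    by (intro markov subtree_star) (auto simp: star_def star_col_def Cons_in_tree)
  then have "measure \<mu> (cyl \<mu> (star (Suc n)) (star_col i j)) * pnode i
      = measure \<mu> (cyl \<mu> (star n) (star_col i j)) * pedge i j"
    by (simp add: star_Suc star_col_def)
  then have "measure \<mu> (cyl \<mu> (star (Suc n)) (star_col i j)) * pnode i ^ Suc n
      = (measure \<mu> (cyl \<mu> (star n) (star_col i j)) * pnode i ^ n) * pedge i j"
    by (simp add: algebra_simps)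
  also have "\<dots> = pnode i * pedge i j ^ Suc n" using Suc by simp
  finally show ?case .
qed

lemma bdry_root: "bdry (tree_V r) tree_E {[]} = (\<lambda>a. [a]) ` {..r}"
  by (auto simp: bdry_def Cons_in_tree tree_E_def)

text \<open>With all neighbours of the root coloured \<open>j\<close>, the Gibbs property gives the
  root the colour \<open>i\<close> with probability proportional to \<open>lam i\<close> among the
  neighbours of \<open>j\<close>. The factor \<open>t\<close> collects the boundary probability and
  the normaliser, and is the same for all \<open>i\<close>.\<close>

lemma star_weight:
  assumes j: "j \<in> {1..q}"
  obtains t where "0 \<le> t"
    "\<And>i. H i j \<Longrightarrow> measure \<mu> (cyl \<mu> (star (Suc r)) (star_col i j)) = lam i * t"
proof -
  let ?P = "PiE {[]} (\<lambda>_. {1..q}) :: (nat list \<Rightarrow> nat) set"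
  define B where "B = bdry (tree_V r) tree_E {[]}"
  define \<gamma> where "\<gamma> i = restrict (\<lambda>_. i) {[] :: nat list}" for i :: nat
  define F where "F c = fillw tree_E H lam {[]} ({[]} \<union> B) (comb {[]} c (\<lambda>_. j))" for c
  define S where "S = (\<Sum>c\<in>?P. F c)"
  have star: "star (Suc r) = {[]} \<union> B" by (auto simp: star_def B_def bdry_root)
  have \<gamma>P: "\<gamma> i \<in> ?P" if "i \<in> {1..q}" for i using that by (auto simp: \<gamma>_def)
  have comb: "comb {[]} (\<gamma> i) (\<lambda>_. j) = star_col i j" for i
    by (auto simp: comb_def star_col_def \<gamma>_def fun_eq_iff)
  have F\<gamma>: "F (\<gamma> i) = lam i" if "H i j" for i
  proof -
    have "compat tree_E H ({[]} \<union> B) (star_col i j)"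
      using that H_sym[OF that] unfolding compat_def B_def bdry_root
      by (auto simp: star_col_def tree_E_def)
    then show ?thesis unfolding F_def comb fillw_def by (simp add: star_col_def)
  qed
  have finP: "finite ?P" by (intro finite_PiE) auto
  have Fnn: "0 \<le> F c" if "c \<in> ?P" for c
    unfolding F_def using that lam by (intro fillw_nonneg) (auto simp: PiE_def)
  obtain k where k: "H j k" using ex_neighbour[OF j] by blast
  have "F (\<gamma> k) \<le> S"
    unfolding S_def using finP Fnn \<gamma>P H_in(2)[OF k] by (intro member_le_sum) auto
  then have S: "0 < S"
    using F\<gamma>[OF H_sym[OF k]] lam H_in(2)[OF k] by fastforce
  define t where "t = measure \<mu> (cyl \<mu> B (\<lambda>_. j)) / S"
  show thesis
  proof (rule that[of t])
    show "0 \<le> t" using S by (simp add: t_def)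
    fix i assume i: "H i j"
    have "measure \<mu> (cyl \<mu> ({[]} \<union> B) (comb {[]} (\<gamma> i) (\<lambda>_. j))) * S
        = F (\<gamma> i) * measure \<mu> (cyl \<mu> B (\<lambda>_. j))"
      unfolding S_def F_def B_def using i j \<gamma>P H_in(1)[OF i]
      by (intro gibbs_cylinder gibbs lam tree_bdry_finite) auto
    then show "measure \<mu> (cyl \<mu> (star (Suc r)) (star_col i j)) = lam i * t"
      unfolding star[symmetric] comb F\<gamma>[OF i] t_def using S by (simp add: field_simps)
  qed
qed

text \<open>Comparing the star formula with the Gibbs property gives
  \<open>p(i, j)\<^sup>r\<^sup>+\<^sup>1 = \<lambda>\<^sub>i \<pi>(i)\<^sup>r t\<^sub>j\<close> on edges, so that \<open>p(i, j) = g\<^sub>i h\<^sub>j\<close>; as \<open>p\<close> is symmetric and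
  \<open>H\<close> is connected, \<open>g\<close> is a multiple of \<open>h\<close>.\<close>

lemma pedge_weight:
  obtains h \<kappa> where "0 < \<kappa>" "is_weight r lam h"
    "\<And>i j. pedge i j = (if H i j then \<kappa> * h i * h j else 0)"
proof -
  define m where "m i j = measure \<mu> (cyl \<mu> (star (Suc r)) (star_col i j))" for i j
  have "\<forall>j\<in>{1..q}. \<exists>t\<ge>0. \<forall>i. H i j \<longrightarrow> m i j = lam i * t"
    using star_weight unfolding m_def by metis
  then obtain t where t: "\<And>j. j \<in> {1..q} \<Longrightarrow> 0 \<le> t j"
    "\<And>i j. j \<in> {1..q} \<Longrightarrow> H i j \<Longrightarrow> m i j = lam i * t j"
    by metis
  \<comment> \<open>One factor \<open>pnode i\<close> of the star formula is cancelled; where it is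
    0, both sides vanish.\<close>
  have m: "m i j * pnode i ^ r = pedge i j ^ Suc r" if "i \<in> {1..q}" for i j
  proof (cases "pnode i = 0")
    case True
    then have "pedge i j = 0" using pedge_le_pnode[of i j] pedge_nonneg[of i j] by simp
    moreover have "m i j \<le> pnode i"
      unfolding m_def pnode_def using zero_one_sets
      by (intro finite_measure_mono) (auto simp: cyl_def star_def star_col_def)
    then have "m i j = 0" using True by (simp add: m_def measure_le_0_iff)
    ultimately show ?thesis by simp
  next
    case False
    have "m i j * pnode i ^ Suc r = pnode i * pedge i j ^ Suc r"
      unfolding m_def using that by (intro measure_star) auto
    then show ?thesis using False by simp
  qed
  have lampos: "0 < lam i" if "i \<in> {1..q}" for i using lam that by blast
  have t_pos: "0 < t j" if "pedge i j \<noteq> 0" for i j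
  proof -
    have ij: "H i j" "i \<in> {1..q}" "j \<in> {1..q}" using pedge_imp_H[OF that] H_in by blast+
    have "m i j \<noteq> 0" using m[OF ij(2), of j] that by auto
    then show ?thesis using t[OF ij(3)] ij(1) by fastforce
  qed
  \<comment> \<open>With \<open>pedge_sym\<close>, positivity of \<open>t\<close> passes from a node
    to its neighbours, hence through the connected graph.\<close>
  have spread: "pedge k j \<noteq> 0" if "0 < t j" "H k j" for j k
  proof -
    have kj: "k \<in> {1..q}" "j \<in> {1..q}" using H_in[OF that(2)] by auto
    have "0 < m k j" using t(2)[OF kj(2) that(2)] lampos[OF kj(1)] that(1) by simp
    moreover have "m k j \<le> pnode k"
      unfolding m_def pnode_def using zero_one_sets
      by (intro finite_measure_mono) (auto simp: cyl_def star_def star_col_def)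
    ultimately have "0 < m k j * pnode k ^ r" by simp
    then show ?thesis using m[OF kj(1), of j] by auto
  qed
  obtain k0 i0 where "pedge k0 i0 \<noteq> 0"
    using sum_pnode unfolding pnode_eq_sum by (metis sum.neutral zero_neq_one)
  then have i0: "0 < t i0" and i0q: "i0 \<in> {1..q}"
    using t_pos H_in(2)[OF pedge_imp_H] by blast+
  have tpos: "0 < t i" if "i \<in> {1..q}" for i
  proof -
    have "H\<^sup>*\<^sup>* i0 i" using connected i0q that by (auto simp: cg_connected_def)
    then show ?thesis
    proof (induction rule: rtranclp_induct)
      case (step y z)
      then have "pedge z y \<noteq> 0" using spread[of y z] H_sym by blast
      then have "pedge y z \<noteq> 0" by (simp add: pedge_sym)
      then show ?case by (rule t_pos)
    qed (rule i0)
  qed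
  have p_pos: "0 < pedge i j" if "H i j" for i j
    using spread[OF tpos that] H_in(2)[OF that] pedge_nonneg[of i j] by simp
  \<comment> \<open>By \<open>m\<close> and the formula for the star, \<open>pedge i j\<close> to
    the power \<open>r + 1\<close> is a product of a factor in \<open>i\<close> and a factor in
    \<open>j\<close>; taking roots separates them.\<close>
  define g where "g i = root (Suc r) (lam i * pnode i ^ r)" for i
  define h where "h j = root (Suc r) (t j)" for j
  have p_eq: "pedge i j = g i * h j" if "H i j" for i j
  proof -
    have ij: "i \<in> {1..q}" "j \<in> {1..q}" using H_in[OF that] by auto
    have "pedge i j = root (Suc r) (pedge i j ^ Suc r)"
      using pedge_nonneg by (intro real_root_power_cancel[symmetric]) auto
    also have "pedge i j ^ Suc r = (lam i * pnode i ^ r) * t j"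
      using m[OF ij(1), of j] t(2)[OF ij(2) that] by (simp add: algebra_simps)
    finally show ?thesis unfolding g_def h_def real_root_mult .
  qed
  have hpos: "0 < h i" if "i \<in> {1..q}" for i unfolding h_def using tpos[OF that] by simp
  have ratio: "g j / h j = g i / h i" if "H i j" for i j
  proof -
    have "g i * h j = g j * h i" using p_eq[OF that] p_eq[OF H_sym[OF that]] pedge_sym by metis
    moreover have "h i \<noteq> 0" "h j \<noteq> 0" using hpos[OF H_in(1)[OF that]] hpos[OF H_in(2)[OF that]] by auto
    ultimately show ?thesis by (simp add: field_simps)
  qed
  define \<kappa> where "\<kappa> = g i0 / h i0"
  have gh: "g i = \<kappa> * h i" if "i \<in> {1..q}" for i
  proof -
    have "H\<^sup>*\<^sup>* i0 i" using connected i0q that by (auto simp: cg_connected_def)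
    then have "g i / h i = \<kappa>"
      by (induction rule: rtranclp_induct) (use ratio in \<open>auto simp: \<kappa>_def\<close>)
    then show ?thesis using hpos[OF that] by (auto simp: field_simps)
  qed
  have p: "pedge i j = (if H i j then \<kappa> * h i * h j else 0)" for i j
    using p_eq[of i j] gh H_in(1)[of i j] pedge_imp_H[of i j] by auto
  obtain j where j: "H i0 j" using ex_neighbour[OF i0q] by blast
  have \<kappa>: "0 < \<kappa>"
  proof -
    have "0 < \<kappa> * (h i0 * h j)" using p_pos[OF j] p[of i0 j] j by (simp add: mult.assoc)
    moreover have "0 < h i0 * h j" using hpos i0q H_in(2)[OF j] by simp
    ultimately show ?thesis by (simp add: zero_less_mult_iff)
  qed
  have pn: "pnode i = \<kappa> * h i * nsum h i" for i
  proof -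
    have "pnode i = (\<Sum>j\<in>{1..q}. if H i j then \<kappa> * h i * h j else 0)"
      unfolding pnode_eq_sum p ..
    also have "\<dots> = (\<Sum>j\<in>nbs i. \<kappa> * h i * h j)"
      using nbs_subset by (intro sum.mono_neutral_cong_right) auto
    finally show ?thesis by (simp add: nsum_def sum_distrib_left)
  qed
  \<comment> \<open>Inserting \<open>pn\<close> into the definition of \<open>g\<close> and
    cancelling \<open>(\<kappa> * h i) ^ r\<close> leaves the weight equation.\<close>
  have "\<kappa> * h i = lam i * nsum h i ^ r" if i: "i \<in> {1..q}" for i
  proof -
    have "g i ^ Suc r = lam i * pnode i ^ r"
      unfolding g_def using lampos[OF i] pnode_nonneg
      by (intro real_root_pow_pos2) auto
    then have "\<kappa> * h i * (\<kappa> * h i) ^ r = lam i * nsum h i ^ r * (\<kappa> * h i) ^ r"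
      unfolding gh[OF i] pn by (simp add: power_mult_distrib algebra_simps)
    moreover have "(\<kappa> * h i) ^ r \<noteq> 0" using \<kappa> hpos[OF i] by simp
    ultimately show ?thesis by (simp only: mult_cancel_right) simp
  qed
  then have "is_weight r lam h" unfolding is_weight_def using hpos \<kappa> by blast
  then show thesis using p by (intro that[OF \<kappa>])
qed

text \<open>Uniqueness of the weights leaves a single scalar free in the edge law, and total mass 1
  fixes it.\<close>

lemma pedge_formula:
  assumes uniq: "\<And>v. is_weight r lam v \<Longrightarrow> \<exists>t>0. \<forall>i\<in>{1..q}. v i = t * w i"
  shows "pedge i j = (if H i j then w i * w j else 0)
    / (\<Sum>i\<in>{1..q}. \<Sum>j\<in>{1..q}. if H i j then w i * w j else 0)"
proof -
  obtain \<kappa> h where h: "0 < \<kappa>" "is_weight r lam h"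
    and p: "\<And>i j. pedge i j = (if H i j then \<kappa> * h i * h j else 0)"
    by (rule pedge_weight) (rule that)
  obtain t where t: "0 < t" "\<forall>i\<in>{1..q}. h i = t * w i" using uniq[OF h(2)] by blast
  let ?f = "\<lambda>i j. if H i j then w i * w j else 0"
  have p': "pedge i j = \<kappa> * t\<^sup>2 * ?f i j" for i j
    unfolding p using t(2) H_in[of i j] by (auto simp: power2_eq_square)
  define Z where "Z = (\<Sum>i\<in>{1..q}. \<Sum>j\<in>{1..q}. ?f i j)"
  have "1 = (\<Sum>i\<in>{1..q}. \<Sum>j\<in>{1..q}. \<kappa> * t\<^sup>2 * ?f i j)"
    using sum_pnode unfolding pnode_eq_sum p' by simp
  also have "\<dots> = \<kappa> * t\<^sup>2 * Z"
    unfolding Z_def sum_distrib_left ..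
  finally have *: "1 = \<kappa> * t\<^sup>2 * Z" .
  then have "Z \<noteq> 0" by auto
  then have "\<kappa> * t\<^sup>2 = 1 / Z" using * by (simp add: eq_divide_eq)
  then show ?thesis unfolding p' Z_def[symmetric] by simp
qed

lemma pnode_pos: "i \<in> {1..q} \<Longrightarrow> 0 < pnode i"
proof -
  assume i: "i \<in> {1..q}"
  obtain \<kappa> h where h: "0 < \<kappa>" "is_weight r lam h"
    and p: "\<And>i j. pedge i j = (if H i j then \<kappa> * h i * h j else 0)"
    by (rule pedge_weight) (rule that)
  obtain j where j: "H i j" using ex_neighbour[OF i] by blast
  have "0 < pedge i j"
    using p[of i j] j h i H_in(2)[OF j] by (simp add: is_weight_def)
  then show ?thesis using pedge_le_pnode[of i j] by linarith
qed

end

text \<open>Both edge laws are given by the same formula in \<open>w\<close>, and the node laws are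
  their marginals. Since the node probabilities are positive, \<open>markov\<close> transports the
  equality leaf by leaf to all finite subtrees.\<close>

lemma simple_invariant_gibbs_unique:
  assumes \<mu>: "simple_invariant_gibbs q H r lam \<mu>" and \<nu>: "simple_invariant_gibbs q H r lam \<nu>"
    and uniq: "\<And>v. cgraph.is_weight q H r lam v \<Longrightarrow> \<exists>t>0. \<forall>i\<in>{1..q}. v i = t * w i"
  shows "\<mu> = \<nu>"
proof -
  interpret \<mu>: simple_invariant_gibbs q H r lam \<mu> by fact
  interpret \<nu>: simple_invariant_gibbs q H r lam \<nu> by fact
  have pe: "\<mu>.pedge i j = \<nu>.pedge i j" for i j
  proof -
    let ?Z = "\<Sum>i\<in>{1..q}. \<Sum>j\<in>{1..q}. if H i j then w i * w j else 0"
    have "\<mu>.pedge i j = (if H i j then w i * w j else 0) / ?Z"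
      by (rule \<mu>.pedge_formula) (rule uniq)
    moreover have "\<nu>.pedge i j = (if H i j then w i * w j else 0) / ?Z"
      by (rule \<nu>.pedge_formula) (rule uniq)
    ultimately show ?thesis by simp
  qed
  then have pn: "\<mu>.pnode i = \<nu>.pnode i" for i
    unfolding \<mu>.pnode_eq_sum \<nu>.pnode_eq_sum by simp
  have eq: "measure \<mu> (cyl \<mu> W c) = measure \<nu> (cyl \<nu> W c)"
    if "subtree r W" "\<forall>v\<in>W. c v \<in> {1..q}" for W c
    using that
  proof (induction rule: subtree_induct)
    case Nil
    then show ?case
      using \<mu>.measure_vertex[OF Nil_in_tree, of c] \<nu>.measure_vertex[OF Nil_in_tree, of c] pn by simp
  next
    case (insert W a v)
    then have cv: "c v \<in> {1..q}" and eqW: "measure \<mu> (cyl \<mu> W c) = measure \<nu> (cyl \<nu> W c)" by auto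
    show ?case
      using \<mu>.markov[OF insert(1-4), of c] \<nu>.markov[OF insert(1-4), of c] cv eqW pe pn
        \<mu>.pnode_pos[OF cv] by (metis less_irrefl mult_right_cancel)
  qed
  show ?thesis
  proof (rule hom_measure_eqI[OF \<mu>.hom_measure_axioms \<nu>.hom_measure_axioms])
    fix J assume J: "finite J" "J \<subseteq> tree_V r"
    note W = subtree_suffix_hull[OF J]
    show "\<exists>W. finite W \<and> J \<subseteq> W \<and> W \<subseteq> tree_V r \<and>
        (\<forall>c\<in>PiE W (\<lambda>_. {1..q}). measure \<mu> (cyl \<mu> W c) = measure \<nu> (cyl \<nu> W c))"
      using subtreeD(1,2)[OF W] suffix_hull_superset eq[OF W]
      by (intro exI[of _ "suffix_hull J"]) (auto simp: PiE_def Pi_def)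
  qed
qed

section \<open>Existence\<close>

lemma sum_prod_partition:
  fixes f :: "'c \<Rightarrow> ('a \<Rightarrow> 'b) \<Rightarrow> real"
  assumes "finite I" "disjoint_family_on P I"
  shows "(\<Sum>c\<in>PiE (\<Union>i\<in>I. P i) Y. \<Prod>i\<in>I. f i (restrict c (P i))) = (\<Prod>i\<in>I. \<Sum>c\<in>PiE (P i) Y. f i c)"
  using assms
proof (induction I rule: finite_induct)
  case (insert j I)
  have disj: "P j \<inter> (\<Union>i\<in>I. P i) = {}"
    using insert.prems insert.hyps(2) by (auto simp: disjoint_family_on_def)
  have r1: "restrict (comb (P j) c d) (P j) = c" if "c \<in> PiE (P j) Y" for c d
    using that by (auto simp: comb_def fun_eq_iff PiE_def extensional_def)
  have r2: "restrict (comb (P j) c d) (P i) = restrict d (P i)" if "i \<in> I" for c d i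
    using that disj by (auto simp: comb_def fun_eq_iff)
  have "(\<Sum>c\<in>PiE (\<Union>i\<in>insert j I. P i) Y. \<Prod>i\<in>insert j I. f i (restrict c (P i)))
      = (\<Sum>c\<in>PiE (P j) Y. \<Sum>d\<in>PiE (\<Union>i\<in>I. P i) Y. \<Prod>i\<in>insert j I. f i (restrict (comb (P j) c d) (P i)))"
    unfolding UN_insert by (rule sum_cylinder_split[OF disj])
  also have "\<dots> = (\<Sum>c\<in>PiE (P j) Y. \<Sum>d\<in>PiE (\<Union>i\<in>I. P i) Y. f j c * (\<Prod>i\<in>I. f i (restrict d (P i))))"
  proof (intro sum.cong refl)
    fix c d assume "c \<in> PiE (P j) Y" "d \<in> PiE (\<Union>i\<in>I. P i) Y"
    moreover have "(\<Prod>i\<in>I. f i (restrict (comb (P j) c d) (P i))) = (\<Prod>i\<in>I. f i (restrict d (P i)))"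
      by (intro prod.cong refl) (simp add: r2)
    ultimately show "(\<Prod>i\<in>insert j I. f i (restrict (comb (P j) c d) (P i)))
        = f j c * (\<Prod>i\<in>I. f i (restrict d (P i)))"
      using insert.hyps r1 by simp
  qed
  also have "\<dots> = (\<Sum>c\<in>PiE (P j) Y. f j c) * (\<Sum>d\<in>PiE (\<Union>i\<in>I. P i) Y. \<Prod>i\<in>I. f i (restrict d (P i)))"
    by (simp add: sum_product)
  also have "\<dots> = (\<Prod>i\<in>insert j I. \<Sum>c\<in>PiE (P i) Y. f i c)"
  proof -
    have "(\<Sum>d\<in>PiE (\<Union>i\<in>I. P i) Y. \<Prod>i\<in>I. f i (restrict d (P i))) = (\<Prod>i\<in>I. \<Sum>c\<in>PiE (P i) Y. f i c)"
      using insert.prems by (intro insert.IH) (auto simp: disjoint_family_on_def)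
    then show ?thesis by (simp only: prod.insert[OF insert.hyps])
  qed
  finally show ?case .
qed simp

section \<open>A factorisation criterion for simplicity\<close>

context hom_measure
begin

lemma Int_stable_rect: "Int_stable {rect \<mu> D X | D X. finite D \<and> D \<subseteq> C}"
proof (rule Int_stableI)
  fix A B assume "A \<in> {rect \<mu> D X | D X. finite D \<and> D \<subseteq> C}" "B \<in> {rect \<mu> D X | D X. finite D \<and> D \<subseteq> C}"
  then obtain D X D' X' where A: "A = rect \<mu> D X" "finite D" "D \<subseteq> C"
    and B: "B = rect \<mu> D' X'" "finite D'" "D' \<subseteq> C" by blast
  have "A \<inter> B = rect \<mu> (D \<union> D') (\<lambda>v. (if v \<in> D then X v else UNIV) \<inter> (if v \<in> D' then X' v else UNIV))"
    unfolding A B rect_def by auto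
  then show "A \<inter> B \<in> {rect \<mu> D X | D X. finite D \<and> D \<subseteq> C}" using A B by blast
qed

lemma restrict_vimage_sigma_rect:
  assumes "C \<subseteq> V" "B \<in> sets (PiM C (\<lambda>_. count_space {1..q}))"
  shows "(\<lambda>\<phi>. restrict \<phi> C) -` B \<inter> space \<mu> \<in> sigma_sets (space \<mu>) {rect \<mu> D X | D X. finite D \<and> D \<subseteq> C}"
proof -
  let ?G = "{rect \<mu> D X | D X. finite D \<and> D \<subseteq> C}"
  let ?S = "sigma (space \<mu>) ?G"
  have G: "?G \<subseteq> Pow (space \<mu>)" by (auto simp: rect_def)
  have spS: "space ?S = space \<mu>" using G by (rule space_measure_of)
  have "(\<lambda>\<phi>. restrict \<phi> C) \<in> measurable ?S (PiM C (\<lambda>_. count_space {1..q}))"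
  proof (rule measurable_restrict)
    fix v assume v: "v \<in> C"
    have "(\<lambda>\<phi>. \<phi> v) -` {j} \<inter> space ?S \<in> sets ?S" for j
    proof -
      have "(\<lambda>\<phi>. \<phi> v) -` {j} \<inter> space ?S = rect \<mu> {v} (\<lambda>_. {j})"
        unfolding spS by (auto simp: rect_def)
      moreover have "rect \<mu> {v} (\<lambda>_. {j}) \<in> ?G" using v by blast
      ultimately show ?thesis using G by (simp add: sigma_sets.Basic)
    qed
    moreover have "(\<lambda>\<phi>. \<phi> v) \<in> space ?S \<rightarrow> {1..q}"
      unfolding spS using coord_in[of _ v] v assms(1) by auto
    ultimately show "(\<lambda>\<phi>. \<phi> v) \<in> measurable ?S (count_space {1..q})"
      by (subst measurable_count_space_eq2) auto
  qed
  from measurable_sets[OF this assms(2)] show ?thesis using G by simp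
qed

text \<open>The finite family \<open>K\<close> of components may be larger than needed to cover \<open>B\<close>; this avoids a
  case distinction on components not meeting \<open>B\<close>.\<close>

lemma simpleI:
  assumes sym: "\<And>x y. E x y \<Longrightarrow> E y x"
    and factor: "\<And>u i J. u \<in> V \<Longrightarrow> i \<in> {1..q} \<Longrightarrow> finite J \<Longrightarrow> J \<subseteq> V \<Longrightarrow> \<exists>B \<kappa> f. finite B \<and> insert u J \<subseteq> B \<and> B \<subseteq> V \<and>
        (\<forall>K. finite K \<longrightarrow> K \<subseteq> components_without V E u \<longrightarrow> B - {u} \<subseteq> \<Union>K \<longrightarrow>
          (\<forall>c\<in>PiE B (\<lambda>_. {1..q}). c u = i \<longrightarrow>
            measure \<mu> (cyl \<mu> B c) = \<kappa> * (\<Prod>C\<in>K. f C (restrict c (C \<inter> B)))))"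
  shows "is_simple V E q H \<mu>"
  unfolding is_simple_def
proof (intro ballI impI)
  fix u i assume u: "u \<in> V" and i: "i \<in> {1..q}" and nz: "measure \<mu> {\<phi> \<in> space \<mu>. \<phi> u = i} \<noteq> 0"
  let ?A = "{\<phi> \<in> space \<mu>. \<phi> u = i}" and ?Cs = "components_without V E u"
  define N where "N = uniform_measure \<mu> ?A"
  have A_rect: "?A = rect \<mu> {u} (\<lambda>_. {i})" by (auto simp: rect_def)
  have A: "?A \<in> sets \<mu>" unfolding A_rect using u by (intro rect_sets) auto
  have ne: "emeasure \<mu> ?A \<noteq> 0" "emeasure \<mu> ?A \<noteq> \<infinity>"
    using nz measure_nonneg[of \<mu> ?A] by (auto simp: emeasure_eq_measure)
  interpret N: prob_space N unfolding N_def using ne by (rule prob_space_uniform_measure)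
  have spN: "space N = space \<mu>" "sets N = sets \<mu>" by (simp_all add: N_def)
  have N: "measure N B = measure \<mu> (?A \<inter> B) / measure \<mu> ?A" if "B \<in> sets \<mu>" for B
    unfolding N_def using ne that by simp
  define G where "G C = {rect \<mu> D X | D X. finite D \<and> D \<subseteq> C}" for C
  have CV: "C \<subseteq> V - {u}" if "C \<in> ?Cs" for C using component_subset[OF that] .
  have "N.indep_sets G ?Cs"
  proof (rule N.indep_setsI)
    fix C assume C: "C \<in> ?Cs"
    show "G C \<subseteq> N.events" unfolding G_def spN using CV[OF C] by (auto intro!: rect_sets)
  next
    fix A' J assume J: "J \<noteq> {}" "J \<subseteq> ?Cs" "finite J" "\<forall>C\<in>J. A' C \<in> G C"
    then have "\<forall>C\<in>J. \<exists>D X. A' C = rect \<mu> D X \<and> finite D \<and> D \<subseteq> C" unfolding G_def by blast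
    then obtain D X where DX: "\<And>C. C \<in> J \<Longrightarrow> A' C = rect \<mu> (D C) (X C)"
      "\<And>C. C \<in> J \<Longrightarrow> finite (D C)" "\<And>C. C \<in> J \<Longrightarrow> D C \<subseteq> C" by metis
    let ?J = "\<Union>C\<in>J. D C"
    have J': "finite ?J" "?J \<subseteq> V" using J DX CV by blast+
    obtain B \<kappa> f where *: "finite B \<and> insert u ?J \<subseteq> B \<and> B \<subseteq> V \<and>
        (\<forall>K'. finite K' \<longrightarrow> K' \<subseteq> ?Cs \<longrightarrow> B - {u} \<subseteq> \<Union>K' \<longrightarrow>
          (\<forall>c\<in>PiE B (\<lambda>_. {1..q}). c u = i \<longrightarrow>
            measure \<mu> (cyl \<mu> B c) = \<kappa> * (\<Prod>C\<in>K'. f C (restrict c (C \<inter> B)))))"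
      using factor[OF u i J'] by (elim exE)
    then have B: "finite B" "u \<in> B" "?J \<subseteq> B" "B \<subseteq> V" by auto
    define K where "K = component V E u ` (B - {u}) \<union> J"
    have K: "finite K" "K \<subseteq> ?Cs"
      unfolding K_def using B J by (auto simp: components_without_eq)
    have cover: "B - {u} = (\<Union>C\<in>K. C \<inter> B)"
    proof (intro equalityI subsetI)
      fix x assume "x \<in> B - {u}"
      then have "x \<in> component V E u x" "component V E u x \<in> K"
        using B component_refl[of x V u E] by (auto simp: K_def)
      then show "x \<in> (\<Union>C\<in>K. C \<inter> B)" using \<open>x \<in> B - {u}\<close> by blast
    next
      fix x assume "x \<in> (\<Union>C\<in>K. C \<inter> B)"
      then show "x \<in> B - {u}" using CV K(2) by blast
    qed
    have disj: "disjoint_family_on (\<lambda>C. C \<inter> B) K"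
      unfolding disjoint_family_on_def
    proof (intro ballI impI equals0I)
      fix C C' x assume "C \<in> K" "C' \<in> K" "C \<noteq> C'" "x \<in> C \<inter> B \<inter> (C' \<inter> B)"
      then show False using components_disjoint[of E C V u C' x] sym K(2) by blast
    qed
    have fac: "measure \<mu> (cyl \<mu> B c) = \<kappa> * (\<Prod>C\<in>K. f C (restrict c (C \<inter> B)))"
      if "c \<in> PiE B (\<lambda>_. {1..q})" "c u = i" for c
    proof -
      have "B - {u} \<subseteq> \<Union>K" using cover by blast
      then show ?thesis using * K that by blast
    qed
    define S where "S Y C = (\<Sum>c\<in>PiE (C \<inter> B) (\<lambda>v. Y v \<inter> {1..q}). f C c)" for Y C
    define \<kappa>' where "\<kappa>' = \<kappa> / measure \<mu> ?A"
    have rectN: "measure N (rect \<mu> (B - {u}) Y) = \<kappa>' * (\<Prod>C\<in>K. S Y C)" for Y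
    proof -
      let ?Y = "\<lambda>v. (if v = u then {i} else Y v) \<inter> {1..q}"
      have "?A \<inter> rect \<mu> (B - {u}) Y = rect \<mu> B (\<lambda>v. if v = u then {i} else Y v)"
        using B(2) by (auto simp: rect_def)
      then have "measure \<mu> (?A \<inter> rect \<mu> (B - {u}) Y) = (\<Sum>c\<in>PiE B ?Y. measure \<mu> (cyl \<mu> B c))"
        using measure_rect[OF B(1,4)] by simp
      also have "\<dots> = (\<Sum>c\<in>PiE B ?Y. \<kappa> * (\<Prod>C\<in>K. f C (restrict c (C \<inter> B))))"
      proof (intro sum.cong refl fac)
        fix c assume c: "c \<in> PiE B ?Y"
        then show "c \<in> PiE B (\<lambda>_. {1..q})" by (auto simp: PiE_def Pi_def)
        have "c u \<in> ?Y u" using c B(2) by (rule PiE_mem)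
        then show "c u = i" by simp
      qed
      also have "B = (B - {u}) \<union> {u}" using B(2) by blast
      also have "(\<Sum>c\<in>PiE ((B - {u}) \<union> {u}) ?Y. \<kappa> * (\<Prod>C\<in>K. f C (restrict c (C \<inter> ((B - {u}) \<union> {u})))))
          = (\<Sum>c\<in>PiE (B - {u}) ?Y. \<Sum>d\<in>PiE {u} ?Y.
              \<kappa> * (\<Prod>C\<in>K. f C (restrict (comb (B - {u}) c d) (C \<inter> ((B - {u}) \<union> {u})))))"
        by (intro sum_cylinder_split) auto
      also have "\<dots> = (\<Sum>c\<in>PiE (B - {u}) ?Y. \<Sum>d\<in>PiE {u} ?Y.
              \<kappa> * (\<Prod>C\<in>K. f C (restrict c (C \<inter> B))))"
      proof (intro sum.cong refl arg_cong2[where f = times] prod.cong)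
        fix c d :: "'a \<Rightarrow> nat" and C assume C: "C \<in> K"
        have "restrict (comb (B - {u}) c d) (C \<inter> ((B - {u}) \<union> {u})) = restrict c (C \<inter> B)"
          using CV[of C] C K(2) by (auto simp: comb_def fun_eq_iff)
        then show "f C (restrict (comb (B - {u}) c d) (C \<inter> ((B - {u}) \<union> {u}))) = f C (restrict c (C \<inter> B))"
          by simp
      qed
      also have "PiE {u} ?Y = PiE {u} (\<lambda>v. {restrict (\<lambda>_. i) {u} v})"
        using i by (intro PiE_cong) auto
      also have "\<dots> = {restrict (\<lambda>_. i) {u}}" by (rule PiE_singleton) (rule restrict_extensional)
      also have "PiE (B - {u}) ?Y = PiE (\<Union>C\<in>K. C \<inter> B) (\<lambda>v. Y v \<inter> {1..q})"
        unfolding cover[symmetric] by (intro PiE_cong) auto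
      also have "(\<Sum>c\<in>PiE (\<Union>C\<in>K. C \<inter> B) (\<lambda>v. Y v \<inter> {1..q}). \<Sum>d\<in>{restrict (\<lambda>_. i) {u}}.
          \<kappa> * (\<Prod>C\<in>K. f C (restrict c (C \<inter> B)))) = \<kappa> * (\<Prod>C\<in>K. S Y C)"
        unfolding S_def sum_prod_partition[OF K(1) disj, symmetric] sum_distrib_left
        by (simp del: UN_simps)
      finally show ?thesis
        using B by (subst N) (auto simp: \<kappa>'_def intro!: rect_sets)
    qed
    \<comment> \<open>Imposing no constraint at all expresses \<open>\<kappa>'\<close> through the
      sums \<open>S\<close>, so every probability becomes a product of ratios over the
      components.\<close>
    have one: "\<kappa>' * (\<Prod>C\<in>K. S (\<lambda>_. UNIV) C) = 1"
    proof -
      have "rect \<mu> (B - {u}) (\<lambda>_. UNIV) = space N" by (simp add: rect_def spN)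
      then show ?thesis using rectN[of "\<lambda>_. UNIV"] N.prob_space by simp
    qed
    have ratio: "measure N (rect \<mu> (B - {u}) Y) = (\<Prod>C\<in>K. S Y C / S (\<lambda>_. UNIV) C)" for Y
    proof -
      have "(\<Prod>C\<in>K. S (\<lambda>_. UNIV) C) \<noteq> 0" using one by auto
      then have "\<kappa>' = 1 / (\<Prod>C\<in>K. S (\<lambda>_. UNIV) C)" using one by (simp add: eq_divide_eq)
      then show ?thesis unfolding rectN by (simp add: prod_dividef)
    qed
    have SU: "S (\<lambda>_. UNIV) C \<noteq> 0" if "C \<in> K" for C
      using one K(1) that by (metis mult_eq_0_iff prod_zero zero_neq_one)
    \<comment> \<open>The constraints of the events indexed by \<open>J'\<close>, gathered into one
      rectangle. A site belongs to one component only, so a component feels no constraint but its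
      own; this is \<open>SY\<close>.\<close>
    define Y where "Y J' v = (\<Inter>C\<in>{C \<in> J'. v \<in> D C}. X C v)" for J' v
    have rectY: "(\<Inter>C\<in>J'. A' C) = rect \<mu> (B - {u}) (Y J')" if J': "J' \<subseteq> J" "J' \<noteq> {}" for J'
    proof -
      have "\<phi> \<in> (\<Inter>C\<in>J'. A' C) \<longleftrightarrow> \<phi> \<in> space \<mu> \<and> (\<forall>C\<in>J'. \<forall>v\<in>D C. \<phi> v \<in> X C v)" for \<phi>
        using J' DX(1) by (auto simp: rect_def subset_iff)
      moreover have "D C \<subseteq> B - {u}" if "C \<in> J'" for C
      proof -
        have "C \<in> J" using that J' by blast
        then show ?thesis using DX(3)[of C] B(3) CV[of C] J(2) by blast
      qed
      ultimately show ?thesis unfolding rect_def Y_def by blast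
    qed
    have SY: "S (Y J') C = (if C \<in> J' then S (Y {C}) C else S (\<lambda>_. UNIV) C)"
      if J': "J' \<subseteq> J" and C: "C \<in> K" for J' C
    proof -
      have "Y J' v = (if C \<in> J' then Y {C} v else UNIV)" if v: "v \<in> C \<inter> B" for v
      proof -
        have "C' = C" if "C' \<in> J'" "v \<in> D C'" for C'
        proof -
          have "C' \<in> J" using that J' by blast
          then have "v \<in> C'" "C' \<in> ?Cs" using DX(3) that J(2) by blast+
          then show ?thesis using components_disjoint[of E C' V u C v] sym C K(2) v by blast
        qed
        then have "{C' \<in> J'. v \<in> D C'} = (if C \<in> J' then {C' \<in> {C}. v \<in> D C'} else {})" by auto
        then show ?thesis unfolding Y_def by simp
      qed
      then have "PiE (C \<inter> B) (\<lambda>v. Y J' v \<inter> {1..q})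
          = PiE (C \<inter> B) (\<lambda>v. (if C \<in> J' then Y {C} v else UNIV) \<inter> {1..q})"
        by (intro PiE_cong) simp
      then show ?thesis unfolding S_def by simp
    qed
    have JK: "J \<subseteq> K" by (auto simp: K_def)
    have prodJ: "measure N (\<Inter>C\<in>J'. A' C) = (\<Prod>C\<in>J'. S (Y {C}) C / S (\<lambda>_. UNIV) C)"
      if J': "J' \<subseteq> J" "J' \<noteq> {}" for J'
    proof -
      have "measure N (\<Inter>C\<in>J'. A' C)
          = (\<Prod>C\<in>K. if C \<in> J' then S (Y {C}) C / S (\<lambda>_. UNIV) C else 1)"
        unfolding rectY[OF J'] ratio using SY[OF J'(1)] SU by (intro prod.cong refl) auto
      also have "\<dots> = (\<Prod>C\<in>J'. S (Y {C}) C / S (\<lambda>_. UNIV) C)"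
        using K(1) J' JK by (simp add: prod.If_cases Int_absorb1)
      finally show ?thesis .
    qed
    have "measure N (A' C) = S (Y {C}) C / S (\<lambda>_. UNIV) C" if "C \<in> J" for C
      using prodJ[of "{C}"] that by simp
    then show "N.prob (\<Inter>C\<in>J. A' C) = (\<Prod>C\<in>J. N.prob (A' C))"
      using prodJ[of J] J(1) by simp
  qed
  then have ind: "N.indep_sets (\<lambda>C. sigma_sets (space N) (G C)) ?Cs"
    using Int_stable_rect unfolding G_def by (intro N.indep_sets_sigma)
  show "prob_space.indep_vars (uniform_measure \<mu> ?A) (\<lambda>C. PiM C (\<lambda>_. count_space {1..q}))
      (\<lambda>C \<phi>. restrict \<phi> C) ?Cs"
    unfolding N_def[symmetric] N.indep_vars_def2
  proof (intro conjI ballI)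
    fix C assume "C \<in> ?Cs"
    then show "(\<lambda>\<phi>. restrict \<phi> C) \<in> measurable N (PiM C (\<lambda>_. count_space {1..q}))"
      unfolding measurable_cong_sets[OF spN(2) refl] using CV by (intro measurable_restrict_coord) blast
  next
    show "N.indep_sets (\<lambda>C. {(\<lambda>\<phi>. restrict \<phi> C) -` B \<inter> space N | B.
        B \<in> sets (PiM C (\<lambda>_. count_space {1..q}))}) ?Cs"
    proof (rule N.indep_sets_mono_sets[OF ind])
      fix C assume "C \<in> ?Cs"
      then have "C \<subseteq> V" using CV by blast
      then show "{(\<lambda>\<phi>. restrict \<phi> C) -` B \<inter> space N | B. B \<in> sets (PiM C (\<lambda>_. count_space {1..q}))}
          \<subseteq> sigma_sets (space N) (G C)"
        using restrict_vimage_sigma_rect unfolding G_def spN by blast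
    qed
  qed
qed

end

section \<open>The branching random walk on \<open>H\<close>\<close>

definition deg :: "nat list set \<Rightarrow> nat list \<Rightarrow> nat" where
  "deg W v = card {x \<in> W. tree_E v x}"

lemma deg_insert_leaf:
  assumes W: "subtree r W" and v: "v \<in> W" and new: "a # v \<notin> W"
  shows "deg (insert (a # v) W) (a # v) = 1" "deg (insert (a # v) W) v = Suc (deg W v)"
    and "u \<in> W \<Longrightarrow> u \<noteq> v \<Longrightarrow> deg (insert (a # v) W) u = deg W u"
proof -
  have nb: "tree_E (a # v) x \<longleftrightarrow> x = v" if "x \<in> W" for x
    using that subtreeD(4)[OF W] new unfolding tree_E_def by blast
  have "{x \<in> insert (a # v) W. tree_E (a # v) x} = {v}" using nb v by auto
  then show "deg (insert (a # v) W) (a # v) = 1" by (simp add: deg_def)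
  have "{x \<in> insert (a # v) W. tree_E v x} = insert (a # v) {x \<in> W. tree_E v x}" by auto
  then show "deg (insert (a # v) W) v = Suc (deg W v)"
    using new subtreeD(1)[OF W] by (simp add: deg_def)
  assume u: "u \<in> W" "u \<noteq> v"
  then have "\<not> tree_E u (a # v)" using nb[of u] tree_E_sym by blast
  then have "{x \<in> insert (a # v) W. tree_E u x} = {x \<in> W. tree_E u x}" by auto
  then show "deg (insert (a # v) W) u = deg W u" by (simp add: deg_def)
qed

lemma deg_full:
  assumes "v \<in> tree_V r" "{x \<in> tree_V r. tree_E v x} \<subseteq> W" "W \<subseteq> tree_V r"
  shows "deg W v = Suc r"
proof -
  have "{x \<in> W. tree_E v x} = {x \<in> tree_V r. tree_E v x}" using assms by blast
  then show ?thesis using tree_nbrs(2)[OF assms(1)] by (simp add: deg_def)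
qed

text \<open>Every site carries a choice prepared for each colour its parent may have, and the walk
  reads the one that applies. The dependent colours thus become a function of independent
  coordinates, and a product measure suffices for the construction.\<close>

primrec walk :: "(nat list \<times> nat \<Rightarrow> nat) \<Rightarrow> nat list \<Rightarrow> nat" where
  "walk \<omega> [] = \<omega> ([], 0)"
| "walk \<omega> (a # v) = \<omega> (a # v, walk \<omega> v)"

locale branching_walk = cgraph +
  fixes r :: nat and lam w :: "nat \<Rightarrow> real"
  assumes lam: "\<forall>i\<in>{1..q}. 0 < lam i" and wpos: "\<forall>i\<in>{1..q}. 0 < w i"
    and fixpoint: "\<forall>i\<in>{1..q}. w i = lam i * nsum w i ^ r"
begin

lemma npos: "i \<in> {1..q} \<Longrightarrow> 0 < nsum w i"
  by (rule nsum_pos[OF wpos])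

definition Z :: real where
  "Z = (\<Sum>i\<in>{1..q}. w i * nsum w i)"

lemma Z_pos: "0 < Z"
  unfolding Z_def using q_ge_1 wpos npos by (intro sum_pos) auto

text \<open>An independent choice of a successor for every site and every possible colour of its
  parent; colour \<open>0\<close> marks the root.\<close>

definition step :: "nat list \<times> nat \<Rightarrow> nat measure" where
  "step k = (if snd k \<in> {1..q} then point_measure (nbs (snd k)) (\<lambda>j. ennreal (w j / nsum w (snd k)))
    else point_measure {1..q} (\<lambda>j. ennreal (w j * nsum w j / Z)))"

lemma step_node: "i \<in> {1..q} \<Longrightarrow> step (x, i) = point_measure (nbs i) (\<lambda>j. ennreal (w j / nsum w i))"
  and step_root: "step (x, 0) = point_measure {1..q} (\<lambda>j. ennreal (w j * nsum w j / Z))"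
  by (simp_all add: step_def)

lemma w_nn: "i \<in> {1..q} \<Longrightarrow> 0 \<le> w i"
  using wpos by (auto intro: less_imp_le)

lemma prob_space_step: "prob_space (step k)"
proof (cases "snd k \<in> {1..q}")
  case True
  have "(\<Sum>j\<in>nbs (snd k). ennreal (w j / nsum w (snd k))) = ennreal (\<Sum>j\<in>nbs (snd k). w j / nsum w (snd k))"
    using npos[OF True] w_nn[OF H_in(2)] by (intro sum_ennreal) (auto intro!: divide_nonneg_pos)
  also have "(\<Sum>j\<in>nbs (snd k). w j / nsum w (snd k)) = 1"
    using npos[OF True] by (simp add: sum_divide_distrib[symmetric] nsum_def[symmetric])
  finally show ?thesis
    unfolding step_def using True by (auto intro!: prob_space_point_measure)
next
  case False
  have "(\<Sum>j\<in>{1..q}. ennreal (w j * nsum w j / Z)) = ennreal (\<Sum>j\<in>{1..q}. w j * nsum w j / Z)"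
    using Z_pos wpos npos by (intro sum_ennreal) (simp add: less_imp_le)
  also have "(\<Sum>j\<in>{1..q}. w j * nsum w j / Z) = 1"
    using Z_pos unfolding sum_divide_distrib[symmetric] Z_def[symmetric] by simp
  finally show ?thesis
    unfolding step_def using False by (auto intro!: prob_space_point_measure)
qed

sublocale S: product_prob_space step "tree_V r \<times> {0..q}"
  using prob_space_step by (intro product_prob_spaceI)

abbreviation \<Omega> :: "(nat list \<times> nat \<Rightarrow> nat) measure" where
  "\<Omega> \<equiv> PiM (tree_V r \<times> {0..q}) step"

lemma space_step: "i \<in> {1..q} \<Longrightarrow> space (step (x, i)) = nbs i" "space (step (x, 0)) = {1..q}"
  by (simp_all add: step_node step_root space_point_measure)

lemma sets_step: "A \<subseteq> space (step k) \<Longrightarrow> A \<in> sets (step k)"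
  by (auto simp: step_def space_point_measure sets_point_measure split: if_splits)

lemma coord_step: "\<omega> \<in> space \<Omega> \<Longrightarrow> x \<in> tree_V r \<Longrightarrow> i \<in> {0..q} \<Longrightarrow> \<omega> (x, i) \<in> space (step (x, i))"
  by (auto simp: space_PiM PiE_def Pi_def)

lemma walk_in: "\<omega> \<in> space \<Omega> \<Longrightarrow> v \<in> tree_V r \<Longrightarrow> walk \<omega> v \<in> {1..q}"
  and walk_H: "\<omega> \<in> space \<Omega> \<Longrightarrow> a # v \<in> tree_V r \<Longrightarrow> H (walk \<omega> v) (walk \<omega> (a # v))"
proof -
  have *: "H (walk \<omega> v) (walk \<omega> (a # v))"
    if "\<omega> \<in> space \<Omega>" "a # v \<in> tree_V r" "walk \<omega> v \<in> {1..q}" for \<omega> a v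
    using coord_step[OF that(1,2), of "walk \<omega> v"] that(3) space_step(1)[OF that(3)] by auto
  show in_q: "walk \<omega> v \<in> {1..q}" if "\<omega> \<in> space \<Omega>" "v \<in> tree_V r" for \<omega> v
    using that(2)
  proof (induction v)
    case Nil
    show ?case using coord_step[OF that(1), of "[]" 0] space_step(2) by simp
  next
    case (Cons a v)
    then have "H (walk \<omega> v) (walk \<omega> (a # v))" using * that(1) by (simp add: Cons_in_tree)
    then show ?case by (rule H_in(2))
  qed
  show "H (walk \<omega> v) (walk \<omega> (a # v))" if "\<omega> \<in> space \<Omega>" "a # v \<in> tree_V r"
    using * in_q that by (simp add: Cons_in_tree)
qed

lemma coord_event: "x \<in> tree_V r \<Longrightarrow> i \<in> {0..q} \<Longrightarrow> {\<omega> \<in> space \<Omega>. \<omega> (x, i) = j} \<in> sets \<Omega>"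
proof -
  assume xi: "x \<in> tree_V r" "i \<in> {0..q}"
  have "(\<lambda>\<omega>. \<omega> (x, i)) \<in> measurable \<Omega> (step (x, i))"
    using xi by (intro measurable_component_singleton) auto
  then have "(\<lambda>\<omega>. \<omega> (x, i)) -` ({j} \<inter> space (step (x, i))) \<inter> space \<Omega> \<in> sets \<Omega>"
    by (rule measurable_sets) (intro sets_step, simp)
  also have "(\<lambda>\<omega>. \<omega> (x, i)) -` ({j} \<inter> space (step (x, i))) \<inter> space \<Omega> = {\<omega> \<in> space \<Omega>. \<omega> (x, i) = j}"
    using coord_step xi by auto
  finally show ?thesis .
qed

lemma walk_measurable: "v \<in> tree_V r \<Longrightarrow> (\<lambda>\<omega>. walk \<omega> v) \<in> measurable \<Omega> (count_space {1..q})"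
proof -
  have ev: "{\<omega> \<in> space \<Omega>. walk \<omega> v = j} \<in> sets \<Omega>" if "v \<in> tree_V r" for v j
    using that
  proof (induction v arbitrary: j)
    case Nil
    then show ?case using coord_event[of "[]" 0 j] by simp
  next
    case (Cons a v)
    then have v: "v \<in> tree_V r" by (simp add: Cons_in_tree)
    have "{\<omega> \<in> space \<Omega>. walk \<omega> (a # v) = j}
        = (\<Union>i\<in>{1..q}. {\<omega> \<in> space \<Omega>. walk \<omega> v = i} \<inter> {\<omega> \<in> space \<Omega>. \<omega> (a # v, i) = j})"
      using walk_in[OF _ v] by auto
    also have "\<dots> \<in> sets \<Omega>"
      using Cons.IH[OF v] coord_event[OF Cons.prems] by (intro sets.finite_UN sets.Int) auto
    finally show ?case .
  qed
  assume v: "v \<in> tree_V r"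
  then show ?thesis
    using walk_in ev[OF v] by (subst measurable_count_space_eq2) (auto simp: vimage_def Int_def conj_commute)
qed

definition walk_measure :: "(nat list \<Rightarrow> nat) measure" where
  "walk_measure = distr \<Omega> (hom_space (tree_V r) tree_E q H) (\<lambda>\<omega>. restrict (walk \<omega>) (tree_V r))"

lemma walk_measurable_hom:
  "(\<lambda>\<omega>. restrict (walk \<omega>) (tree_V r)) \<in> measurable \<Omega> (hom_space (tree_V r) tree_E q H)"
  unfolding hom_space_def
proof (rule measurable_restrict_space2)
  show "(\<lambda>\<omega>. restrict (walk \<omega>) (tree_V r)) \<in> space \<Omega> \<rightarrow> hom_set (tree_V r) tree_E q H"
  proof
    fix \<omega> assume \<omega>: "\<omega> \<in> space \<Omega>"
    have "H (walk \<omega> x) (walk \<omega> y)" if "x \<in> tree_V r" "y \<in> tree_V r" "tree_E x y" for x y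
      using that walk_H[OF \<omega>] H_sym unfolding tree_E_def by blast
    then show "restrict (walk \<omega>) (tree_V r) \<in> hom_set (tree_V r) tree_E q H"
      using walk_in[OF \<omega>] unfolding hom_set_def by (simp add: Pi_iff)
  qed
  show "(\<lambda>\<omega>. restrict (walk \<omega>) (tree_V r)) \<in> measurable \<Omega> (PiM (tree_V r) (\<lambda>_. count_space {1..q}))"
    by (intro measurable_restrict walk_measurable)
qed

sublocale walk: prob_space walk_measure
  unfolding walk_measure_def using walk_measurable_hom by (rule S.prob_space_distr)

sublocale walk: hom_measure walk_measure "tree_V r" tree_E q H
  by unfold_locales (simp add: walk_measure_def)

text \<open>The marginal on a finite subtree, written symmetrically: the root plays no special role.\<close>

definition tree_weight :: "nat list set \<Rightarrow> (nat list \<Rightarrow> nat) \<Rightarrow> real" where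
  "tree_weight W c = (if compat tree_E H W c
    then (\<Prod>v\<in>W. w (c v) * nsum w (c v) / nsum w (c v) ^ deg W v) else 0) / Z"

text \<open>The coordinate that the walk consults at \<open>x\<close> if its colours agree with
  \<open>c\<close>.\<close>

definition key :: "(nat list \<Rightarrow> nat) \<Rightarrow> nat list \<Rightarrow> nat list \<times> nat" where
  "key c x = (x, if x = [] then 0 else c (tl x))"

text \<open>A new leaf \<open>x\<close> below \<open>v\<close> has degree 1 and contributes
  \<open>w (c x)\<close>, while the degree of \<open>v\<close> rises by one and contributes
  \<open>1 / nsum w (c v)\<close>. Their product is the transition probability.\<close>

lemma prod_step_eq_tree_weight:
  assumes "subtree r W" "\<forall>v\<in>W. c v \<in> {1..q}"
  shows "(\<Prod>x\<in>W. measure (step (key c x)) ({c x} \<inter> space (step (key c x)))) = tree_weight W c"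
  using assms
proof (induction rule: subtree_induct)
  case Nil
  then have c: "c [] \<in> {1..q}" by simp
  have nn: "0 \<le> w j * nsum w j / Z" if "j \<in> {1..q}" for j
    using w_nn[OF that] npos[OF that] Z_pos by simp
  have k: "key c [] = ([], 0)" by (simp add: key_def)
  have "{c []} \<inter> {1..q} = {c []}" using c by auto
  then have "measure (step (key c [])) ({c []} \<inter> space (step (key c []))) = w (c []) * nsum w (c []) / Z"
    unfolding k space_step step_root using nn c by (subst measure_point_measure_finite_if) auto
  moreover have "deg {[]} [] = 0" by (auto simp: deg_def)
  ultimately show ?case by (simp add: tree_weight_def compat_def)
next
  case (insert W a v)
  let ?x = "a # v"
  note fin = subtreeD(1)[OF insert(1)]
  have c: "c v \<in> {1..q}" "c ?x \<in> {1..q}" using insert by auto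
  note d = deg_insert_leaf[OF insert(1,2,4)]
  have step: "measure (step (key c ?x)) ({c ?x} \<inter> space (step (key c ?x)))
      = (if H (c v) (c ?x) then w (c ?x) / nsum w (c v) else 0)"
  proof -
    have k: "key c ?x = (?x, c v)" by (simp add: key_def)
    have nn: "0 \<le> w j / nsum w (c v)" if "j \<in> nbs (c v)" for j
    proof (rule divide_nonneg_pos)
      show "0 \<le> w j" using that by (intro w_nn H_in(2)[of "c v"]) simp
    qed (rule npos[OF c(1)])
    show ?thesis
    proof (cases "H (c v) (c ?x)")
      case True
      then have "{c ?x} \<inter> nbs (c v) = {c ?x}" by auto
      then show ?thesis unfolding k space_step(1)[OF c(1)] step_node[OF c(1)]
        using nn True by (subst measure_point_measure_finite_if) auto
    next
      case False
      then have "{c ?x} \<inter> nbs (c v) = {}" by auto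
      then show ?thesis unfolding k space_step(1)[OF c(1)] using False by simp
    qed
  qed
  have compat: "compat tree_E H (insert ?x W) c \<longleftrightarrow> compat tree_E H W c \<and> H (c v) (c ?x)"
  proof
    assume "compat tree_E H (insert ?x W) c"
    then show "compat tree_E H W c \<and> H (c v) (c ?x)"
      using insert(2) tree_E_Cons(2)[of v a] unfolding compat_def by blast
  next
    assume *: "compat tree_E H W c \<and> H (c v) (c ?x)"
    have nb: "y = v" if "y \<in> W" "tree_E ?x y \<or> tree_E y ?x" for y
      using that subtreeD(4)[OF insert(1)] insert(4) unfolding tree_E_def by blast
    show "compat tree_E H (insert ?x W) c"
      unfolding compat_def
    proof (intro ballI impI)
      fix y z assume yz: "y \<in> insert ?x W" "z \<in> insert ?x W" "tree_E y z"
      then consider "y \<in> W" "z \<in> W" | "y = ?x" "z \<in> W" | "y \<in> W" "z = ?x"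
        using not_tree_E_refl by blast
      then show "H (c y) (c z)"
      proof cases
        case 1 then show ?thesis using * yz unfolding compat_def by blast
      next
        case 2 then show ?thesis using nb[of z] yz * H_sym by blast
      next
        case 3 then show ?thesis using nb[of y] yz * by blast
      qed
    qed
  qed
  define t where "t W v = w (c v) * nsum w (c v) / nsum w (c v) ^ deg W v" for W v
  have n0: "nsum w (c v) \<noteq> 0" "nsum w (c ?x) \<noteq> 0" using npos[OF c(1)] npos[OF c(2)] by auto
  have tx: "t (insert ?x W) ?x = w (c ?x)" unfolding t_def d(1) using n0 by simp
  have tv: "t (insert ?x W) v = t W v / nsum w (c v)" unfolding t_def d(2) by simp
  have "(\<Prod>u\<in>insert ?x W. t (insert ?x W) u)
      = t (insert ?x W) ?x * (t (insert ?x W) v * (\<Prod>u\<in>W - {v}. t (insert ?x W) u))"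
    using fin insert(2,4) by (simp add: prod.remove)
  also have "(\<Prod>u\<in>W - {v}. t (insert ?x W) u) = (\<Prod>u\<in>W - {v}. t W u)"
    using d(3) by (intro prod.cong refl) (auto simp: t_def)
  also have "t (insert ?x W) ?x * (t (insert ?x W) v * (\<Prod>u\<in>W - {v}. t W u))
      = w (c ?x) / nsum w (c v) * (\<Prod>u\<in>W. t W u)"
    unfolding tx tv using fin insert(2) by (simp add: prod.remove)
  finally have prod: "(\<Prod>u\<in>insert ?x W. t (insert ?x W) u) = w (c ?x) / nsum w (c v) * (\<Prod>u\<in>W. t W u)" .
  have "tree_weight (insert ?x W) c
      = (if H (c v) (c ?x) then w (c ?x) / nsum w (c v) else 0) * tree_weight W c"
    unfolding tree_weight_def compat t_def[symmetric] prod by auto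
  then show ?case
    using fin insert(4) insert(6) insert(7) step by simp
qed

text \<open>This replaces an event about dependent colours by one about coordinates that are
  distinct and fixed in advance, to which the product formula applies. The proof follows the parents
  up to the root.\<close>

lemma walk_eq_iff:
  assumes W: "subtree r W"
  shows "(\<forall>x\<in>W. walk \<omega> x = c x) \<longleftrightarrow> (\<forall>x\<in>W. \<omega> (key c x) = c x)"
proof (intro iffI ballI)
  fix x assume eq: "\<forall>x\<in>W. walk \<omega> x = c x" and x: "x \<in> W"
  show "\<omega> (key c x) = c x"
  proof (cases x)
    case Nil then show ?thesis using eq x by (auto simp: key_def)
  next
    case (Cons a v)
    then have "walk \<omega> v = c v" using eq x subtreeD(4)[OF W] by blast
    moreover have "walk \<omega> (a # v) = c (a # v)" using eq x Cons by blast
    ultimately show ?thesis using Cons by (simp add: key_def)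
  qed
next
  fix x assume eq: "\<forall>x\<in>W. \<omega> (key c x) = c x" and x: "x \<in> W"
  show "walk \<omega> x = c x"
    using x
  proof (induction x)
    case Nil then show ?case using eq by (auto simp: key_def)
  next
    case (Cons a v)
    then have "walk \<omega> v = c v" using subtreeD(4)[OF W] by blast
    moreover have "\<omega> (key c (a # v)) = c (a # v)" using eq Cons by blast
    ultimately show ?case by (simp add: key_def)
  qed
qed

lemma measure_walk_cyl:
  assumes W: "subtree r W" and c: "\<forall>v\<in>W. c v \<in> {1..q}"
  shows "measure walk_measure (cyl walk_measure W c) = tree_weight W c"
proof -
  note fW = subtreeD[OF W]
  let ?J = "key c ` W"
  let ?X = "\<lambda>k. {c (fst k)} \<inter> space (step k)"
  have J: "?J \<subseteq> tree_V r \<times> {0..q}"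
  proof
    fix k assume "k \<in> ?J"
    then obtain x where x: "x \<in> W" "k = key c x" by blast
    then have "tl x \<in> W" using subtree_tl[OF W] by blast
    then show "k \<in> tree_V r \<times> {0..q}" using x c fW(2) by (auto simp: key_def)
  qed
  have inj: "inj_on (key c) W" by (auto simp: inj_on_def key_def)
  have "(\<lambda>\<omega>. restrict (walk \<omega>) (tree_V r)) -` cyl walk_measure W c \<inter> space \<Omega>
      = {\<omega> \<in> space \<Omega>. \<forall>x\<in>W. walk \<omega> x = c x}"
    using measurable_space[OF walk_measurable_hom] fW(2) by (auto simp: cyl_def walk.space_eq)
  also have "\<dots> = {\<omega> \<in> space \<Omega>. \<forall>k\<in>?J. \<omega> k \<in> ?X k}"
  proof -
    have "\<omega> (key c x) = c x \<longleftrightarrow> \<omega> (key c x) \<in> ?X (key c x)" if "\<omega> \<in> space \<Omega>" "x \<in> W" for \<omega> x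
    proof -
      have "\<omega> (key c x) \<in> space (step (key c x))"
        using that J by (auto simp: space_PiM PiE_def Pi_def)
      then show ?thesis by (simp add: key_def)
    qed
    then show ?thesis unfolding walk_eq_iff[OF W] by auto
  qed
  finally have pre: "(\<lambda>\<omega>. restrict (walk \<omega>) (tree_V r)) -` cyl walk_measure W c \<inter> space \<Omega>
      = {\<omega> \<in> space \<Omega>. \<forall>k\<in>?J. \<omega> k \<in> ?X k}" .
  have "cyl walk_measure W c \<in> sets (hom_space (tree_V r) tree_E q H)"
    unfolding walk.sets_eq[symmetric] using fW by (intro walk.cyl_sets)
  then have "emeasure walk_measure (cyl walk_measure W c) = emeasure \<Omega> {\<omega> \<in> space \<Omega>. \<forall>k\<in>?J. \<omega> k \<in> ?X k}"
    unfolding pre[symmetric] by (subst walk_measure_def) (simp add: emeasure_distr walk_measurable_hom)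
  also have "\<dots> = (\<Prod>k\<in>?J. emeasure (step k) (?X k))"
  proof (rule S.emeasure_PiM_Collect[OF J])
    show "?X k \<in> sets (step k)" for k by (rule sets_step) blast
  qed (use fW in simp)
  also have "\<dots> = (\<Prod>x\<in>W. emeasure (step (key c x)) ({c x} \<inter> space (step (key c x))))"
    unfolding prod.reindex[OF inj] by (simp add: key_def)
  also have "\<dots> = (\<Prod>x\<in>W. ennreal (measure (step (key c x)) ({c x} \<inter> space (step (key c x)))))"
    by (simp add: S.M.emeasure_eq_measure)
  also have "\<dots> = ennreal (tree_weight W c)"
    unfolding prod_step_eq_tree_weight[OF W c, symmetric] by (intro prod_ennreal) auto
  finally have "ennreal (measure walk_measure (cyl walk_measure W c)) = ennreal (tree_weight W c)"
    by (simp add: walk.emeasure_eq_measure)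
  moreover have "0 \<le> tree_weight W c"
    unfolding prod_step_eq_tree_weight[OF W c, symmetric] by (intro prod_nonneg) auto
  ultimately show ?thesis by (simp add: ennreal_inj)
qed

text \<open>\<open>tree_weight\<close> refers only to adjacency and degrees within the finite set,
  and both are preserved by an automorphism.\<close>

lemma walk_invariant: "is_invariant (tree_V r) tree_E q H walk_measure"
  unfolding is_invariant_def
proof (intro allI impI)
  fix g assume g: "board_automorphism (tree_V r) tree_E g"
  let ?V = "tree_V r"
  let ?\<nu> = "distr walk_measure (hom_space ?V tree_E q H) (\<lambda>\<phi>. restrict (\<phi> \<circ> g) ?V)"
  have bij: "bij_betw g ?V ?V" using g by (simp add: board_automorphism_def)
  \<comment> \<open>The preimage of the root is put into \<open>W\<close>, so that the image of
    \<open>W\<close> is again a subtree.\<close>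
  obtain p where p: "p \<in> ?V" "g p = []"
    using bij Nil_in_tree by (metis bij_betw_iff_bijections)
  interpret \<nu>: prob_space ?\<nu>
    using walk.automorphism_measurable[OF g] by (rule walk.prob_space_distr)
  interpret \<nu>: hom_measure ?\<nu> ?V tree_E q H by unfold_locales simp
  show "?\<nu> = walk_measure"
  proof (rule hom_measure_eqI[OF \<nu>.hom_measure_axioms walk.hom_measure_axioms])
    fix J assume J: "finite J" "J \<subseteq> ?V"
    define W where "W = suffix_hull (insert p J)"
    have W: "subtree r W" unfolding W_def using J p by (intro subtree_suffix_hull) auto
    have sup: "p \<in> W" "J \<subseteq> W" unfolding W_def using suffix_hull_superset[of "insert p J"] by auto
    note fW = subtreeD(1,2)[OF W]
    have gW: "subtree r (g ` W)" by (rule subtree_image_automorphism[OF g W sup(1) p(2)])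
    have inj: "inj_on g W" using bij fW(2) by (meson bij_betw_def inj_on_subset)
    have E: "tree_E (g x) (g y) \<longleftrightarrow> tree_E x y" if "x \<in> W" "y \<in> W" for x y
      using g fW(2) that unfolding board_automorphism_def by blast
    have deg: "deg (g ` W) (g v) = deg W v" if "v \<in> W" for v
    proof -
      have "{x \<in> g ` W. tree_E (g v) x} = g ` {x \<in> W. tree_E v x}" using E that by auto
      moreover have "inj_on g {x \<in> W. tree_E v x}" using inj by (rule inj_on_subset) auto
      ultimately show ?thesis unfolding deg_def by (simp add: card_image)
    qed
    have eq: "measure ?\<nu> (cyl ?\<nu> W c) = measure walk_measure (cyl walk_measure W c)"
      if c: "c \<in> PiE W (\<lambda>_. {1..q})" for c
    proof -
      define d where "d = c \<circ> inv_into W g"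
      have dg: "d (g v) = c v" if "v \<in> W" for v using that inj by (simp add: d_def)
      have dq: "\<forall>v\<in>g ` W. d v \<in> {1..q}" using dg c by (auto simp: PiE_def Pi_def)
      have cq: "\<forall>v\<in>W. c v \<in> {1..q}" using c by (auto simp: PiE_def Pi_def)
      have "cyl ?\<nu> W c = cyl walk_measure W (d \<circ> g)"
        using dg by (auto simp: cyl_def walk.space_eq)
      then have "measure ?\<nu> (cyl ?\<nu> W c) = measure walk_measure (cyl walk_measure (g ` W) d)"
        using walk.measure_distr_automorphism[OF g fW, of d] by simp
      also have "\<dots> = tree_weight (g ` W) d" by (rule measure_walk_cyl[OF gW dq])
      also have "\<dots> = tree_weight W c"
      proof -
        have "compat tree_E H (g ` W) d \<longleftrightarrow> compat tree_E H W c"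
          unfolding compat_def using E dg by simp
        then show ?thesis
          unfolding tree_weight_def prod.reindex[OF inj] using deg dg by (simp cong: prod.cong)
      qed
      also have "\<dots> = measure walk_measure (cyl walk_measure W c)"
        by (rule measure_walk_cyl[OF W cq, symmetric])
      finally show ?thesis .
    qed
    then show "\<exists>W. finite W \<and> J \<subseteq> W \<and> W \<subseteq> ?V \<and> (\<forall>c\<in>PiE W (\<lambda>_. {1..q}).
        measure ?\<nu> (cyl ?\<nu> W c) = measure walk_measure (cyl walk_measure W c))"
      using fW sup by blast
  qed
qed

text \<open>A site of \<open>U\<close> has all its \<open>r + 1\<close> neighbours in
  \<open>W\<close>, so its factor in \<open>tree_weight\<close> is \<open>w / nsum w ^ r\<close>,
  which is its activity by the fixed-point equation. The sites outside \<open>U\<close> contribute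
  the factor \<open>R\<close>.\<close>

lemma walk_gibbs: "is_gibbs (tree_V r) tree_E q H lam walk_measure"
proof (rule walk.gibbsI[OF walk.prob_space_axioms lam tree_bdry_finite])
  fix U J assume U: "finite U" "U \<subseteq> tree_V r" and J: "finite J" "J \<subseteq> tree_V r"
  let ?V = "tree_V r"
  define B where "B = bdry ?V tree_E U"
  have B: "finite B" "B \<subseteq> ?V" unfolding B_def using tree_bdry_finite[OF U] by (auto simp: bdry_def)
  define W where "W = suffix_hull (J \<union> U \<union> B)"
  have W: "subtree r W" unfolding W_def using U J B by (intro subtree_suffix_hull) auto
  have sup: "J \<subseteq> W" "U \<subseteq> W" "B \<subseteq> W"
    unfolding W_def using suffix_hull_superset[of "J \<union> U \<union> B"] by auto
  note fW = subtreeD(1,2)[OF W]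
  have nb: "y \<in> U \<union> B" if "x \<in> U" "y \<in> ?V" "tree_E x y \<or> tree_E y x" for x y
    using that tree_E_sym unfolding B_def bdry_def by blast
  have degU: "deg W v = Suc r" if "v \<in> U" for v
  proof (rule deg_full)
    show "{x \<in> tree_V r. tree_E v x} \<subseteq> W" using nb[OF that] sup by blast
  qed (use that U fW in auto)
  define t where "t c v = w (c v) * nsum w (c v) / nsum w (c v) ^ deg W v" for c v
  define R where "R d = (if compat tree_E H (W - U) d then \<Prod>v\<in>W - U. t d v else 0) / Z" for d
  have "measure walk_measure (cyl walk_measure W (comb U c d))
      = R d * fillw tree_E H lam U (U \<union> B) (comb U c d)"
    if c: "c \<in> PiE U (\<lambda>_. {1..q})" and d: "d \<in> PiE (W - U) (\<lambda>_. {1..q})" for c d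
  proof -
    let ?e = "comb U c d"
    have eq: "\<forall>v\<in>W. ?e v \<in> {1..q}" using c d by (auto simp: comb_def PiE_def Pi_def)
    have compat: "compat tree_E H W ?e \<longleftrightarrow> compat tree_E H (W - U) d \<and> compat tree_E H (U \<union> B) ?e"
    proof -
      have "compat tree_E H (W - U) d \<longleftrightarrow> compat tree_E H (W - U) ?e"
        by (intro compat_cong) (simp add: comb_def)
      moreover have "compat tree_E H W ?e \<longleftrightarrow> compat tree_E H (W - U) ?e \<and> compat tree_E H (U \<union> B) ?e"
      proof
        assume "compat tree_E H W ?e"
        then show "compat tree_E H (W - U) ?e \<and> compat tree_E H (U \<union> B) ?e"
          using sup unfolding compat_def by blast
      next
        assume *: "compat tree_E H (W - U) ?e \<and> compat tree_E H (U \<union> B) ?e"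
        show "compat tree_E H W ?e"
          unfolding compat_def
        proof (intro ballI impI)
          fix x y assume xy: "x \<in> W" "y \<in> W" "tree_E x y"
          have xyV: "x \<in> ?V" "y \<in> ?V" using xy fW by auto
          consider "x \<in> U" | "y \<in> U" | "x \<in> W - U" "y \<in> W - U" using xy by blast
          then show "H (?e x) (?e y)"
          proof cases
            case 1
            then show ?thesis using nb[OF 1 xyV(2)] xy * unfolding compat_def by blast
          next
            case 2
            then show ?thesis using nb[OF 2 xyV(1)] xy * unfolding compat_def by blast
          next
            case 3
            then show ?thesis using xy * unfolding compat_def by blast
          qed
        qed
      qed
      ultimately show ?thesis by simp
    qed
    have "(\<Prod>v\<in>W. t ?e v) = (\<Prod>v\<in>W - U. t ?e v) * (\<Prod>v\<in>U. t ?e v)"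
      using sup(2) fW(1) by (rule prod.subset_diff)
    also have "(\<Prod>v\<in>W - U. t ?e v) = (\<Prod>v\<in>W - U. t d v)"
      by (intro prod.cong refl) (simp add: t_def comb_def)
    also have "(\<Prod>v\<in>U. t ?e v) = (\<Prod>v\<in>U. lam (?e v))"
    proof (intro prod.cong refl)
      fix v assume v: "v \<in> U"
      then have i: "?e v \<in> {1..q}" using eq sup by blast
      have "nsum w (?e v) \<noteq> 0" using npos[OF i] by simp
      then show "t ?e v = lam (?e v)"
        unfolding t_def degU[OF v] using fixpoint[rule_format, OF i] by (simp add: field_simps)
    qed
    finally have "tree_weight W ?e = R d * fillw tree_E H lam U (U \<union> B) ?e"
      unfolding tree_weight_def R_def fillw_def compat t_def[symmetric] by simp
    then show ?thesis using measure_walk_cyl[OF W eq] by simp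
  qed
  then show "\<exists>W R. finite W \<and> J \<subseteq> W \<and> W \<subseteq> ?V \<and> (\<forall>c\<in>PiE U (\<lambda>_. {1..q}). \<forall>d\<in>PiE (W - U) (\<lambda>_. {1..q}).
      measure walk_measure (cyl walk_measure W (comb U c d))
        = R d * fillw tree_E H lam U (U \<union> bdry ?V tree_E U) (comb U c d))"
    using fW sup(1) unfolding B_def by (intro exI[of _ W] exI[of _ R]) simp
qed

text \<open>No edge joins two components of the tree without \<open>u\<close>, so once the colour of
  \<open>u\<close> is fixed, compatibility and \<open>tree_weight\<close> factorise over the
  components.\<close>

lemma walk_simple: "is_simple (tree_V r) tree_E q H walk_measure"
proof (rule walk.simpleI)
  show "tree_E y x" if "tree_E x y" for x y using that tree_E_sym by blast
  fix u i J
  assume u: "u \<in> tree_V r" and J: "finite J" "J \<subseteq> tree_V r"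
  let ?V = "tree_V r"
  define W where "W = suffix_hull (insert u J)"
  have W: "subtree r W" unfolding W_def using u J by (intro subtree_suffix_hull) auto
  have sup: "u \<in> W" "J \<subseteq> W" unfolding W_def using suffix_hull_superset[of "insert u J"] by auto
  note fW = subtreeD(1,2)[OF W]
  define t where "t c v = w (c v) * nsum w (c v) / nsum w (c v) ^ deg W v" for c v
  define \<kappa> where "\<kappa> = t (\<lambda>_. i) u / Z"
  \<comment> \<open>Each component carries its own edges to \<open>u\<close>; since \<open>u\<close>
    is not one of its sites, the colour \<open>i\<close> is put in by the update.\<close>
  define f where "f C c = (if compat tree_E H (insert u (C \<inter> W)) (c(u := i))
    then \<Prod>v\<in>C \<inter> W. t c v else 0)" for C c
  have "measure walk_measure (cyl walk_measure W c) = \<kappa> * (\<Prod>C\<in>K. f C (restrict c (C \<inter> W)))"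
    if K: "finite K" "K \<subseteq> components_without ?V tree_E u" "W - {u} \<subseteq> \<Union>K"
      and c: "c \<in> PiE W (\<lambda>_. {1..q})" "c u = i" for K c
  proof -
    have CV: "C \<subseteq> ?V - {u}" if "C \<in> K" for C by (rule component_subset) (use K(2) that in blast)
    have compat: "compat tree_E H W c \<longleftrightarrow> (\<forall>C\<in>K. compat tree_E H (insert u (C \<inter> W)) c)"
    proof
      assume "compat tree_E H W c"
      then show "\<forall>C\<in>K. compat tree_E H (insert u (C \<inter> W)) c" using sup(1) unfolding compat_def by blast
    next
      assume *: "\<forall>C\<in>K. compat tree_E H (insert u (C \<inter> W)) c"
      have in_C: "\<exists>C\<in>K. x \<in> C \<inter> W" if "x \<in> W" "x \<noteq> u" for x using K(3) that by blast
      show "compat tree_E H W c"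
        unfolding compat_def
      proof (intro ballI impI)
        fix x y assume xy: "x \<in> W" "y \<in> W" "tree_E x y"
        have "\<exists>C\<in>K. x \<in> insert u (C \<inter> W) \<and> y \<in> insert u (C \<inter> W)"
        proof (cases "x = u \<or> y = u")
          case True
          then show ?thesis using in_C xy not_tree_E_refl by (metis insertI1 insertI2)
        next
          case False
          then obtain C where C: "C \<in> K" "x \<in> C \<inter> W" using in_C xy by blast
          obtain z where z: "C = component ?V tree_E u z"
            using C(1) K(2) unfolding components_without_eq by blast
          have xV: "x \<in> ?V - {u}" "y \<in> ?V - {u}" using xy False fW by auto
          have s: "tree_E b a" if "tree_E a b" for a b using that tree_E_sym by blast
          have "component ?V tree_E u x = C"
            unfolding z by (rule component_eq[OF s]) (use C z in auto)
          moreover have "component ?V tree_E u x = component ?V tree_E u y"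
            by (rule component_adjacent[where E = tree_E, OF s xV xy(3)])
          ultimately have "y \<in> C" using component_refl[OF xV(2), of tree_E] by simp
          then show ?thesis using C xy by blast
        qed
        then show "H (c x) (c y)" using * xy unfolding compat_def by blast
      qed
    qed
    have fC: "f C (restrict c (C \<inter> W)) = (if compat tree_E H (insert u (C \<inter> W)) c
        then \<Prod>v\<in>C \<inter> W. t c v else 0)" if C: "C \<in> K" for C
    proof -
      have "compat tree_E H (insert u (C \<inter> W)) ((restrict c (C \<inter> W))(u := i))
          \<longleftrightarrow> compat tree_E H (insert u (C \<inter> W)) c"
        using c(2) by (intro compat_cong) auto
      moreover have "(\<Prod>v\<in>C \<inter> W. t (restrict c (C \<inter> W)) v) = (\<Prod>v\<in>C \<inter> W. t c v)"
        by (intro prod.cong refl) (simp add: t_def)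
      ultimately show ?thesis unfolding f_def by simp
    qed
    have cover: "W - {u} = (\<Union>C\<in>K. C \<inter> W)"
    proof (intro equalityI subsetI)
      fix x assume "x \<in> W - {u}" then show "x \<in> (\<Union>C\<in>K. C \<inter> W)" using K(3) by blast
    next
      fix x assume "x \<in> (\<Union>C\<in>K. C \<inter> W)" then show "x \<in> W - {u}" using CV by blast
    qed
    have s: "tree_E b a" if "tree_E a b" for a b using that tree_E_sym by blast
    have disj: "\<forall>C\<in>K. \<forall>D\<in>K. C \<noteq> D \<longrightarrow> (C \<inter> W) \<inter> (D \<inter> W) = {}"
    proof (intro ballI impI equals0I)
      fix C D x assume "C \<in> K" "D \<in> K" "C \<noteq> D" "x \<in> (C \<inter> W) \<inter> (D \<inter> W)"
      then show False using components_disjoint[where E = tree_E, OF s, of C ?V u D x] K(2) by blast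
    qed
    have "(\<Prod>v\<in>W. t c v) = t c u * (\<Prod>v\<in>W - {u}. t c v)"
      using fW(1) sup(1) by (rule prod.remove)
    also have "(\<Prod>v\<in>W - {u}. t c v) = (\<Prod>C\<in>K. \<Prod>v\<in>C \<inter> W. t c v)"
      unfolding cover using K(1) fW(1) disj by (intro prod.UNION_disjoint) auto
    finally have prod: "(\<Prod>v\<in>W. t c v) = t (\<lambda>_. i) u * (\<Prod>C\<in>K. \<Prod>v\<in>C \<inter> W. t c v)"
      using c(2) by (simp add: t_def)
    have "(\<Prod>C\<in>K. f C (restrict c (C \<inter> W)))
        = (if compat tree_E H W c then \<Prod>C\<in>K. \<Prod>v\<in>C \<inter> W. t c v else 0)"
    proof (cases "compat tree_E H W c")
      case True
      then show ?thesis using compat fC by (simp cong: prod.cong)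
    next
      case False
      then obtain C where "C \<in> K" "\<not> compat tree_E H (insert u (C \<inter> W)) c" using compat by blast
      then have "\<exists>C\<in>K. f C (restrict c (C \<inter> W)) = 0" using fC by (intro bexI[of _ C]) auto
      then show ?thesis using K(1) False by (simp add: prod_zero)
    qed
    moreover have "measure walk_measure (cyl walk_measure W c) = tree_weight W c"
      using c(1) by (intro measure_walk_cyl[OF W]) (auto simp: PiE_def Pi_def)
    ultimately show ?thesis
      unfolding tree_weight_def t_def[symmetric] prod \<kappa>_def by simp
  qed
  then show "\<exists>B \<kappa> f. finite B \<and> insert u J \<subseteq> B \<and> B \<subseteq> ?V \<and>
      (\<forall>K. finite K \<longrightarrow> K \<subseteq> components_without ?V tree_E u \<longrightarrow> B - {u} \<subseteq> \<Union>K \<longrightarrow>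
        (\<forall>c\<in>PiE B (\<lambda>_. {1..q}). c u = i \<longrightarrow>
          measure walk_measure (cyl walk_measure B c) = \<kappa> * (\<Prod>C\<in>K. f C (restrict c (C \<inter> B)))))"
    using fW sup by (intro exI[of _ W] exI[of _ \<kappa>] exI[of _ f]) simp
qed

end

theorem theorem5p4:
  fixes r q :: nat and H :: "nat \<Rightarrow> nat \<Rightarrow> bool"
  assumes "r \<ge> 1"
    and "constraint_graph q H"
    and "cg_connected q H"
    and "\<exists>i j. H i j"
  shows "\<exists>lam :: nat \<Rightarrow> real. (\<forall>i\<in>{1..q}. lam i > 0) \<and>
           (\<exists>!\<mu>. is_gibbs (tree_V r) tree_E q H lam \<mu> \<and>
                 is_simple (tree_V r) tree_E q H \<mu> \<and>
                 is_invariant (tree_V r) tree_E q H \<mu>)"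
proof -
  interpret cgraph q H using assms by unfold_locales
  obtain lam w where lam: "\<forall>i\<in>{1..q}. 0 < lam i" and w: "\<forall>i\<in>{1..q}. 0 < w i"
    "\<forall>i\<in>{1..q}. w i = lam i * nsum w i ^ r"
    and uniq: "\<And>v. is_weight r lam v \<Longrightarrow> \<exists>t>0. \<forall>i\<in>{1..q}. v i = t * w i"
    using ex_unique_weight[OF assms(1)] by metis
  interpret branching_walk q H r lam w using lam w by unfold_locales
  show ?thesis
  proof (intro exI[of _ lam] conjI lam ex1I[of _ walk_measure] walk_gibbs walk_simple walk_invariant)
    fix \<mu> assume \<mu>: "is_gibbs (tree_V r) tree_E q H lam \<mu> \<and> is_simple (tree_V r) tree_E q H \<mu> \<and>
      is_invariant (tree_V r) tree_E q H \<mu>"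
    have "simple_invariant_gibbs q H r lam \<mu>" "simple_invariant_gibbs q H r lam walk_measure"
      using \<mu> walk_gibbs walk_simple walk_invariant lam by unfold_locales auto
    then show "\<mu> = walk_measure"
      by (rule simple_invariant_gibbs_unique) (rule uniq)
  qed
qed

end
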